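(* Let $R$ be a ring, $f_0\in R$, $I_0=(f_0)$, and let $\{R_i,t_i\}_{i\ge 0}$ be a perfectoid tower arising from the pair $(R,I_0)$. Suppose that $R$ is $f_0$-torsion free. Then the following conditions are equivalent. (1) $R_i$ is completely integrally closed in $R_i[\frac{1}{f_0}]$ for every $i\ge 0$. (2) $R_\infty$ is completely integrally closed in $R_\infty[\frac{1}{f_0}]$. (3) $\widehat{R_\infty}$ is completely integrally closed in $\widehat{R_\infty}[\frac{1}{f_0}]$. Moreover, if $\{R_i,t_i\}_{i\ge 0}$ satisfies these conditions, then so does its tilt $\{R_i^{s.\flat},t_i^{s.\flat}\}_{i\ge 0}$; that is, for a generator $f_0^{s.\flat}$ of the principal ideal $I_0^{s.\flat}$ of $R_0^{s.\flat}$: $R_i^{s.\flat}$ is completely integrally closed in $R_i^{s.\flat}[\frac{1}{f_0^{s.\flat}}]$ for every $i\ge 0$, and (equivalently) the analogues of (2) and (3) hold for $R_\infty^{s.\flat}$ and for its $I_0^{s.\flat}$-adic completion.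
   Context: Fix a prime $p$. All rings are commutative and unital. Torsion: for an ideal $I$ of a ring $A$ and an $A$-module $M$, $x\in M$ is $I$-torsion if for every $a\in I$ there is $n>0$ with $a^nx=0$; $M_{I\text{-tor}}$ is the submodule of $I$-torsion elements; $M$ is $I$-torsion free if $M_{I\text{-tor}}=0$ (for $I=(f)$ one says $f$-torsion free). Complete integral closedness: for a ring extension $A\subseteq B$, $b\in B$ is almost integral over $A$ if the subalgebra $A[b]$ is contained in a finitely generated $A$-submodule of $B$; $A$ is completely integrally closed in $B$ if every $b\in B$ almost integral over $A$ lies in $A$. Towers: a tower $\{R_i,t_i\}_{i\ge0}$ is a sequence of ring maps $R_0\xrightarrow{t_0}R_1\xrightarrow{t_1}R_2\to\cdots$. Let $R$ be a ring and $I\subset R$ an ideal. The tower is a perfectoid tower arising from $(R,I)$ if: (a) $R_0=R$ and $p\in I$. (b) For every $i\ge0$ the map $\overline{t_i}:R_i/IR_i\to R_{i+1}/IR_{i+1}$ induced by $t_i$ is injective. (c) For every $i\ge0$ the Frobenius endomorphism of $R_{i+1}/IR_{i+1}$ factors as $\overline{t_i}\circ F_i$ for a (unique) ring map $F_i:R_{i+1}/IR_{i+1}\to R_i/IR_i$, the $i$-th Frobenius projection. (d) Every $F_i$ is surjective. (e) For every $i\ge0$, $IR_i$ is contained in the Jacobson radical of $R_i$. (f) $I$ is principal and there is a principal ideal $I_1\subset R_1$ with (f-1) $I_1^p=IR_1$, and (f-2) $\ker(F_i)=I_1(R_{i+1}/IR_{i+1})$ for every $i\ge0$. (g) For every $i\ge0$,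 $I(R_i)_{I\text{-tor}}=0$, and there is a (unique) bijection $(F_i)_{\mathrm{tor}}:(R_{i+1})_{I\text{-tor}}\to(R_i)_{I\text{-tor}}$ compatible with $F_i$ via the natural maps $(R_j)_{I\text{-tor}}\to R_j/IR_j$ ($j=i,i+1$). Notation: $R_\infty=\varinjlim_i R_i$, and $\widehat{R_\infty}$ is its $I$-adic completion. Tilt: the $j$-th small tilt is $R_j^{s.\flat}=\varprojlim\{\cdots\to R_{j+i+1}/IR_{j+i+1}\xrightarrow{F_{j+i}}R_{j+i}/IR_{j+i}\to\cdots\xrightarrow{F_j}R_j/IR_j\}$, with transition maps $t_j^{s.\flat}:R_j^{s.\flat}\to R_{j+1}^{s.\flat}$, $(a_i)_{i\ge0}\mapsto(\overline{t_{j+i}}(a_i))_{i\ge0}$. Put $I^{s.\flat}=\ker(R_0^{s.\flat}\to R/I)$ (the $0$-th projection); write $I_0^{s.\flat}$ when $I=I_0$. It is known that $\{R_i^{s.\flat},t_i^{s.\flat}\}$ is a perfectoid tower arising from $(R_0^{s.\flat},I_0^{s.\flat})$ (in particular $I_0^{s.\flat}$ is principal). $R_\infty^{s.\flat}=\varinjlim_iR_i^{s.\flat}$. When $R$ is $f_0$-torsion free, all the rings $R_i$, $R_\infty$, $\widehat{R_\infty}$ are $f_0$-torsion free, and $R_i^{s.\flat}$, $R_\infty^{s.\flat}$ and its completion are $f_0^{s.\flat}$-torsion free, so they embed in their localizations. *)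

theory Defs
  imports "HOL-Algebra.Algebra" "HOL-Computational_Algebra.Primes"
begin

section \<open>Generalities on rings\<close>

definition jacobson_radical :: "'a ring \<Rightarrow> 'a set" where
  "jacobson_radical A = {x \<in> carrier A. \<forall>M. maximalideal M A \<longrightarrow> x \<in> M}"

text \<open>For \<open>h\<close> sending \<open>I\<close> into \<open>J\<close>, the map \<open>A/I \<rightarrow> B/J\<close> induced by \<open>h : A \<rightarrow> B\<close>.  All members
  of the union coincide when the argument is a coset of \<open>I\<close>, so that \<open>I + x\<close> is sent
  to \<open>J + h(x)\<close>.\<close>

definition quot_map :: "'b ring \<Rightarrow> 'b set \<Rightarrow> ('a \<Rightarrow> 'b) \<Rightarrow> 'a set \<Rightarrow> 'b set" where
  "quot_map B J h U = (\<Union>x\<in>U. J +>\<^bsub>B\<^esub> h x)"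

definition inverse_limit :: "(nat \<Rightarrow> 'a ring) \<Rightarrow> (nat \<Rightarrow> 'a \<Rightarrow> 'a) \<Rightarrow> (nat \<Rightarrow> 'a) ring" where
  "inverse_limit Q h =
    \<lparr>carrier = {a. \<forall>i. a i \<in> carrier (Q i) \<and> h i (a (Suc i)) = a i},
     monoid.mult = (\<lambda>a b i. a i \<otimes>\<^bsub>Q i\<^esub> b i),
     one = (\<lambda>i. \<one>\<^bsub>Q i\<^esub>),
     ring.zero = (\<lambda>i. \<zero>\<^bsub>Q i\<^esub>),
     ring.add = (\<lambda>a b i. a i \<oplus>\<^bsub>Q i\<^esub> b i)\<rparr>"

subsection \<open>Torsion\<close>

definition torsion :: "'a ring \<Rightarrow> 'a set \<Rightarrow> ('a, 'b) module \<Rightarrow> 'b set" where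
  "torsion A I M =
    {x \<in> carrier M. \<forall>a\<in>I. \<exists>n::nat. n > 0 \<and> (a [^]\<^bsub>A\<^esub> n) \<odot>\<^bsub>M\<^esub> x = \<zero>\<^bsub>M\<^esub>}"

text \<open>A ring \<open>B\<close> as a module over the source of a ring map \<open>h\<close> into \<open>B\<close>.\<close>

definition module_via :: "('a \<Rightarrow> 'b) \<Rightarrow> 'b ring \<Rightarrow> ('a, 'b) module" where
  "module_via h B =
    \<lparr>carrier = carrier B, monoid.mult = monoid.mult B, one = \<one>\<^bsub>B\<^esub>, ring.zero = \<zero>\<^bsub>B\<^esub>, ring.add = ring.add B,
     smult = (\<lambda>a x. h a \<otimes>\<^bsub>B\<^esub> x)\<rparr>"

definition torsion_free_elt :: "'a ring \<Rightarrow> 'a \<Rightarrow> bool" where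
  "torsion_free_elt A f \<longleftrightarrow> torsion A (Idl\<^bsub>A\<^esub> {f}) (module_via (\<lambda>a. a) A) = {\<zero>\<^bsub>A\<^esub>}"

subsection \<open>Complete integral closedness\<close>

definition almost_integral :: "'a ring \<Rightarrow> 'a set \<Rightarrow> 'a \<Rightarrow> bool" where
  "almost_integral B A b \<longleftrightarrow>
    (\<exists>us. set us \<subseteq> carrier B \<and> ring.simple_extension B A b \<subseteq> ring.Span B A us)"

definition completely_integrally_closed :: "'a ring \<Rightarrow> 'a set \<Rightarrow> bool" where
  "completely_integrally_closed B A \<longleftrightarrow> (\<forall>b\<in>carrier B. almost_integral B A b \<longrightarrow> b \<in> A)"

subsection \<open>The localization \<open>A[1/f]\<close>\<close>

text \<open>The pair \<open>(a, m)\<close> stands for the fraction \<open>a / f\<^sup>m\<close>.\<close>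

definition loc_rel :: "'a ring \<Rightarrow> 'a \<Rightarrow> (('a \<times> nat) \<times> ('a \<times> nat)) set" where
  "loc_rel A f = {((a, m), (b, n)). a \<in> carrier A \<and> b \<in> carrier A \<and>
    (\<exists>k::nat. f [^]\<^bsub>A\<^esub> k \<otimes>\<^bsub>A\<^esub> (f [^]\<^bsub>A\<^esub> n \<otimes>\<^bsub>A\<^esub> a) = f [^]\<^bsub>A\<^esub> k \<otimes>\<^bsub>A\<^esub> (f [^]\<^bsub>A\<^esub> m \<otimes>\<^bsub>A\<^esub> b))}"

definition loc_frac :: "'a ring \<Rightarrow> 'a \<Rightarrow> 'a \<Rightarrow> nat \<Rightarrow> ('a \<times> nat) set" where
  "loc_frac A f a m = loc_rel A f `` {(a, m)}"

definition localization :: "'a ring \<Rightarrow> 'a \<Rightarrow> ('a \<times> nat) set ring" where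
  "localization A f =
    \<lparr>carrier = (carrier A \<times> UNIV) // loc_rel A f,
     monoid.mult = (\<lambda>U V. \<Union>(a, m)\<in>U. \<Union>(b, n)\<in>V. loc_frac A f (a \<otimes>\<^bsub>A\<^esub> b) (m + n)),
     one = loc_frac A f \<one>\<^bsub>A\<^esub> 0,
     ring.zero = loc_frac A f \<zero>\<^bsub>A\<^esub> 0,
     ring.add = (\<lambda>U V. \<Union>(a, m)\<in>U. \<Union>(b, n)\<in>V.
       loc_frac A f ((f [^]\<^bsub>A\<^esub> n \<otimes>\<^bsub>A\<^esub> a) \<oplus>\<^bsub>A\<^esub> (f [^]\<^bsub>A\<^esub> m \<otimes>\<^bsub>A\<^esub> b)) (m + n))\<rparr>"

text \<open>\<open>A\<close> is completely integrally closed in \<open>A[1/f]\<close>; the ring \<open>A\<close> is identified with its image.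
  This map is injective when \<open>A\<close> is \<open>f\<close>-torsion free.\<close>

definition cic_in_localization :: "'a ring \<Rightarrow> 'a \<Rightarrow> bool" where
  "cic_in_localization A f \<longleftrightarrow>
    completely_integrally_closed (localization A f) ((\<lambda>a. loc_frac A f a 0) ` carrier A)"

subsection \<open>Adic completion\<close>

text \<open>In the monoid \<open>ideals_set A\<close> of ideals, \<open>J [^] n\<close> is the \<open>n\<close>-th power of the ideal \<open>J\<close>.\<close>

definition adic_completion :: "'a ring \<Rightarrow> 'a set \<Rightarrow> (nat \<Rightarrow> 'a set) ring" where
  "adic_completion A J =
    inverse_limit (\<lambda>n. A Quot (J [^]\<^bsub>ideals_set A\<^esub> n))
      (\<lambda>n. quot_map A (J [^]\<^bsub>ideals_set A\<^esub> n) (\<lambda>x. x))"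

definition to_completion :: "'a ring \<Rightarrow> 'a set \<Rightarrow> 'a \<Rightarrow> nat \<Rightarrow> 'a set" where
  "to_completion A J a = (\<lambda>n. (J [^]\<^bsub>ideals_set A\<^esub> n) +>\<^bsub>A\<^esub> a)"

section \<open>Towers of rings\<close>

text \<open>All rings of a tower have their elements in one type \<open>'a\<close>.  As \<open>'a\<close> is
  arbitrary and the carriers may overlap or differ, this is no restriction.\<close>

definition ring_tower :: "(nat \<Rightarrow> 'a ring) \<Rightarrow> (nat \<Rightarrow> 'a \<Rightarrow> 'a) \<Rightarrow> bool" where
  "ring_tower R t \<longleftrightarrow> (\<forall>i. cring (R i) \<and> t i \<in> ring_hom (R i) (R (Suc i)))"

text \<open>The composite \<open>t\<^bsub>j-1\<^esub> \<circ> \<dots> \<circ> t\<^bsub>i\<^esub> : R\<^bsub>i\<^esub> \<rightarrow> R\<^bsub>j\<^esub>\<close>, for \<open>i \<le> j\<close>.\<close>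

definition tower_map :: "(nat \<Rightarrow> 'a \<Rightarrow> 'a) \<Rightarrow> nat \<Rightarrow> nat \<Rightarrow> 'a \<Rightarrow> 'a" where
  "tower_map t i j = fold t [i..<j]"

subsection \<open>The direct limit\<close>

definition colim_rel ::
  "(nat \<Rightarrow> 'a ring) \<Rightarrow> (nat \<Rightarrow> 'a \<Rightarrow> 'a) \<Rightarrow> ((nat \<times> 'a) \<times> (nat \<times> 'a)) set" where
  "colim_rel R t = {((i, x), (j, y)). x \<in> carrier (R i) \<and> y \<in> carrier (R j) \<and>
    (\<exists>k\<ge>max i j. tower_map t i k x = tower_map t j k y)}"

definition to_colim ::
  "(nat \<Rightarrow> 'a ring) \<Rightarrow> (nat \<Rightarrow> 'a \<Rightarrow> 'a) \<Rightarrow> nat \<Rightarrow> 'a \<Rightarrow> (nat \<times> 'a) set" where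
  "to_colim R t i x = colim_rel R t `` {(i, x)}"

definition tower_colim :: "(nat \<Rightarrow> 'a ring) \<Rightarrow> (nat \<Rightarrow> 'a \<Rightarrow> 'a) \<Rightarrow> (nat \<times> 'a) set ring" where
  "tower_colim R t =
    \<lparr>carrier = (SIGMA i:UNIV. carrier (R i)) // colim_rel R t,
     monoid.mult = (\<lambda>U V. \<Union>(i, x)\<in>U. \<Union>(j, y)\<in>V. to_colim R t (max i j)
       (tower_map t i (max i j) x \<otimes>\<^bsub>R (max i j)\<^esub> tower_map t j (max i j) y)),
     one = to_colim R t 0 \<one>\<^bsub>R 0\<^esub>,
     ring.zero = to_colim R t 0 \<zero>\<^bsub>R 0\<^esub>,
     ring.add = (\<lambda>U V. \<Union>(i, x)\<in>U. \<Union>(j, y)\<in>V. to_colim R t (max i j)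
       (tower_map t i (max i j) x \<oplus>\<^bsub>R (max i j)\<^esub> tower_map t j (max i j) y))\<rparr>"

definition colim_ideal ::
  "(nat \<Rightarrow> 'a ring) \<Rightarrow> (nat \<Rightarrow> 'a \<Rightarrow> 'a) \<Rightarrow> 'a set \<Rightarrow> (nat \<times> 'a) set set" where
  "colim_ideal R t I = Idl\<^bsub>tower_colim R t\<^esub> (to_colim R t 0 ` I)"

subsection \<open>Perfectoid towers\<close>

definition level_ideal ::
  "(nat \<Rightarrow> 'a ring) \<Rightarrow> (nat \<Rightarrow> 'a \<Rightarrow> 'a) \<Rightarrow> 'a set \<Rightarrow> nat \<Rightarrow> 'a set" where
  "level_ideal R t I i = Idl\<^bsub>R i\<^esub> (tower_map t 0 i ` I)"

definition level_quot ::
  "(nat \<Rightarrow> 'a ring) \<Rightarrow> (nat \<Rightarrow> 'a \<Rightarrow> 'a) \<Rightarrow> 'a set \<Rightarrow> nat \<Rightarrow> 'a set ring" where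
  "level_quot R t I i = R i Quot level_ideal R t I i"

definition level_map ::
  "(nat \<Rightarrow> 'a ring) \<Rightarrow> (nat \<Rightarrow> 'a \<Rightarrow> 'a) \<Rightarrow> 'a set \<Rightarrow> nat \<Rightarrow> 'a set \<Rightarrow> 'a set" where
  "level_map R t I i = quot_map (R (Suc i)) (level_ideal R t I (Suc i)) (t i)"

definition frob_factor ::
  "nat \<Rightarrow> (nat \<Rightarrow> 'a ring) \<Rightarrow> (nat \<Rightarrow> 'a \<Rightarrow> 'a) \<Rightarrow> 'a set \<Rightarrow> nat \<Rightarrow> ('a set \<Rightarrow> 'a set) \<Rightarrow> bool" where
  "frob_factor p R t I i F \<longleftrightarrow>
    F \<in> ring_hom (level_quot R t I (Suc i)) (level_quot R t I i) \<and>
    (\<forall>x\<in>carrier (level_quot R t I (Suc i)).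
      x [^]\<^bsub>level_quot R t I (Suc i)\<^esub> p = level_map R t I i (F x))"

text \<open>When \<open>level_map R t I i\<close> is injective, a map as in \<open>frob_factor\<close> is determined on the carrier;
  \<open>extensional\<close> fixes its values elsewhere.\<close>

definition frob_proj ::
  "nat \<Rightarrow> (nat \<Rightarrow> 'a ring) \<Rightarrow> (nat \<Rightarrow> 'a \<Rightarrow> 'a) \<Rightarrow> 'a set \<Rightarrow> nat \<Rightarrow> 'a set \<Rightarrow> 'a set" where
  "frob_proj p R t I i =
    (THE F. F \<in> extensional (carrier (level_quot R t I (Suc i))) \<and> frob_factor p R t I i F)"

definition level_torsion ::
  "(nat \<Rightarrow> 'a ring) \<Rightarrow> (nat \<Rightarrow> 'a \<Rightarrow> 'a) \<Rightarrow> 'a set \<Rightarrow> nat \<Rightarrow> 'a set" where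
  "level_torsion R t I i = torsion (R 0) I (module_via (tower_map t 0 i) (R i))"

definition perfectoid_tower ::
  "nat \<Rightarrow> 'a ring \<Rightarrow> 'a set \<Rightarrow> (nat \<Rightarrow> 'a ring) \<Rightarrow> (nat \<Rightarrow> 'a \<Rightarrow> 'a) \<Rightarrow> bool" where
  "perfectoid_tower p A I R t \<longleftrightarrow>
    cring A \<and> ideal I A \<and> ring_tower R t \<and>
    R 0 = A \<and> add_pow A p \<one>\<^bsub>A\<^esub> \<in> I \<and>
    (\<forall>i. inj_on (level_map R t I i) (carrier (level_quot R t I i))) \<and>
    (\<forall>i. \<exists>F. frob_factor p R t I i F) \<and>
    (\<forall>i. frob_proj p R t I i ` carrier (level_quot R t I (Suc i))
                = carrier (level_quot R t I i)) \<and>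
    (\<forall>i. level_ideal R t I i \<subseteq> jacobson_radical (R i)) \<and>
    principalideal I A \<and>
      (\<exists>I\<^sub>1. principalideal I\<^sub>1 (R 1) \<and>
        I\<^sub>1 [^]\<^bsub>ideals_set (R 1)\<^esub> p = level_ideal R t I 1 \<and>
        (\<forall>i. a_kernel (level_quot R t I (Suc i)) (level_quot R t I i) (frob_proj p R t I i)
          = Idl\<^bsub>level_quot R t I (Suc i)\<^esub>
              ((\<lambda>x. level_ideal R t I (Suc i) +>\<^bsub>R (Suc i)\<^esub> tower_map t 1 (Suc i) x) ` I\<^sub>1))) \<and>
    (\<forall>i. (\<forall>a\<in>I. \<forall>x\<in>level_torsion R t I i. tower_map t 0 i a \<otimes>\<^bsub>R i\<^esub> x = \<zero>\<^bsub>R i\<^esub>) \<and>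
      (\<exists>G. bij_betw G (level_torsion R t I (Suc i)) (level_torsion R t I i) \<and>
        (\<forall>x\<in>level_torsion R t I (Suc i).
          frob_proj p R t I i (level_ideal R t I (Suc i) +>\<^bsub>R (Suc i)\<^esub> x)
            = level_ideal R t I i +>\<^bsub>R i\<^esub> G x)))"

subsection \<open>The tilt\<close>

definition small_tilt ::
  "nat \<Rightarrow> (nat \<Rightarrow> 'a ring) \<Rightarrow> (nat \<Rightarrow> 'a \<Rightarrow> 'a) \<Rightarrow> 'a set \<Rightarrow> nat \<Rightarrow> (nat \<Rightarrow> 'a set) ring" where
  "small_tilt p R t I j =
    inverse_limit (\<lambda>i. level_quot R t I (j + i)) (\<lambda>i. frob_proj p R t I (j + i))"

definition small_tilt_map ::
  "(nat \<Rightarrow> 'a ring) \<Rightarrow> (nat \<Rightarrow> 'a \<Rightarrow> 'a) \<Rightarrow> 'a set \<Rightarrow> nat \<Rightarrow> (nat \<Rightarrow> 'a set) \<Rightarrow> (nat \<Rightarrow> 'a set)" where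
  "small_tilt_map R t I j a = (\<lambda>i. level_map R t I (j + i) (a i))"

definition small_tilt_ideal ::
  "nat \<Rightarrow> (nat \<Rightarrow> 'a ring) \<Rightarrow> (nat \<Rightarrow> 'a \<Rightarrow> 'a) \<Rightarrow> 'a set \<Rightarrow> (nat \<Rightarrow> 'a set) set" where
  "small_tilt_ideal p R t I = a_kernel (small_tilt p R t I 0) (level_quot R t I 0) (\<lambda>a. a 0)"

subsection \<open>Complete integral closedness along a tower\<close>

text \<open>\<open>f\<close> is an element of \<open>R 0\<close>, and the completion is taken with respect to the
  ideal generated by \<open>f\<close>.\<close>

definition levels_cic :: "(nat \<Rightarrow> 'a ring) \<Rightarrow> (nat \<Rightarrow> 'a \<Rightarrow> 'a) \<Rightarrow> 'a \<Rightarrow> bool" where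
  "levels_cic R t f \<longleftrightarrow> (\<forall>i. cic_in_localization (R i) (tower_map t 0 i f))"

definition colim_cic :: "(nat \<Rightarrow> 'a ring) \<Rightarrow> (nat \<Rightarrow> 'a \<Rightarrow> 'a) \<Rightarrow> 'a \<Rightarrow> bool" where
  "colim_cic R t f \<longleftrightarrow> cic_in_localization (tower_colim R t) (to_colim R t 0 f)"

definition completed_colim_cic :: "(nat \<Rightarrow> 'a ring) \<Rightarrow> (nat \<Rightarrow> 'a \<Rightarrow> 'a) \<Rightarrow> 'a \<Rightarrow> bool" where
  "completed_colim_cic R t f \<longleftrightarrow>
    (let S = tower_colim R t; J = colim_ideal R t (Idl\<^bsub>R 0\<^esub> {f})
     in cic_in_localization (adic_completion S J) (to_completion S J (to_colim R t 0 f)))"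

end

theory Submission
  imports Defs
begin

text \<open>For a regular element \<open>f\<close> of a ring \<open>A\<close>, the fraction \<open>a/f\<close> is almost integral over \<open>A\<close> iff
  one power \<open>f\<^sup>m\<close> clears the denominators of all its powers, i.e. \<open>f\<^sup>n\<close> divides \<open>f\<^sup>m a\<^sup>n\<close> for all \<open>n\<close>.
  So \<open>A\<close> is completely integrally closed in \<open>A[1/f]\<close> iff such an \<open>a\<close> is always divisible by \<open>f\<close>
  (\<open>cic_in_localization_iff\<close>).  This criterion, called \<open>power_closed\<close>, speaks only about
  divisibility by powers of \<open>f\<close>.

  It passes between a ring \<open>C\<close> and a family of rings mapping to \<open>C\<close>, provided that the maps reflect
  divisibility by powers of \<open>f\<close> and that every element of \<open>C\<close> is congruent modulo \<open>f\<close> to an image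
  (\<open>power_closed_transfer\<close>).  In a perfectoid tower without \<open>f\<close>-torsion, injectivity of the maps modulo
  \<open>f\<close> implies injectivity modulo \<open>f\<^sup>n\<close>, so the levels \<open>R\<^sub>i\<close> and their direct limit are such a family;
  a ring and its \<open>f\<close>-adic completion are another.  This gives the equivalence of the three conditions,
  for every tower in which \<open>f\<close> is regular and the maps are injective modulo \<open>f\<close>.

  The tilt is such a tower for a generator \<open>g\<close> of its ideal.  Dropping the first component identifies
  the \<open>j\<close>-th small tilt with the next one and turns the transition map into the \<open>p\<close>-th power; from
  this, the kernel of the projection to \<open>R\<^sub>j/f\<close> is generated by the image of \<open>g\<close> for every \<open>j\<close>
  (\<open>kernel_next_level\<close>), and \<open>g\<close> is regular (\<open>G_annihilates_component\<close>).

  It remains to see that \<open>g\<close> divides an element \<open>c\<close> of the \<open>j\<close>-th small tilt, i.e. that \<open>c\<^sub>0 = 0\<close>, if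
  \<open>g\<^sup>n\<close> divides \<open>g\<^sup>m c\<^sup>n\<close> for all \<open>n\<close>.  The component \<open>g\<^sub>i\<close> is a \<open>p\<^sup>i\<close>-th root of zero modulo \<open>f\<close>, and,
  because \<open>f\<close> lies in the Jacobson radical, the \<open>p\<^sup>i\<close>-th power of any lift \<open>\<Gamma>\<^sub>i\<close> of it to \<open>R\<^sub>j\<^sub>+\<^sub>i\<close> divides \<open>f\<close>
  if \<open>i > 0\<close> (\<open>lift_power_divides\<close>).  If \<open>C\<close> lifts \<open>c\<^sub>0\<close>, the hypothesis for \<open>n = p\<^sup>i\<close> says that \<open>f\<close> divides
  \<open>\<Gamma>\<^sub>i\<^sup>m C\<close> in \<open>R\<^sub>j\<^sub>+\<^sub>i\<close>.  Taking \<open>n\<close>-th powers with \<open>m n \<le> p\<^sup>i\<close> yields that \<open>f\<^sup>n\<close> divides \<open>f C\<^sup>n\<close>, first in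
  \<open>R\<^sub>j\<^sub>+\<^sub>i\<close> and then in \<open>R\<^sub>j\<close>.  So \<open>C/f\<close> is almost integral over \<open>R\<^sub>j\<close>, hence \<open>f\<close> divides \<open>C\<close>
  (\<open>power_closed_tilt\<close>).\<close>

section \<open>Complete integral closedness in a localization\<close>

text \<open>The operations of a localization and of a direct limit are unions over pairs of representatives;
  such a union is a single value once it does not depend on the representatives.\<close>
lemma UN_pairs_constant:
  assumes "(a0, m0) \<in> U" "(b0, n0) \<in> V"
    and "\<And>a m b n. (a, m) \<in> U \<Longrightarrow> (b, n) \<in> V \<Longrightarrow> g a m b n = c"
  shows "(\<Union>(a, m)\<in>U. \<Union>(b, n)\<in>V. g a m b n) = c"
proof (intro equalityI subsetI)
  fix x assume "x \<in> (\<Union>(a, m)\<in>U. \<Union>(b, n)\<in>V. g a m b n)"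
  then show "x \<in> c" using assms(3) by blast
next
  fix x assume "x \<in> c"
  then have "x \<in> g a0 m0 b0 n0" using assms by simp
  then show "x \<in> (\<Union>(a, m)\<in>U. \<Union>(b, n)\<in>V. g a m b n)" using assms(1,2) by blast
qed

definition regular_elt :: "('a, 'b) ring_scheme \<Rightarrow> 'a \<Rightarrow> bool" where
  "regular_elt A f \<longleftrightarrow> f \<in> carrier A \<and> (\<forall>x\<in>carrier A. f \<otimes>\<^bsub>A\<^esub> x = \<zero>\<^bsub>A\<^esub> \<longrightarrow> x = \<zero>\<^bsub>A\<^esub>)"

text \<open>For regular \<open>f\<close> this is complete integral closedness of \<open>A\<close> in \<open>A[1/f]\<close>, expressed inside \<open>A\<close>: the
  condition on \<open>a\<close> says that \<open>f\<^sup>m (a/f)\<^sup>n\<close> lies in \<open>A\<close> for all \<open>n\<close>.\<close>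
definition power_closed :: "('a, 'b) ring_scheme \<Rightarrow> 'a \<Rightarrow> bool" where
  "power_closed A f \<longleftrightarrow> (\<forall>a\<in>carrier A.
    (\<exists>m::nat. \<forall>n::nat. f [^]\<^bsub>A\<^esub> n divides\<^bsub>A\<^esub> f [^]\<^bsub>A\<^esub> m \<otimes>\<^bsub>A\<^esub> a [^]\<^bsub>A\<^esub> n) \<longrightarrow> f divides\<^bsub>A\<^esub> a)"

lemma regular_elt_closed: "regular_elt A f \<Longrightarrow> f \<in> carrier A"
  by (simp add: regular_elt_def)

lemma (in cring) regular_elt_cancel:
  assumes "regular_elt R f" "x \<in> carrier R" "y \<in> carrier R" "f \<otimes> x = f \<otimes> y"
  shows "x = y"
proof -
  have f: "f \<in> carrier R" using assms(1) by (rule regular_elt_closed)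
  have "f \<otimes> (x \<ominus> y) = \<zero>"
    using assms(2-4) f by (simp add: a_minus_def r_distr r_minus r_neg)
  then have "x \<ominus> y = \<zero>" using assms(1-3) by (simp add: regular_elt_def)
  then show ?thesis using assms(2,3) by (simp add: r_right_minus_eq)
qed

lemma (in cring) regular_elt_pow:
  assumes "regular_elt R f"
  shows "regular_elt R (f [^] (n::nat))"
proof (induction n)
  case 0
  then show ?case by (simp add: regular_elt_def)
next
  case (Suc n)
  have f: "f \<in> carrier R" using assms by (rule regular_elt_closed)
  show ?case
    unfolding regular_elt_def
  proof (intro conjI ballI impI)
    fix x assume x: "x \<in> carrier R" and "f [^] Suc n \<otimes> x = \<zero>"
    then have "f [^] n \<otimes> (f \<otimes> x) = \<zero>" using f by (simp add: m_assoc)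
    then have "f \<otimes> x = \<zero>" using Suc f x unfolding regular_elt_def by blast
    then show "x = \<zero>" using assms x unfolding regular_elt_def by blast
  qed (use f in simp)
qed

lemma (in cring) pow_cancel:
  assumes "regular_elt R f" "x \<in> carrier R" "y \<in> carrier R" "f [^] (n::nat) \<otimes> x = f [^] n \<otimes> y"
  shows "x = y"
  using regular_elt_cancel[OF regular_elt_pow[OF assms(1), of n] assms(2-4)] .

locale regular_cring = cring R for R :: "'a ring" (structure) +
  fixes f :: 'a
  assumes regular: "regular_elt R f"
begin

lemma f_closed [simp]: "f \<in> carrier R"
  using regular by (rule regular_elt_closed)

lemma loc_rel_iff:
  "((a, m), (b, n)) \<in> loc_rel R f \<longleftrightarrow>
    a \<in> carrier R \<and> b \<in> carrier R \<and> f [^] n \<otimes> a = f [^] m \<otimes> b"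
proof -
  have "f [^] n \<otimes> a = f [^] m \<otimes> b"
    if "a \<in> carrier R" "b \<in> carrier R" "f [^] k \<otimes> (f [^] n \<otimes> a) = f [^] k \<otimes> (f [^] m \<otimes> b)"
    for k :: nat
    using pow_cancel[OF regular _ _ that(3)] that by simp
  then show ?thesis
    unfolding loc_rel_def by (auto intro: exI[of _ 0])
qed

lemma equiv_loc_rel: "equiv (carrier R \<times> UNIV) (loc_rel R f)"
proof (rule equivI)
  show "loc_rel R f \<subseteq> (carrier R \<times> UNIV) \<times> (carrier R \<times> UNIV)"
    by (auto simp: loc_rel_def)
  show "refl_on (carrier R \<times> UNIV) (loc_rel R f)"
    by (auto simp: refl_on_def loc_rel_iff)
  show "sym (loc_rel R f)"
    unfolding sym_def by (metis loc_rel_iff surj_pair)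
  show "trans (loc_rel R f)"
  proof (rule transI, clarsimp simp: loc_rel_iff)
    fix a b c and l m n :: nat
    assume c: "a \<in> carrier R" "b \<in> carrier R" "c \<in> carrier R"
      and ab: "f [^] m \<otimes> a = f [^] l \<otimes> b" and bc: "f [^] n \<otimes> b = f [^] m \<otimes> c"
    have "f [^] m \<otimes> (f [^] n \<otimes> a) = f [^] n \<otimes> (f [^] m \<otimes> a)"
      using c by (simp add: m_lcomm)
    also have "\<dots> = f [^] l \<otimes> (f [^] n \<otimes> b)"
      unfolding ab using c by (simp add: m_lcomm)
    also have "\<dots> = f [^] m \<otimes> (f [^] l \<otimes> c)"
      unfolding bc using c by (simp add: m_lcomm)
    finally show "f [^] n \<otimes> a = f [^] l \<otimes> c"
      by (rule pow_cancel[OF regular, rotated 2]) (use c in auto)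
  qed
qed

lemma loc_frac_eq_iff:
  assumes "a \<in> carrier R" "b \<in> carrier R"
  shows "loc_frac R f a m = loc_frac R f b n \<longleftrightarrow> f [^] n \<otimes> a = f [^] m \<otimes> b"
  unfolding loc_frac_def using eq_equiv_class_iff[OF equiv_loc_rel, of "(a,m)" "(b,n)"] assms
  by (simp add: loc_rel_iff)

lemma loc_carrier: "carrier (localization R f) = {loc_frac R f a m | a m. a \<in> carrier R}"
  by (auto simp: localization_def quotient_def loc_frac_def)

lemma mem_loc_frac:
  assumes "a \<in> carrier R"
  shows "(b, n) \<in> loc_frac R f a m \<longleftrightarrow> b \<in> carrier R \<and> f [^] n \<otimes> a = f [^] m \<otimes> b"
  using assms by (simp add: loc_frac_def loc_rel_iff)

lemma loc_mult:
  assumes a: "a \<in> carrier R" and b: "b \<in> carrier R"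
  shows "loc_frac R f a m \<otimes>\<^bsub>localization R f\<^esub> loc_frac R f b n = loc_frac R f (a \<otimes> b) (m + n)"
proof -
  have "loc_frac R f (a' \<otimes> b') (m' + n') = loc_frac R f (a \<otimes> b) (m + n)"
    if "(a', m') \<in> loc_frac R f a m" "(b', n') \<in> loc_frac R f b n" for a' b' m' n'
  proof -
    have c: "a' \<in> carrier R" "b' \<in> carrier R"
      and ea: "f [^] m' \<otimes> a = f [^] m \<otimes> a'" and eb: "f [^] n' \<otimes> b = f [^] n \<otimes> b'"
      using that a b by (auto simp: mem_loc_frac)
    have "f [^] (m' + n') \<otimes> (a \<otimes> b) = (f [^] m' \<otimes> a) \<otimes> (f [^] n' \<otimes> b)"
      using a b by (simp add: nat_pow_mult[symmetric] m_ac)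
    also have "\<dots> = f [^] (m + n) \<otimes> (a' \<otimes> b')"
      using a b c unfolding ea eb by (simp add: nat_pow_mult[symmetric] m_ac)
    finally show ?thesis
      using a b c by (simp add: loc_frac_eq_iff)
  qed
  moreover have "(a, m) \<in> loc_frac R f a m" "(b, n) \<in> loc_frac R f b n"
    using a b by (auto simp: mem_loc_frac)
  ultimately show ?thesis
    unfolding localization_def monoid.simps ring.simps by (intro UN_pairs_constant)
qed

lemma loc_add:
  assumes a: "a \<in> carrier R" and b: "b \<in> carrier R"
  shows "loc_frac R f a m \<oplus>\<^bsub>localization R f\<^esub> loc_frac R f b n =
    loc_frac R f (f [^] n \<otimes> a \<oplus> f [^] m \<otimes> b) (m + n)"
proof -
  have "loc_frac R f (f [^] n' \<otimes> a' \<oplus> f [^] m' \<otimes> b') (m' + n') =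
      loc_frac R f (f [^] n \<otimes> a \<oplus> f [^] m \<otimes> b) (m + n)"
    if "(a', m') \<in> loc_frac R f a m" "(b', n') \<in> loc_frac R f b n" for a' b' m' n'
  proof -
    have c: "a' \<in> carrier R" "b' \<in> carrier R"
      and ea: "f [^] m' \<otimes> a = f [^] m \<otimes> a'" and eb: "f [^] n' \<otimes> b = f [^] n \<otimes> b'"
      using that a b by (auto simp: mem_loc_frac)
    have "f [^] (m' + n') \<otimes> (f [^] n \<otimes> a \<oplus> f [^] m \<otimes> b) =
        f [^] (n + n') \<otimes> (f [^] m' \<otimes> a) \<oplus> f [^] (m + m') \<otimes> (f [^] n' \<otimes> b)"
      using a b by (simp add: nat_pow_mult[symmetric] m_ac r_distr)
    also have "\<dots> = f [^] (m + n) \<otimes> (f [^] n' \<otimes> a' \<oplus> f [^] m' \<otimes> b')"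
      using a b c unfolding ea eb by (simp add: nat_pow_mult[symmetric] m_ac r_distr)
    finally show ?thesis
      using a b c by (simp add: loc_frac_eq_iff)
  qed
  moreover have "(a, m) \<in> loc_frac R f a m" "(b, n) \<in> loc_frac R f b n"
    using a b by (auto simp: mem_loc_frac)
  ultimately show ?thesis
    unfolding localization_def monoid.simps ring.simps by (intro UN_pairs_constant)
qed

lemma loc_zero: "\<zero>\<^bsub>localization R f\<^esub> = loc_frac R f \<zero> 0"
  by (simp add: localization_def)

lemma loc_one: "\<one>\<^bsub>localization R f\<^esub> = loc_frac R f \<one> 0"
  by (simp add: localization_def)

lemma loc_frac_closed: "a \<in> carrier R \<Longrightarrow> loc_frac R f a m \<in> carrier (localization R f)"
  by (auto simp: loc_carrier)

lemma loc_cases: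
  assumes "x \<in> carrier (localization R f)"
  obtains a m where "a \<in> carrier R" "x = loc_frac R f a m"
  using assms by (auto simp: loc_carrier)

lemma ring_localization: "ring (localization R f)"
proof (rule ringI)
  show "abelian_group (localization R f)"
  proof (rule abelian_groupI)
    fix x assume "x \<in> carrier (localization R f)"
    then obtain a m where x: "a \<in> carrier R" "x = loc_frac R f a m" by (rule loc_cases)
    have "loc_frac R f (\<ominus> a) m \<oplus>\<^bsub>localization R f\<^esub> x = \<zero>\<^bsub>localization R f\<^esub>"
      using x by (simp add: loc_add loc_zero loc_frac_eq_iff r_minus l_neg)
    then show "\<exists>y\<in>carrier (localization R f). y \<oplus>\<^bsub>localization R f\<^esub> x = \<zero>\<^bsub>localization R f\<^esub>"
      using x loc_frac_closed by blast
  qed (auto elim!: loc_cases simp: loc_add loc_zero loc_frac_closed loc_frac_eq_iff r_distr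
      nat_pow_mult[symmetric] m_ac a_ac add_ac)
  show "Group.monoid (localization R f)"
    by (rule monoidI)
      (auto elim!: loc_cases simp: loc_mult loc_one loc_frac_closed m_assoc add.assoc)
qed (elim loc_cases, simp add: loc_add loc_mult loc_frac_closed loc_frac_eq_iff r_distr
      nat_pow_mult[symmetric] m_ac a_ac add_ac)+

lemma loc_pow_mem_simple_extension:
  assumes a: "a \<in> carrier R"
  shows "loc_frac R f (a [^] n) (k * n) \<in>
    ring.simple_extension (localization R f) ((\<lambda>a. loc_frac R f a 0) ` carrier R) (loc_frac R f a k)"
    (is "_ \<in> ring.simple_extension ?B ?A ?b")
proof -
  interpret B: ring ?B by (rule ring_localization)
  show ?thesis
  proof (induction n)
    case 0
    have "\<zero>\<^bsub>?B\<^esub> \<otimes>\<^bsub>?B\<^esub> ?b \<oplus>\<^bsub>?B\<^esub> loc_frac R f \<one> 0 \<in> B.simple_extension ?A ?b"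
      by (rule B.simple_extension.lin) auto
    moreover have "loc_frac R f (f [^] k) k = loc_frac R f \<one> 0"
      by (simp add: loc_frac_eq_iff)
    ultimately show ?case
      using a by (simp add: loc_zero loc_mult loc_add)
  next
    case (Suc n)
    have "loc_frac R f (a [^] n) (k * n) \<otimes>\<^bsub>?B\<^esub> ?b \<oplus>\<^bsub>?B\<^esub> loc_frac R f \<zero> 0 \<in> B.simple_extension ?A ?b"
      using Suc.IH by (rule B.simple_extension.lin) auto
    then show ?case
      using a by (simp add: loc_mult loc_add add.commute)
  qed
qed

text \<open>Only the finitely many generators contribute denominators, since the coefficients come from the
  ring itself.\<close>
lemma loc_Span_common_denominator:
  assumes "set us \<subseteq> carrier (localization R f)"
  shows "\<exists>M. ring.Span (localization R f) ((\<lambda>a. loc_frac R f a 0) ` carrier R) us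
    \<subseteq> (\<lambda>a. loc_frac R f a M) ` carrier R"
proof -
  interpret B: ring "localization R f" by (rule ring_localization)
  show ?thesis
    using assms
  proof (induction us)
    case Nil
    then show ?case by (auto simp: loc_zero intro!: exI[of _ 0])
  next
    case (Cons u us)
    then obtain M where M: "B.Span ((\<lambda>a. loc_frac R f a 0) ` carrier R) us
        \<subseteq> (\<lambda>a. loc_frac R f a M) ` carrier R" by auto
    obtain b m where u: "b \<in> carrier R" "u = loc_frac R f b m"
      using Cons.prems by (auto elim: loc_cases)
    have "B.Span ((\<lambda>a. loc_frac R f a 0) ` carrier R) (u # us)
        \<subseteq> (\<lambda>a. loc_frac R f a (m + M)) ` carrier R"
    proof
      fix x assume "x \<in> B.Span ((\<lambda>a. loc_frac R f a 0) ` carrier R) (u # us)"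
      then obtain a v where a: "a \<in> carrier R" and v: "v \<in> B.Span ((\<lambda>a. loc_frac R f a 0) ` carrier R) us"
        and x: "x = loc_frac R f a 0 \<otimes>\<^bsub>localization R f\<^esub> u \<oplus>\<^bsub>localization R f\<^esub> v"
        by (auto simp: B.line_extension_mem_iff)
      obtain c where c: "c \<in> carrier R" "v = loc_frac R f c M" using v M by auto
      show "x \<in> (\<lambda>a. loc_frac R f a (m + M)) ` carrier R"
        unfolding x u(2) c(2) using a c(1) u(1) by (simp add: loc_mult loc_add)
    qed
    then show ?case by blast
  qed
qed

text \<open>A finitely generated submodule has a common denominator, which then bounds all powers of a
  fraction; conversely, a bound \<open>f\<^sup>m\<close> puts the algebra generated by the fraction into the cyclic module
  generated by \<open>1/f\<^sup>m\<close>.\<close>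
lemma almost_integral_localization:
  assumes a: "a \<in> carrier R"
  shows "almost_integral (localization R f) ((\<lambda>a. loc_frac R f a 0) ` carrier R) (loc_frac R f a k)
    \<longleftrightarrow> (\<exists>m::nat. \<forall>n::nat. f [^] (k * n) divides f [^] m \<otimes> a [^] n)"
    (is "almost_integral ?B ?A ?b \<longleftrightarrow> ?P")
proof -
  interpret B: ring ?B by (rule ring_localization)
  show ?thesis
  proof
    assume "almost_integral ?B ?A ?b"
    then obtain us where us: "set us \<subseteq> carrier ?B" "B.simple_extension ?A ?b \<subseteq> B.Span ?A us"
      unfolding almost_integral_def by blast
    then obtain M where M: "B.Span ?A us \<subseteq> (\<lambda>a. loc_frac R f a M) ` carrier R"
      using loc_Span_common_denominator by blast
    have "f [^] (k * n) divides f [^] M \<otimes> a [^] n" for n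
    proof -
      have "loc_frac R f (a [^] n) (k * n) \<in> (\<lambda>a. loc_frac R f a M) ` carrier R"
        using loc_pow_mem_simple_extension[OF a] us(2) M by blast
      then obtain c where "c \<in> carrier R" "loc_frac R f (a [^] n) (k * n) = loc_frac R f c M" by blast
      then show ?thesis using a by (auto simp: loc_frac_eq_iff)
    qed
    then show ?P by blast
  next
    assume ?P
    then obtain m :: nat where m: "\<And>n::nat. f [^] (k * n) divides f [^] m \<otimes> a [^] n" by blast
    \<comment> \<open>The bound for \<open>x\<close> alone is not inherited by \<open>x b + y\<close>; the bound for all \<open>x b\<^sup>n\<close> is.\<close>
    have stable: "\<exists>c l. c \<in> carrier R \<and> x = loc_frac R f c l \<and>
        (\<forall>n::nat. f [^] (l + k * n) divides f [^] m \<otimes> (c \<otimes> a [^] n))"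
      if "x \<in> B.simple_extension ?A ?b" for x
      using that
    proof (induction rule: B.simple_extension.induct)
      case zero
      have "f [^] (0 + k * n) divides f [^] m \<otimes> (\<zero> \<otimes> a [^] n)" for n
        using a by (auto simp: factor_def intro!: bexI[of _ \<zero>])
      then show ?case by (metis loc_zero zero_closed)
    next
      case (lin x y)
      then obtain c l b where c: "c \<in> carrier R" "x = loc_frac R f c l"
        and div: "\<And>n::nat. f [^] (l + k * n) divides f [^] m \<otimes> (c \<otimes> a [^] n)"
        and b: "b \<in> carrier R" "y = loc_frac R f b 0" by blast
      have eq: "x \<otimes>\<^bsub>?B\<^esub> ?b \<oplus>\<^bsub>?B\<^esub> y = loc_frac R f (c \<otimes> a \<oplus> f [^] (l + k) \<otimes> b) (l + k)"
        using a b c by (simp add: loc_mult loc_add)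
      have "f [^] (l + k + k * n) divides f [^] m \<otimes> ((c \<otimes> a \<oplus> f [^] (l + k) \<otimes> b) \<otimes> a [^] n)" for n
      proof -
        obtain d where d: "d \<in> carrier R" "f [^] m \<otimes> (c \<otimes> a [^] Suc n) = f [^] (l + k * Suc n) \<otimes> d"
          using div[of "Suc n"] by (auto simp: factor_def)
        obtain d' where d': "d' \<in> carrier R" "f [^] m \<otimes> a [^] n = f [^] (k * n) \<otimes> d'"
          using m[of n] by (auto simp: factor_def)
        have "f [^] m \<otimes> ((c \<otimes> a \<oplus> f [^] (l + k) \<otimes> b) \<otimes> a [^] n) =
            f [^] m \<otimes> (c \<otimes> a [^] Suc n) \<oplus> f [^] (l + k) \<otimes> b \<otimes> (f [^] m \<otimes> a [^] n)"
          using a b c by (simp add: l_distr r_distr m_ac)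
        also have "\<dots> = f [^] (l + k + k * n) \<otimes> (d \<oplus> b \<otimes> d')"
          unfolding d(2) d'(2) using b d(1) d'(1)
          by (simp add: r_distr nat_pow_mult[symmetric] m_ac)
        finally show ?thesis using b d(1) d'(1) by auto
      qed
      then show ?case
        unfolding eq using a b c by (intro exI[of _ "c \<otimes> a \<oplus> f [^] (l + k) \<otimes> b"] exI[of _ "l + k"]) simp
    qed
    have "B.simple_extension ?A ?b \<subseteq> B.Span ?A [loc_frac R f \<one> m]"
    proof
      fix x assume "x \<in> B.simple_extension ?A ?b"
      then obtain c l where c: "c \<in> carrier R" "x = loc_frac R f c l"
        and div: "\<And>n::nat. f [^] (l + k * n) divides f [^] m \<otimes> (c \<otimes> a [^] n)"
        using stable by blast
      obtain d where d: "d \<in> carrier R" "f [^] m \<otimes> c = f [^] l \<otimes> d"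
        using div[of 0] a c(1) by (auto simp: factor_def)
      have "x = loc_frac R f d 0 \<otimes>\<^bsub>?B\<^esub> loc_frac R f \<one> m \<oplus>\<^bsub>?B\<^esub> \<zero>\<^bsub>?B\<^esub>"
        using c d by (simp add: loc_mult loc_add loc_zero loc_frac_eq_iff)
      then show "x \<in> B.Span ?A [loc_frac R f \<one> m]"
        using d(1) by (auto simp: B.line_extension_mem_iff)
    qed
    then show "almost_integral ?B ?A ?b"
      unfolding almost_integral_def
      by (intro exI[of _ "[loc_frac R f \<one> m]"]) (simp add: loc_frac_closed del: B.Span.simps)
  qed
qed

text \<open>Denominators \<open>f\<close> suffice: if \<open>a/f\<^sup>k\<^sup>+\<^sup>1\<close> is almost integral, so is its multiple \<open>a/f\<close>; hence \<open>f\<close>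
  divides \<open>a\<close> and the exponent of the denominator drops.\<close>
theorem cic_in_localization_iff: "cic_in_localization R f \<longleftrightarrow> power_closed R f"
proof
  assume cic: "cic_in_localization R f"
  show "power_closed R f"
    unfolding power_closed_def
  proof (intro ballI impI)
    fix a assume a: "a \<in> carrier R"
      and "\<exists>m::nat. \<forall>n::nat. f [^] n divides f [^] m \<otimes> a [^] n"
    then have "almost_integral (localization R f) ((\<lambda>a. loc_frac R f a 0) ` carrier R) (loc_frac R f a 1)"
      by (simp add: almost_integral_localization)
    then have "loc_frac R f a 1 \<in> (\<lambda>a. loc_frac R f a 0) ` carrier R"
      using cic loc_frac_closed[OF a]
      unfolding cic_in_localization_def completely_integrally_closed_def by blast
    then obtain c where "c \<in> carrier R" "loc_frac R f a 1 = loc_frac R f c 0" by blast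
    then show "f divides a" using a by (auto simp: loc_frac_eq_iff)
  qed
next
  assume pc: "power_closed R f"
  have "loc_frac R f a k \<in> (\<lambda>a. loc_frac R f a 0) ` carrier R"
    if a: "a \<in> carrier R"
      and ai: "almost_integral (localization R f) ((\<lambda>a. loc_frac R f a 0) ` carrier R) (loc_frac R f a k)"
    for a k
    using a ai
  proof (induction k arbitrary: a)
    case 0
    then show ?case by blast
  next
    case (Suc k)
    obtain m :: nat where m: "\<And>n::nat. f [^] (Suc k * n) divides f [^] m \<otimes> a [^] n"
      using Suc.prems almost_integral_localization by blast
    have "f [^] n divides f [^] m \<otimes> a [^] n" for n :: nat
    proof (rule divides_trans[OF _ m])
      have "f [^] (Suc k * n) = f [^] n \<otimes> f [^] (k * n)" by (simp add: nat_pow_mult)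
      then show "f [^] n divides f [^] (Suc k * n)" by auto
    qed simp
    then obtain b where b: "b \<in> carrier R" "a = f \<otimes> b"
      using pc Suc.prems(1) unfolding power_closed_def factor_def by blast
    have eq: "loc_frac R f a (Suc k) = loc_frac R f b k"
      using b by (simp add: loc_frac_eq_iff m_assoc)
    show ?case
      using Suc.IH[OF b(1)] Suc.prems(2) unfolding eq by blast
  qed
  then show "cic_in_localization R f"
    unfolding cic_in_localization_def completely_integrally_closed_def by (auto elim!: loc_cases)
qed

end

section \<open>Transfer along a family of ring maps\<close>

text \<open>Bounds for \<open>a\<close> in \<open>R i\<close> are mapped to bounds in \<open>C\<close>, and divisibility by \<open>f\<close> comes back by reflection.
  In the other direction an element of \<open>C\<close> is replaced by an image congruent to it modulo \<open>f\<close>, which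
  satisfies the same bound and is divisible by \<open>f\<close> iff the original element is.  A direct limit is
  covered by the images of many rings; a completion receives one ring with dense image.\<close>
lemma power_closed_transfer:
  assumes R: "\<And>i. cring (R i)" and C: "cring C"
    and h: "\<And>i. h i \<in> ring_hom (R i) C"
    and F: "\<And>i. F i \<in> carrier (R i)" "\<And>i. h i (F i) = f"
    and reflect: "\<And>i (n::nat) a. a \<in> carrier (R i) \<Longrightarrow> f [^]\<^bsub>C\<^esub> n divides\<^bsub>C\<^esub> h i a
      \<Longrightarrow> F i [^]\<^bsub>R i\<^esub> n divides\<^bsub>R i\<^esub> a"
    and approx: "\<And>x. x \<in> carrier C \<Longrightarrow>
      \<exists>i. \<exists>a\<in>carrier (R i). \<exists>y\<in>carrier C. x = h i a \<oplus>\<^bsub>C\<^esub> f \<otimes>\<^bsub>C\<^esub> y"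
  shows "(\<forall>i. power_closed (R i) (F i)) \<longleftrightarrow> power_closed C f"
proof -
  interpret C: cring C by (rule C)
  have f: "f \<in> carrier C" using F ring_hom_closed[OF h] by metis
  have hom: "ring_hom_cring (R i) C (h i)" for i
    by (intro ring_hom_cring.intro ring_hom_cring_axioms.intro R C h)
  have h_pow: "h i (F i [^]\<^bsub>R i\<^esub> (m::nat) \<otimes>\<^bsub>R i\<^esub> a [^]\<^bsub>R i\<^esub> (n::nat)) = f [^]\<^bsub>C\<^esub> m \<otimes>\<^bsub>C\<^esub> h i a [^]\<^bsub>C\<^esub> n"
    if "a \<in> carrier (R i)" for i a m n
  proof -
    interpret ring_hom_cring "R i" C "h i" by (rule hom)
    show ?thesis using that F by simp
  qed
  show ?thesis
  proof (intro iffI allI)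
    assume pc: "\<forall>i. power_closed (R i) (F i)"
    show "power_closed C f"
      unfolding power_closed_def
    proof (intro ballI impI)
      fix x assume x: "x \<in> carrier C"
        and "\<exists>m::nat. \<forall>n::nat. f [^]\<^bsub>C\<^esub> n divides\<^bsub>C\<^esub> f [^]\<^bsub>C\<^esub> m \<otimes>\<^bsub>C\<^esub> x [^]\<^bsub>C\<^esub> n"
      then obtain m :: nat where m: "\<And>n::nat. f [^]\<^bsub>C\<^esub> n divides\<^bsub>C\<^esub> f [^]\<^bsub>C\<^esub> m \<otimes>\<^bsub>C\<^esub> x [^]\<^bsub>C\<^esub> n"
        by blast
      obtain i a y where a: "a \<in> carrier (R i)" and y: "y \<in> carrier C"
        and xy: "x = h i a \<oplus>\<^bsub>C\<^esub> f \<otimes>\<^bsub>C\<^esub> y"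
        using approx[OF x] by blast
      define z where "z = \<ominus>\<^bsub>C\<^esub> y"
      have z: "z \<in> carrier C" using y by (simp add: z_def)
      have ha: "h i a \<in> carrier C" using a h ring_hom_closed by metis
      have ha_eq: "h i a = x \<oplus>\<^bsub>C\<^esub> f \<otimes>\<^bsub>C\<^esub> z"
        unfolding xy z_def using ha y f by (simp add: C.r_minus C.a_assoc C.r_neg)
      \<comment> \<open>Writing one factor \<open>h i a\<close> as \<open>x + f z\<close> turns it either into a factor \<open>x\<close> or into an explicit
        factor \<open>f\<close>; both keep the exponent \<open>n + k\<close>, which is why mixed products have to be considered.\<close>
      have step: "f [^]\<^bsub>C\<^esub> (n + k) divides\<^bsub>C\<^esub> f [^]\<^bsub>C\<^esub> m \<otimes>\<^bsub>C\<^esub> (h i a [^]\<^bsub>C\<^esub> n \<otimes>\<^bsub>C\<^esub> x [^]\<^bsub>C\<^esub> k)" for n k :: nat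
      proof (induction n arbitrary: k)
        case 0
        then show ?case using m[of k] x by simp
      next
        case (Suc n)
        obtain c where c: "c \<in> carrier C"
          "f [^]\<^bsub>C\<^esub> m \<otimes>\<^bsub>C\<^esub> (h i a [^]\<^bsub>C\<^esub> n \<otimes>\<^bsub>C\<^esub> x [^]\<^bsub>C\<^esub> Suc k) = f [^]\<^bsub>C\<^esub> (n + Suc k) \<otimes>\<^bsub>C\<^esub> c"
          using Suc[of "Suc k"] by (auto simp: factor_def)
        obtain d where d: "d \<in> carrier C"
          "f [^]\<^bsub>C\<^esub> m \<otimes>\<^bsub>C\<^esub> (h i a [^]\<^bsub>C\<^esub> n \<otimes>\<^bsub>C\<^esub> x [^]\<^bsub>C\<^esub> k) = f [^]\<^bsub>C\<^esub> (n + k) \<otimes>\<^bsub>C\<^esub> d"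
          using Suc[of k] by (auto simp: factor_def)
        have "f [^]\<^bsub>C\<^esub> m \<otimes>\<^bsub>C\<^esub> (h i a [^]\<^bsub>C\<^esub> Suc n \<otimes>\<^bsub>C\<^esub> x [^]\<^bsub>C\<^esub> k) =
          f [^]\<^bsub>C\<^esub> m \<otimes>\<^bsub>C\<^esub> ((h i a [^]\<^bsub>C\<^esub> n \<otimes>\<^bsub>C\<^esub> (x \<oplus>\<^bsub>C\<^esub> f \<otimes>\<^bsub>C\<^esub> z)) \<otimes>\<^bsub>C\<^esub> x [^]\<^bsub>C\<^esub> k)"
          using arg_cong[OF ha_eq, of "\<lambda>u. f [^]\<^bsub>C\<^esub> m \<otimes>\<^bsub>C\<^esub> ((h i a [^]\<^bsub>C\<^esub> n \<otimes>\<^bsub>C\<^esub> u) \<otimes>\<^bsub>C\<^esub> x [^]\<^bsub>C\<^esub> k)"] by simp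
        also have "\<dots> = f [^]\<^bsub>C\<^esub> m \<otimes>\<^bsub>C\<^esub> (h i a [^]\<^bsub>C\<^esub> n \<otimes>\<^bsub>C\<^esub> x [^]\<^bsub>C\<^esub> Suc k) \<oplus>\<^bsub>C\<^esub>
          f \<otimes>\<^bsub>C\<^esub> z \<otimes>\<^bsub>C\<^esub> (f [^]\<^bsub>C\<^esub> m \<otimes>\<^bsub>C\<^esub> (h i a [^]\<^bsub>C\<^esub> n \<otimes>\<^bsub>C\<^esub> x [^]\<^bsub>C\<^esub> k))"
          using ha x z f by (simp add: C.l_distr C.r_distr C.m_ac)
        also have "\<dots> = f [^]\<^bsub>C\<^esub> (Suc n + k) \<otimes>\<^bsub>C\<^esub> (c \<oplus>\<^bsub>C\<^esub> z \<otimes>\<^bsub>C\<^esub> d)"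
          unfolding c(2) d(2) using c(1) d(1) z f by (simp add: C.r_distr C.m_ac)
        finally show ?case using c(1) d(1) z by (auto simp: factor_def)
      qed
      have "F i [^]\<^bsub>R i\<^esub> n divides\<^bsub>R i\<^esub> F i [^]\<^bsub>R i\<^esub> m \<otimes>\<^bsub>R i\<^esub> a [^]\<^bsub>R i\<^esub> n" for n :: nat
      proof (rule reflect)
        interpret Ri: cring "R i" by (rule R)
        show "F i [^]\<^bsub>R i\<^esub> m \<otimes>\<^bsub>R i\<^esub> a [^]\<^bsub>R i\<^esub> n \<in> carrier (R i)" using a F by simp
        show "f [^]\<^bsub>C\<^esub> n divides\<^bsub>C\<^esub> h i (F i [^]\<^bsub>R i\<^esub> m \<otimes>\<^bsub>R i\<^esub> a [^]\<^bsub>R i\<^esub> n)"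
          using step[of n 0] ha by (simp add: h_pow[OF a])
      qed
      then obtain b where b: "b \<in> carrier (R i)" "a = F i \<otimes>\<^bsub>R i\<^esub> b"
        using pc a unfolding power_closed_def factor_def by blast
      have "h i a = f \<otimes>\<^bsub>C\<^esub> h i b"
        unfolding b(2) using ring_hom_mult[OF h F(1) b(1)] F(2) by simp
      then have "x = f \<otimes>\<^bsub>C\<^esub> (h i b \<oplus>\<^bsub>C\<^esub> y)"
        unfolding xy using b(1) y f ring_hom_closed[OF h] by (simp add: C.r_distr)
      then show "f divides\<^bsub>C\<^esub> x"
        using b(1) y ring_hom_closed[OF h] by (auto simp: factor_def)
    qed
  next
    fix i
    assume pc: "power_closed C f"
    interpret Ri: cring "R i" by (rule R)
    interpret ring_hom_cring "R i" C "h i" by (rule hom)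
    show "power_closed (R i) (F i)"
      unfolding power_closed_def
    proof (intro ballI impI)
      fix a assume a: "a \<in> carrier (R i)"
        and "\<exists>m::nat. \<forall>n::nat. F i [^]\<^bsub>R i\<^esub> n divides\<^bsub>R i\<^esub> F i [^]\<^bsub>R i\<^esub> m \<otimes>\<^bsub>R i\<^esub> a [^]\<^bsub>R i\<^esub> n"
      then obtain m :: nat where m: "\<And>n::nat. F i [^]\<^bsub>R i\<^esub> n divides\<^bsub>R i\<^esub> F i [^]\<^bsub>R i\<^esub> m \<otimes>\<^bsub>R i\<^esub> a [^]\<^bsub>R i\<^esub> n"
        by blast
      have "f [^]\<^bsub>C\<^esub> n divides\<^bsub>C\<^esub> f [^]\<^bsub>C\<^esub> m \<otimes>\<^bsub>C\<^esub> h i a [^]\<^bsub>C\<^esub> n" for n :: nat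
      proof -
        obtain c where c: "c \<in> carrier (R i)"
          "F i [^]\<^bsub>R i\<^esub> m \<otimes>\<^bsub>R i\<^esub> a [^]\<^bsub>R i\<^esub> n = F i [^]\<^bsub>R i\<^esub> n \<otimes>\<^bsub>R i\<^esub> c"
          using m[of n] unfolding factor_def by blast
        have "f [^]\<^bsub>C\<^esub> m \<otimes>\<^bsub>C\<^esub> h i a [^]\<^bsub>C\<^esub> n = f [^]\<^bsub>C\<^esub> n \<otimes>\<^bsub>C\<^esub> h i c"
          unfolding h_pow[OF a, symmetric] c(2) using F c(1) by simp
        then show ?thesis using c(1) by (auto simp: factor_def)
      qed
      then have "f divides\<^bsub>C\<^esub> h i a"
        using pc a unfolding power_closed_def by blast
      then have "F i [^]\<^bsub>R i\<^esub> (1::nat) divides\<^bsub>R i\<^esub> a"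
        using reflect[OF a, of 1] f by simp
      then show "F i divides\<^bsub>R i\<^esub> a" using F by simp
    qed
  qed
qed

section \<open>Inverse limits and direct limits of rings\<close>

lemma inverse_limit_carrier:
  "a \<in> carrier (inverse_limit Q h) \<longleftrightarrow> (\<forall>i. a i \<in> carrier (Q i) \<and> h i (a (Suc i)) = a i)"
  by (simp add: inverse_limit_def)

lemma inverse_limit_simps:
  "(a \<otimes>\<^bsub>inverse_limit Q h\<^esub> b) i = a i \<otimes>\<^bsub>Q i\<^esub> b i"
  "(a \<oplus>\<^bsub>inverse_limit Q h\<^esub> b) i = a i \<oplus>\<^bsub>Q i\<^esub> b i"
  "\<one>\<^bsub>inverse_limit Q h\<^esub> i = \<one>\<^bsub>Q i\<^esub>"
  "\<zero>\<^bsub>inverse_limit Q h\<^esub> i = \<zero>\<^bsub>Q i\<^esub>"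
  by (simp_all add: inverse_limit_def)

lemma inverse_limit_pow: "(a [^]\<^bsub>inverse_limit Q h\<^esub> (n::nat)) i = a i [^]\<^bsub>Q i\<^esub> n"
  by (induction n) (simp_all add: inverse_limit_simps)

lemma cring_inverse_limit:
  assumes Q: "\<And>i. cring (Q i)" and h: "\<And>i. h i \<in> ring_hom (Q (Suc i)) (Q i)"
  shows "cring (inverse_limit Q h)" (is "cring ?L")
proof -
  interpret Q: cring "Q i" for i by (rule Q)
  interpret h: ring_hom_cring "Q (Suc i)" "Q i" "h i" for i
    by (intro ring_hom_cring.intro ring_hom_cring_axioms.intro Q h)
  note simps = inverse_limit_carrier inverse_limit_simps fun_eq_iff
  show ?thesis
  proof (rule cringI)
    show "abelian_group ?L"
    proof (rule abelian_groupI)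
      fix x assume x: "x \<in> carrier ?L"
      show "\<exists>y\<in>carrier ?L. y \<oplus>\<^bsub>?L\<^esub> x = \<zero>\<^bsub>?L\<^esub>"
        using x by (intro bexI[of _ "\<lambda>i. \<ominus>\<^bsub>Q i\<^esub> x i"]) (auto simp: simps Q.l_neg)
    qed (auto simp: simps Q.a_ac)
    show "comm_monoid ?L"
      by (rule comm_monoidI) (auto simp: simps Q.m_ac)
  qed (auto simp: simps Q.l_distr)
qed

lemma tower_map_refl [simp]: "tower_map t i i x = x"
  by (simp add: tower_map_def)

lemma tower_map_Suc: "i \<le> j \<Longrightarrow> tower_map t i (Suc j) x = t j (tower_map t i j x)"
  by (simp add: tower_map_def)

lemma tower_map_comp:
  "i \<le> j \<Longrightarrow> j \<le> k \<Longrightarrow> tower_map t j k (tower_map t i j x) = tower_map t i k x"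
proof (induction k)
  case (Suc k)
  then show ?case by (cases "j = Suc k") (simp_all add: tower_map_Suc)
qed (simp add: tower_map_def)

locale tower =
  fixes R :: "nat \<Rightarrow> 'a ring" and t :: "nat \<Rightarrow> 'a \<Rightarrow> 'a"
  assumes ring_tower: "ring_tower R t"
begin

lemma R_cring: "cring (R i)"
  using ring_tower by (simp add: ring_tower_def)

lemma t_hom: "t i \<in> ring_hom (R i) (R (Suc i))"
  using ring_tower by (simp add: ring_tower_def)

sublocale Ri: cring "R i" for i by (rule R_cring)

lemma tower_map_hom: "i \<le> j \<Longrightarrow> tower_map t i j \<in> ring_hom (R i) (R j)"
proof (induction j)
  case 0
  then show ?case by (auto intro!: ring_hom_memI)
next
  case (Suc j)
  show ?case
  proof (cases "i = Suc j")
    case True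
    then show ?thesis by (auto intro!: ring_hom_memI)
  next
    case False
    then have "i \<le> j" using Suc.prems by simp
    moreover have "tower_map t i (Suc j) = t j \<circ> tower_map t i j"
      using \<open>i \<le> j\<close> by (auto simp: tower_map_Suc)
    ultimately show ?thesis
      using ring_hom_trans[OF Suc.IH t_hom] by (simp only:)
  qed
qed

lemma tower_map_hom_cring: "i \<le> j \<Longrightarrow> ring_hom_cring (R i) (R j) (tower_map t i j)"
  by (intro ring_hom_cring.intro ring_hom_cring_axioms.intro R_cring tower_map_hom)

lemma tower_map_closed: "i \<le> j \<Longrightarrow> x \<in> carrier (R i) \<Longrightarrow> tower_map t i j x \<in> carrier (R j)"
  using tower_map_hom ring_hom_closed by metis

lemma equiv_colim_rel: "equiv (SIGMA i:UNIV. carrier (R i)) (colim_rel R t)"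
proof (rule equivI)
  show "colim_rel R t \<subseteq> (SIGMA i:UNIV. carrier (R i)) \<times> (SIGMA i:UNIV. carrier (R i))"
    by (auto simp: colim_rel_def)
  show "refl_on (SIGMA i:UNIV. carrier (R i)) (colim_rel R t)"
    by (auto simp: refl_on_def colim_rel_def)
  show "sym (colim_rel R t)"
    by (auto simp: sym_def colim_rel_def)
  show "trans (colim_rel R t)"
  proof (rule transI)
    fix u v w assume "(u, v) \<in> colim_rel R t" "(v, w) \<in> colim_rel R t"
    then obtain i x j y l z k k' where
      e: "u = (i, x)" "v = (j, y)" "w = (l, z)"
      and c: "x \<in> carrier (R i)" "z \<in> carrier (R l)"
      and k: "i \<le> k" "j \<le> k" "tower_map t i k x = tower_map t j k y"
      and k': "j \<le> k'" "l \<le> k'" "tower_map t j k' y = tower_map t l k' z"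
      unfolding colim_rel_def by auto
    define K where "K = max k k'"
    have K: "k \<le> K" "k' \<le> K" by (auto simp: K_def)
    have "tower_map t i K x = tower_map t j K y"
      using tower_map_comp[OF k(1) K(1), of t x] tower_map_comp[OF k(2) K(1), of t y] k(3) by simp
    also have "\<dots> = tower_map t l K z"
      using tower_map_comp[OF k'(1) K(2), of t y] tower_map_comp[OF k'(2) K(2), of t z] k'(3) by simp
    finally have "tower_map t i K x = tower_map t l K z" .
    moreover have "max i l \<le> K" using k k' K by linarith
    ultimately show "(u, w) \<in> colim_rel R t"
      using c unfolding colim_rel_def e by blast
  qed
qed

lemma to_colim_eq_iff:
  assumes "x \<in> carrier (R i)" "y \<in> carrier (R j)"
  shows "to_colim R t i x = to_colim R t j y \<longleftrightarrow>
    (\<exists>k\<ge>max i j. tower_map t i k x = tower_map t j k y)"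
  unfolding to_colim_def
  using eq_equiv_class_iff[OF equiv_colim_rel, of "(i, x)" "(j, y)"] assms
  by (simp add: colim_rel_def)

lemma to_colim_tower_map:
  assumes "x \<in> carrier (R i)" "i \<le> j"
  shows "to_colim R t j (tower_map t i j x) = to_colim R t i x"
  using assms by (auto simp: to_colim_eq_iff tower_map_closed intro!: exI[of _ j])

lemma mem_to_colim:
  assumes "x \<in> carrier (R i)"
  shows "(j, y) \<in> to_colim R t i x \<longleftrightarrow> y \<in> carrier (R j) \<and> to_colim R t j y = to_colim R t i x"
proof -
  have "(j, y) \<in> to_colim R t i x \<longleftrightarrow> y \<in> carrier (R j) \<and> ((i, x), (j, y)) \<in> colim_rel R t"
    by (auto simp: to_colim_def colim_rel_def)
  also have "\<dots> \<longleftrightarrow> y \<in> carrier (R j) \<and> to_colim R t i x = to_colim R t j y"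
    using assms by (simp add: to_colim_eq_iff colim_rel_def cong: conj_cong)
  finally show ?thesis by auto
qed

lemma colim_carrier: "carrier (tower_colim R t) = {to_colim R t i x | i x. x \<in> carrier (R i)}"
  by (auto simp: tower_colim_def quotient_def to_colim_def)

lemma to_colim_closed: "x \<in> carrier (R i) \<Longrightarrow> to_colim R t i x \<in> carrier (tower_colim R t)"
  by (auto simp: colim_carrier)

lemma colim_cases:
  assumes "u \<in> carrier (tower_colim R t)"
  obtains i x where "x \<in> carrier (R i)" "u = to_colim R t i x"
  using assms by (auto simp: colim_carrier)

lemma colim_common_level:
  assumes "u \<in> carrier (tower_colim R t)" "v \<in> carrier (tower_colim R t)" "w \<in> carrier (tower_colim R t)"
  obtains k x y z where "x \<in> carrier (R k)" "u = to_colim R t k x" "y \<in> carrier (R k)" "v = to_colim R t k y"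
    "z \<in> carrier (R k)" "w = to_colim R t k z"
proof -
  obtain i x where x: "x \<in> carrier (R i)" "u = to_colim R t i x" using assms(1) by (rule colim_cases)
  obtain j y where y: "y \<in> carrier (R j)" "v = to_colim R t j y" using assms(2) by (rule colim_cases)
  obtain l z where z: "z \<in> carrier (R l)" "w = to_colim R t l z" using assms(3) by (rule colim_cases)
  define k where "k = max i (max j l)"
  have "i \<le> k" "j \<le> k" "l \<le> k" by (auto simp: k_def)
  then show ?thesis
    using x y z by (intro that[of "tower_map t i k x" k "tower_map t j k y" "tower_map t l k z"])
      (auto simp: tower_map_closed to_colim_tower_map)
qed

text \<open>Addition and multiplication of the direct limit are instances of one construction: move both
  arguments to a common level and apply the operation there.  Representatives of the same class become
  equal at a later level, and the operation commutes with the transition maps.\<close>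
lemma colim_operation:
  assumes opc: "\<And>i x y. x \<in> carrier (R i) \<Longrightarrow> y \<in> carrier (R i) \<Longrightarrow> opn i x y \<in> carrier (R i)"
    and oph: "\<And>i j x y. i \<le> j \<Longrightarrow> x \<in> carrier (R i) \<Longrightarrow> y \<in> carrier (R i) \<Longrightarrow>
      tower_map t i j (opn i x y) = opn j (tower_map t i j x) (tower_map t i j y)"
    and x: "x \<in> carrier (R k)" and y: "y \<in> carrier (R k)"
  shows "(\<Union>(i, x)\<in>to_colim R t k x. \<Union>(j, y)\<in>to_colim R t k y.
      to_colim R t (max i j) (opn (max i j) (tower_map t i (max i j) x) (tower_map t j (max i j) y)))
    = to_colim R t k (opn k x y)"
proof (rule UN_pairs_constant)
  show "(k, x) \<in> to_colim R t k x" "(k, y) \<in> to_colim R t k y"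
    using x y by (auto simp: mem_to_colim)
  fix i x' j y'
  assume "(i, x') \<in> to_colim R t k x" "(j, y') \<in> to_colim R t k y"
  then have c: "x' \<in> carrier (R i)" "y' \<in> carrier (R j)"
    and e: "to_colim R t i x' = to_colim R t k x" "to_colim R t j y' = to_colim R t k y"
    using x y by (auto simp: mem_to_colim)
  obtain m where m: "m \<ge> max i k" "tower_map t i m x' = tower_map t k m x"
    using e(1) c(1) x by (auto simp: to_colim_eq_iff)
  obtain n where n: "n \<ge> max j k" "tower_map t j n y' = tower_map t k n y"
    using e(2) c(2) y by (auto simp: to_colim_eq_iff)
  define N where "N = max m n"
  have N: "m \<le> N" "n \<le> N" "i \<le> N" "j \<le> N" "k \<le> N" "max i j \<le> N" using m n by (auto simp: N_def)
  have mi: "i \<le> m" "k \<le> m" and nj: "j \<le> n" "k \<le> n" using m n by auto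
  have ex: "tower_map t i N x' = tower_map t k N x"
    using tower_map_comp[OF mi(1) N(1), of t x'] tower_map_comp[OF mi(2) N(1), of t x] m(2) by simp
  have ey: "tower_map t j N y' = tower_map t k N y"
    using tower_map_comp[OF nj(1) N(2), of t y'] tower_map_comp[OF nj(2) N(2), of t y] n(2) by simp
  let ?l = "max i j"
  have cl: "tower_map t i ?l x' \<in> carrier (R ?l)" "tower_map t j ?l y' \<in> carrier (R ?l)"
    using c by (auto intro: tower_map_closed)
  have "tower_map t ?l N (opn ?l (tower_map t i ?l x') (tower_map t j ?l y'))
      = opn N (tower_map t i N x') (tower_map t j N y')"
    by (simp add: oph[OF N(6) cl] tower_map_comp N)
  also have "\<dots> = tower_map t k N (opn k x y)"
    by (simp add: ex ey oph[OF N(5) x y])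
  finally show "to_colim R t ?l (opn ?l (tower_map t i ?l x') (tower_map t j ?l y'))
      = to_colim R t k (opn k x y)"
    using N by (subst to_colim_eq_iff) (auto intro!: opc cl x y)
qed

lemma to_colim_mult:
  assumes "x \<in> carrier (R k)" "y \<in> carrier (R k)"
  shows "to_colim R t k x \<otimes>\<^bsub>tower_colim R t\<^esub> to_colim R t k y = to_colim R t k (x \<otimes>\<^bsub>R k\<^esub> y)"
  unfolding tower_colim_def monoid.simps ring.simps
  by (rule colim_operation[of "\<lambda>i. monoid.mult (R i)"])
    (use assms tower_map_hom in \<open>auto simp: ring_hom_mult\<close>)

lemma to_colim_add:
  assumes "x \<in> carrier (R k)" "y \<in> carrier (R k)"
  shows "to_colim R t k x \<oplus>\<^bsub>tower_colim R t\<^esub> to_colim R t k y = to_colim R t k (x \<oplus>\<^bsub>R k\<^esub> y)"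
  unfolding tower_colim_def monoid.simps ring.simps
  by (rule colim_operation[of "\<lambda>i. ring.add (R i)"])
    (use assms tower_map_hom in \<open>auto simp: ring_hom_add\<close>)

lemma colim_one: "\<one>\<^bsub>tower_colim R t\<^esub> = to_colim R t k \<one>\<^bsub>R k\<^esub>"
  using to_colim_tower_map[of "\<one>\<^bsub>R 0\<^esub>" 0 k] ring_hom_one[OF tower_map_hom[of 0 k]]
  by (simp add: tower_colim_def)

lemma colim_zero: "\<zero>\<^bsub>tower_colim R t\<^esub> = to_colim R t k \<zero>\<^bsub>R k\<^esub>"
  using to_colim_tower_map[of "\<zero>\<^bsub>R 0\<^esub>" 0 k] ring_hom_cring.hom_zero[OF tower_map_hom_cring[of 0 k]]
  by (simp add: tower_colim_def)

lemma cring_colim: "cring (tower_colim R t)" (is "cring ?L")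
proof -
  note simps = to_colim_mult to_colim_add to_colim_closed
  show ?thesis
  proof (rule cringI)
    show "abelian_group ?L"
    proof (rule abelian_groupI)
      fix u v w assume uvw: "u \<in> carrier ?L" "v \<in> carrier ?L" "w \<in> carrier ?L"
      obtain k x y z where k: "x \<in> carrier (R k)" "u = to_colim R t k x" "y \<in> carrier (R k)" "v = to_colim R t k y"
        "z \<in> carrier (R k)" "w = to_colim R t k z" using uvw by (rule colim_common_level)
      show "u \<oplus>\<^bsub>?L\<^esub> v \<oplus>\<^bsub>?L\<^esub> w = u \<oplus>\<^bsub>?L\<^esub> (v \<oplus>\<^bsub>?L\<^esub> w)"
        using k by (simp add: simps Ri.a_assoc)
    next
      fix u v assume uv: "u \<in> carrier ?L" "v \<in> carrier ?L"
      obtain k x y z where k: "x \<in> carrier (R k)" "u = to_colim R t k x" "y \<in> carrier (R k)" "v = to_colim R t k y"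
        "z \<in> carrier (R k)" "v = to_colim R t k z" using uv(1,2,2) by (rule colim_common_level)
      show "u \<oplus>\<^bsub>?L\<^esub> v \<in> carrier ?L" "u \<oplus>\<^bsub>?L\<^esub> v = v \<oplus>\<^bsub>?L\<^esub> u"
        unfolding k(2,4) using k(1,3) by (simp_all add: simps Ri.a_comm)
    next
      fix u assume "u \<in> carrier ?L"
      then obtain k x where k: "x \<in> carrier (R k)" "u = to_colim R t k x" by (rule colim_cases)
      show "\<zero>\<^bsub>?L\<^esub> \<oplus>\<^bsub>?L\<^esub> u = u"
        using k by (simp add: colim_zero[of k] simps)
      show "\<exists>y\<in>carrier ?L. y \<oplus>\<^bsub>?L\<^esub> u = \<zero>\<^bsub>?L\<^esub>"
        using k by (intro bexI[of _ "to_colim R t k (\<ominus>\<^bsub>R k\<^esub> x)"])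
          (simp_all add: colim_zero[of k] simps Ri.l_neg)
    qed (simp add: colim_zero[of 0] simps)
    show "comm_monoid ?L"
    proof (rule comm_monoidI)
      fix u v w assume uvw: "u \<in> carrier ?L" "v \<in> carrier ?L" "w \<in> carrier ?L"
      obtain k x y z where k: "x \<in> carrier (R k)" "u = to_colim R t k x" "y \<in> carrier (R k)" "v = to_colim R t k y"
        "z \<in> carrier (R k)" "w = to_colim R t k z" using uvw by (rule colim_common_level)
      show "u \<otimes>\<^bsub>?L\<^esub> v \<otimes>\<^bsub>?L\<^esub> w = u \<otimes>\<^bsub>?L\<^esub> (v \<otimes>\<^bsub>?L\<^esub> w)"
        using k by (simp add: simps Ri.m_assoc)
    next
      fix u v assume uv: "u \<in> carrier ?L" "v \<in> carrier ?L"
      obtain k x y z where k: "x \<in> carrier (R k)" "u = to_colim R t k x" "y \<in> carrier (R k)" "v = to_colim R t k y"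
        "z \<in> carrier (R k)" "v = to_colim R t k z" using uv(1,2,2) by (rule colim_common_level)
      show "u \<otimes>\<^bsub>?L\<^esub> v \<in> carrier ?L" "u \<otimes>\<^bsub>?L\<^esub> v = v \<otimes>\<^bsub>?L\<^esub> u"
        unfolding k(2,4) using k(1,3) by (simp_all add: simps Ri.m_comm)
    next
      fix u assume "u \<in> carrier ?L"
      then obtain k x where k: "x \<in> carrier (R k)" "u = to_colim R t k x" by (rule colim_cases)
      show "\<one>\<^bsub>?L\<^esub> \<otimes>\<^bsub>?L\<^esub> u = u"
        using k by (simp add: colim_one[of k] simps)
    qed (simp add: colim_one[of 0] simps)
    fix u v w assume uvw: "u \<in> carrier ?L" "v \<in> carrier ?L" "w \<in> carrier ?L"
    obtain k x y z where k: "x \<in> carrier (R k)" "u = to_colim R t k x" "y \<in> carrier (R k)" "v = to_colim R t k y"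
      "z \<in> carrier (R k)" "w = to_colim R t k z" using uvw by (rule colim_common_level)
    show "(u \<oplus>\<^bsub>?L\<^esub> v) \<otimes>\<^bsub>?L\<^esub> w = u \<otimes>\<^bsub>?L\<^esub> w \<oplus>\<^bsub>?L\<^esub> v \<otimes>\<^bsub>?L\<^esub> w"
      using k by (simp add: simps Ri.l_distr)
  qed
qed

lemma to_colim_hom: "to_colim R t i \<in> ring_hom (R i) (tower_colim R t)"
  by (rule ring_hom_memI) (auto simp: to_colim_mult to_colim_add to_colim_closed colim_one[of i])

end

section \<open>Principal ideals and their quotients\<close>

lemma (in cring) mem_cgenideal_iff:
  assumes "a \<in> carrier R" "x \<in> carrier R"
  shows "x \<in> PIdl a \<longleftrightarrow> a divides x"
  using assms by (auto simp: cgenideal_def factor_def m_comm)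

text \<open>Extensions of principal ideals are principal.  This makes the level ideals, the ideal of the direct
  limit and the kernels of the Frobenius projections accessible through divisibility.\<close>
lemma Idl_image_principal:
  fixes A B :: "_ ring"
  assumes A: "cring A" and B: "cring B" and h: "h \<in> ring_hom A B" and a: "a \<in> carrier A"
  shows "Idl\<^bsub>B\<^esub> (h ` (Idl\<^bsub>A\<^esub> {a})) = PIdl\<^bsub>B\<^esub> (h a)"
proof -
  interpret A: cring A by (rule A)
  interpret B: cring B by (rule B)
  have ha: "h a \<in> carrier B" using h a by (rule ring_hom_closed)
  have sub: "h ` (PIdl\<^bsub>A\<^esub> a) \<subseteq> PIdl\<^bsub>B\<^esub> (h a)"
    using ring_hom_closed[OF h] ring_hom_mult[OF h _ a] by (auto simp: cgenideal_def)
  have "h a \<in> h ` (PIdl\<^bsub>A\<^esub> a)" using A.cgenideal_self[OF a] by blast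
  then have "PIdl\<^bsub>B\<^esub> (h a) \<subseteq> Idl\<^bsub>B\<^esub> (h ` (PIdl\<^bsub>A\<^esub> a))"
    using B.genideal_self[of "h ` (PIdl\<^bsub>A\<^esub> a)"] B.genideal_ideal[of "h ` (PIdl\<^bsub>A\<^esub> a)"] sub
      additive_subgroup.a_subset[OF ideal.axioms(1)[OF B.cgenideal_ideal[OF ha]]]
    by (intro B.cgenideal_minimal) (auto 4 4)
  moreover have "Idl\<^bsub>B\<^esub> (h ` (PIdl\<^bsub>A\<^esub> a)) \<subseteq> PIdl\<^bsub>B\<^esub> (h a)"
    using sub B.cgenideal_ideal[OF ha] by (rule B.genideal_minimal[rotated])
  ultimately show ?thesis
    using A.cgenideal_eq_genideal[OF a] by auto
qed

lemma (in cring) ideal_prod_principal: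
  assumes a: "a \<in> carrier R" and b: "b \<in> carrier R"
  shows "ideal_prod R (PIdl a) (PIdl b) = PIdl (a \<otimes> b)"
proof
  show "ideal_prod R (PIdl a) (PIdl b) \<subseteq> PIdl (a \<otimes> b)"
  proof
    fix x assume "x \<in> ideal_prod R (PIdl a) (PIdl b)"
    then show "x \<in> PIdl (a \<otimes> b)"
    proof (induction rule: ideal_prod.induct)
      case (prod i j)
      then obtain u v where uv: "u \<in> carrier R" "i = u \<otimes> a" "v \<in> carrier R" "j = v \<otimes> b"
        by (auto simp: cgenideal_def)
      then have "i \<otimes> j = (u \<otimes> v) \<otimes> (a \<otimes> b)" using a b by (simp add: m_ac)
      then show ?case using uv by (auto simp: cgenideal_def)
    next
      case (sum s1 s2)
      then show ?case
        using additive_subgroup.a_closed[OF ideal.axioms(1)[OF cgenideal_ideal]] a b by blast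
    qed
  qed
  show "PIdl (a \<otimes> b) \<subseteq> ideal_prod R (PIdl a) (PIdl b)"
  proof
    fix x assume "x \<in> PIdl (a \<otimes> b)"
    then obtain u where u: "u \<in> carrier R" "x = u \<otimes> (a \<otimes> b)" by (auto simp: cgenideal_def)
    then have "x = (u \<otimes> a) \<otimes> b" using a b by (simp add: m_assoc)
    moreover have "u \<otimes> a \<in> PIdl a" using u by (auto simp: cgenideal_def)
    ultimately show "x \<in> ideal_prod R (PIdl a) (PIdl b)"
      using cgenideal_self[OF b] by (auto intro: ideal_prod.prod)
  qed
qed

lemma (in cring) principal_ideal_power:
  assumes a: "a \<in> carrier R"
  shows "(PIdl a) [^]\<^bsub>ideals_set R\<^esub> (n::nat) = PIdl (a [^] n)"
proof (induction n)
  case 0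
  have "PIdl \<one> = carrier R" by (simp add: cgenideal_eq_genideal genideal_one)
  then show ?case by (simp add: ideals_set_def)
next
  case (Suc n)
  then show ?case
    using a by (simp add: ideals_set_def ideal_prod_principal)
qed

lemma quot_map_coset:
  fixes A B :: "_ ring"
  assumes A: "cring A" and B: "cring B" and h: "h \<in> ring_hom A B"
    and I: "ideal I A" and J: "ideal J B" and IJ: "h ` I \<subseteq> J" and x: "x \<in> carrier A"
  shows "quot_map B J h (I +>\<^bsub>A\<^esub> x) = J +>\<^bsub>B\<^esub> h x"
proof -
  interpret A: cring A by (rule A)
  interpret B: cring B by (rule B)
  interpret I: ideal I A by (rule I)
  interpret J: ideal J B by (rule J)
  interpret ring_hom_cring A B h
    by (intro ring_hom_cring.intro ring_hom_cring_axioms.intro A B h)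
  have const: "J +>\<^bsub>B\<^esub> h y = J +>\<^bsub>B\<^esub> h x" if y: "y \<in> I +>\<^bsub>A\<^esub> x" for y
  proof -
    obtain i where i: "i \<in> I" "y = i \<oplus>\<^bsub>A\<^esub> x" using y by (auto simp: a_r_coset_def')
    have ic: "i \<in> carrier A" using i(1) by (rule I.a_Hcarr)
    have "h y \<ominus>\<^bsub>B\<^esub> h x = h i"
      using ic x unfolding i(2) by (simp add: a_minus_def B.a_assoc B.r_neg)
    then have "h y \<ominus>\<^bsub>B\<^esub> h x \<in> J" using i(1) IJ by auto
    then show ?thesis
      using B.quotient_eq_iff_same_a_r_cos[OF J, of "h y" "h x"] ic x i(2) by simp
  qed
  moreover have "x \<in> I +>\<^bsub>A\<^esub> x" using x by (rule I.a_rcos_self)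
  ultimately show ?thesis unfolding quot_map_def by blast
qed

lemma quot_map_hom:
  fixes A B :: "_ ring"
  assumes A: "cring A" and B: "cring B" and h: "h \<in> ring_hom A B"
    and I: "ideal I A" and J: "ideal J B" and IJ: "h ` I \<subseteq> J"
  shows "quot_map B J h \<in> ring_hom (A Quot I) (B Quot J)"
proof -
  interpret A: cring A by (rule A)
  interpret B: cring B by (rule B)
  note qm = quot_map_coset[OF A B h I J IJ]
  note qA = ideal.rcos_ring_hom[OF I] and qB = ideal.rcos_ring_hom[OF J]
  have carr: "\<exists>x\<in>carrier A. U = I +>\<^bsub>A\<^esub> x" if "U \<in> carrier (A Quot I)" for U
    using that by (auto simp: FactRing_def A_RCOSETS_def' )
  show ?thesis
  proof (rule ring_hom_memI)
    fix U assume "U \<in> carrier (A Quot I)"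
    then obtain x where "x \<in> carrier A" "U = I +>\<^bsub>A\<^esub> x" using carr by blast
    then show "quot_map B J h U \<in> carrier (B Quot J)"
      using ring_hom_closed[OF qB] ring_hom_closed[OF h] by (simp add: qm)
  next
    fix U V assume "U \<in> carrier (A Quot I)" "V \<in> carrier (A Quot I)"
    then obtain x y where x: "x \<in> carrier A" "U = I +>\<^bsub>A\<^esub> x" and y: "y \<in> carrier A" "V = I +>\<^bsub>A\<^esub> y"
      using carr by meson
    show "quot_map B J h (U \<otimes>\<^bsub>A Quot I\<^esub> V) = quot_map B J h U \<otimes>\<^bsub>B Quot J\<^esub> quot_map B J h V"
      unfolding x(2) y(2) ring_hom_mult[OF qA x(1) y(1), symmetric]
      using x(1) y(1) ring_hom_closed[OF h] by (simp add: qm ring_hom_mult[OF h] ring_hom_mult[OF qB])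
    show "quot_map B J h (U \<oplus>\<^bsub>A Quot I\<^esub> V) = quot_map B J h U \<oplus>\<^bsub>B Quot J\<^esub> quot_map B J h V"
      unfolding x(2) y(2) ring_hom_add[OF qA x(1) y(1), symmetric]
      using x(1) y(1) ring_hom_closed[OF h] by (simp add: qm ring_hom_add[OF h] ring_hom_add[OF qB])
  next
    show "quot_map B J h \<one>\<^bsub>A Quot I\<^esub> = \<one>\<^bsub>B Quot J\<^esub>"
      unfolding ring_hom_one[OF qA, symmetric] ring_hom_one[OF qB, symmetric]
      by (simp add: qm ring_hom_one[OF h])
  qed
qed

context cring
begin

lemma quot_cases:
  assumes "U \<in> carrier (R Quot I)"
  obtains x where "x \<in> carrier R" "U = I +> x"
  using assms by (auto simp: FactRing_def A_RCOSETS_def')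

lemma cring_quot_principal:
  "g \<in> carrier R \<Longrightarrow> cring (R Quot (PIdl g))"
  using ideal.quotient_is_cring[OF cgenideal_ideal is_cring] .

lemma hom_quot_principal:
  "g \<in> carrier R \<Longrightarrow> (+>) (PIdl g) \<in> ring_hom R (R Quot (PIdl g))"
  using ideal.rcos_ring_hom[OF cgenideal_ideal] .

lemma coset_principal_eq_iff:
  assumes "g \<in> carrier R" "x \<in> carrier R" "y \<in> carrier R"
  shows "PIdl g +> x = PIdl g +> y \<longleftrightarrow> g divides (x \<ominus> y)"
  using assms quotient_eq_iff_same_a_r_cos[OF cgenideal_ideal, of g x y]
  by (simp add: mem_cgenideal_iff)

lemma coset_principal_zero_iff:
  assumes "g \<in> carrier R" "x \<in> carrier R"
  shows "PIdl g +> x = \<zero>\<^bsub>R Quot (PIdl g)\<^esub> \<longleftrightarrow> g divides x"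
proof -
  have "PIdl g +> \<zero> = \<zero>\<^bsub>R Quot (PIdl g)\<^esub>"
    using ring_hom_zero[OF hom_quot_principal ring_axioms] cring_quot_principal assms
    by (simp add: cring_def)
  then show ?thesis
    using coset_principal_eq_iff[of g x \<zero>] assms by (simp add: a_minus_def)
qed

end

section \<open>The adic completion at a regular element\<close>

context regular_cring
begin

abbreviation Cpl where "Cpl \<equiv> adic_completion R (PIdl f)"
abbreviation to_Cpl where "to_Cpl \<equiv> to_completion R (PIdl f)"
abbreviation Quo where "Quo n \<equiv> R Quot (PIdl (f [^] (n::nat)))"
abbreviation Cls where "Cls n \<equiv> (+>) (PIdl (f [^] (n::nat)))"
abbreviation Trans where "Trans n \<equiv> quot_map R (PIdl (f [^] (n::nat))) (\<lambda>x. x)"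

lemma Cpl_eq: "Cpl = inverse_limit Quo Trans"
  by (simp add: adic_completion_def principal_ideal_power)

lemma to_Cpl_apply: "to_Cpl a n = Cls n a"
  by (simp add: to_completion_def principal_ideal_power)

lemma power_ideal_decreasing: "(\<lambda>x. x) ` (PIdl (f [^] Suc n)) \<subseteq> PIdl (f [^] n)"
proof
  fix x assume "x \<in> (\<lambda>x. x) ` (PIdl (f [^] Suc n))"
  then obtain u where "u \<in> carrier R" "x = (u \<otimes> f) \<otimes> f [^] n"
    by (auto simp: cgenideal_def m_ac)
  then show "x \<in> PIdl (f [^] n)" by (auto simp: cgenideal_def)
qed

lemma Trans_Cls: "x \<in> carrier R \<Longrightarrow> Trans n (Cls (Suc n) x) = Cls n x"
  by (rule quot_map_coset[OF is_cring is_cring _ _ _ power_ideal_decreasing])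
    (auto intro!: ring_hom_memI cgenideal_ideal simp del: nat_pow_Suc)

lemma Trans_hom: "Trans n \<in> ring_hom (Quo (Suc n)) (Quo n)"
  by (rule quot_map_hom[OF is_cring is_cring _ _ _ power_ideal_decreasing])
    (auto intro!: ring_hom_memI cgenideal_ideal simp del: nat_pow_Suc)

lemma cring_Quo: "cring (Quo n)"
  by (rule cring_quot_principal) simp

lemma Cls_hom: "Cls n \<in> ring_hom R (Quo n)"
  by (rule hom_quot_principal) simp

lemma Cls_hom_cring: "ring_hom_cring R (Quo n) (Cls n)"
  by (intro ring_hom_cring.intro ring_hom_cring_axioms.intro is_cring cring_Quo Cls_hom)

lemma Cls_zero_iff: "x \<in> carrier R \<Longrightarrow> Cls n x = \<zero>\<^bsub>Quo n\<^esub> \<longleftrightarrow> f [^] n divides x"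
  by (rule coset_principal_zero_iff) simp_all

lemma Cls_eq_iff: "x \<in> carrier R \<Longrightarrow> y \<in> carrier R \<Longrightarrow> Cls n x = Cls n y \<longleftrightarrow> f [^] n divides (x \<ominus> y)"
  by (rule coset_principal_eq_iff) simp_all

lemma cring_Cpl: "cring Cpl"
  unfolding Cpl_eq by (intro cring_inverse_limit cring_Quo Trans_hom)

lemma Cpl_carrier: "x \<in> carrier Cpl \<longleftrightarrow> (\<forall>n. x n \<in> carrier (Quo n) \<and> Trans n (x (Suc n)) = x n)"
  unfolding Cpl_eq by (rule inverse_limit_carrier)

lemma Cpl_simps:
  "(a \<otimes>\<^bsub>Cpl\<^esub> b) n = a n \<otimes>\<^bsub>Quo n\<^esub> b n"
  "(a \<oplus>\<^bsub>Cpl\<^esub> b) n = a n \<oplus>\<^bsub>Quo n\<^esub> b n"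
  "\<one>\<^bsub>Cpl\<^esub> n = \<one>\<^bsub>Quo n\<^esub>"
  "\<zero>\<^bsub>Cpl\<^esub> n = \<zero>\<^bsub>Quo n\<^esub>"
  "(a [^]\<^bsub>Cpl\<^esub> (k::nat)) n = a n [^]\<^bsub>Quo n\<^esub> k"
  unfolding Cpl_eq by (rule inverse_limit_simps inverse_limit_pow)+

lemma to_Cpl_hom: "to_Cpl \<in> ring_hom R Cpl"
proof (rule ring_hom_memI)
  fix x assume x: "x \<in> carrier R"
  show "to_Cpl x \<in> carrier Cpl"
    unfolding Cpl_carrier to_Cpl_apply using x ring_hom_closed[OF Cls_hom] Trans_Cls by blast
next
  fix x y assume xy: "x \<in> carrier R" "y \<in> carrier R"
  show "to_Cpl (x \<otimes> y) = to_Cpl x \<otimes>\<^bsub>Cpl\<^esub> to_Cpl y"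
    by (rule ext) (simp only: Cpl_simps to_Cpl_apply ring_hom_mult[OF Cls_hom xy])
  show "to_Cpl (x \<oplus> y) = to_Cpl x \<oplus>\<^bsub>Cpl\<^esub> to_Cpl y"
    by (rule ext) (simp only: Cpl_simps to_Cpl_apply ring_hom_add[OF Cls_hom xy])
next
  show "to_Cpl \<one> = \<one>\<^bsub>Cpl\<^esub>"
    by (rule ext) (simp only: Cpl_simps to_Cpl_apply ring_hom_one[OF Cls_hom])
qed

text \<open>The component \<open>n\<close> of a multiple of \<open>f\<^sup>n\<close> is zero modulo \<open>f\<^sup>n\<close>.\<close>
lemma to_Cpl_reflects_divides:
  fixes n :: nat
  assumes a: "a \<in> carrier R" and d: "to_Cpl f [^]\<^bsub>Cpl\<^esub> n divides\<^bsub>Cpl\<^esub> to_Cpl a"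
  shows "f [^] n divides a"
proof -
  interpret Cls_hom: ring_hom_cring R "Quo n" "Cls n" by (rule Cls_hom_cring)
  obtain y where y: "y \<in> carrier Cpl" "to_Cpl a = to_Cpl f [^]\<^bsub>Cpl\<^esub> n \<otimes>\<^bsub>Cpl\<^esub> y"
    using d by (auto simp: factor_def)
  have yn: "y n \<in> carrier (Quo n)" using y(1) by (simp only: Cpl_carrier)
  have "Cls n a = (to_Cpl f [^]\<^bsub>Cpl\<^esub> n \<otimes>\<^bsub>Cpl\<^esub> y) n"
    using y(2) by (simp only: to_Cpl_apply[symmetric])
  also have "\<dots> = Cls n f [^]\<^bsub>Quo n\<^esub> n \<otimes>\<^bsub>Quo n\<^esub> y n"
    by (simp only: Cpl_simps to_Cpl_apply)
  also have "Cls n f [^]\<^bsub>Quo n\<^esub> n = Cls n (f [^] n)"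
    using Cls_hom.hom_pow[of f n] by simp
  also have "\<dots> = \<zero>\<^bsub>Quo n\<^esub>" by (subst Cls_zero_iff) auto
  finally have "Cls n a = \<zero>\<^bsub>Quo n\<^esub>" using yn by simp
  then show ?thesis using a by (simp add: Cls_zero_iff)
qed

text \<open>Cancelling \<open>f\<close> loses one power of \<open>f\<close>, so the component \<open>n\<close> is shown to vanish by looking at the
  component \<open>n + 1\<close>.\<close>
lemma regular_to_Cpl: "regular_elt Cpl (to_Cpl f)"
  unfolding regular_elt_def
proof (intro conjI ballI impI)
  show "to_Cpl f \<in> carrier Cpl" using ring_hom_closed[OF to_Cpl_hom f_closed] .
  fix y assume y: "y \<in> carrier Cpl" and zero: "to_Cpl f \<otimes>\<^bsub>Cpl\<^esub> y = \<zero>\<^bsub>Cpl\<^esub>"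
  show "y = \<zero>\<^bsub>Cpl\<^esub>"
  proof
    fix n
    have "y (Suc n) \<in> carrier (Quo (Suc n))" using y by (simp only: Cpl_carrier)
    then obtain x where x: "x \<in> carrier R" "y (Suc n) = Cls (Suc n) x" by (rule quot_cases)
    have "Cls (Suc n) (f \<otimes> x) = (to_Cpl f \<otimes>\<^bsub>Cpl\<^esub> y) (Suc n)"
      by (simp only: Cpl_simps to_Cpl_apply x(2) ring_hom_mult[OF Cls_hom f_closed x(1)])
    also have "\<dots> = \<zero>\<^bsub>Quo (Suc n)\<^esub>" by (simp only: zero Cpl_simps)
    finally have "f [^] Suc n divides f \<otimes> x"
      using x(1) by (simp only: Cls_zero_iff m_closed f_closed)
    then obtain c where c: "c \<in> carrier R" "f \<otimes> x = f \<otimes> (f [^] n \<otimes> c)"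
      by (auto simp: factor_def m_ac)
    have "x = f [^] n \<otimes> c"
      using regular_elt_cancel[OF regular x(1) _ c(2)] c(1) by simp
    then have "f [^] n divides x" using c(1) by auto
    then have "Cls n x = \<zero>\<^bsub>Quo n\<^esub>" using x(1) by (simp only: Cls_zero_iff)
    moreover have "y n = Trans n (y (Suc n))" using y by (simp only: Cpl_carrier)
    ultimately have "y n = \<zero>\<^bsub>Quo n\<^esub>" by (simp only: x(2) Trans_Cls[OF x(1)])
    then show "y n = \<zero>\<^bsub>Cpl\<^esub> n" by (simp only: Cpl_simps)
  qed
qed

text \<open>An element of the completion minus the image of a lift of its component modulo \<open>f\<close> has all its
  components divisible by \<open>f\<close>; the quotients are unique and hence compatible, as \<open>f\<close> is regular.\<close>
lemma Cpl_approx: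
  assumes x: "x \<in> carrier Cpl"
  shows "\<exists>a\<in>carrier R. \<exists>y\<in>carrier Cpl. x = to_Cpl a \<oplus>\<^bsub>Cpl\<^esub> to_Cpl f \<otimes>\<^bsub>Cpl\<^esub> y"
proof -
  have "\<exists>s\<in>carrier R. x n = Cls n s" for n
  proof -
    have "x n \<in> carrier (Quo n)" using x by (simp only: Cpl_carrier)
    then show ?thesis by (rule quot_cases) blast
  qed
  then obtain s where s: "\<And>n. s n \<in> carrier R" "\<And>n. x n = Cls n (s n)" by metis
  have Cls_s: "Cls n (s (Suc n)) = Cls n (s n)" for n
  proof -
    have "Trans n (x (Suc n)) = x n" using x by (simp only: Cpl_carrier)
    then show ?thesis by (simp only: s(2) Trans_Cls[OF s(1)])
  qed
  then have step: "f [^] n divides (s (Suc n) \<ominus> s n)" for n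
    using s(1) by (simp only: Cls_eq_iff)
  have "\<exists>r\<in>carrier R. s (Suc n) = s 1 \<oplus> f \<otimes> r" for n
  proof (induction n)
    case 0
    show ?case using s(1)[of 1] by (intro bexI[of _ \<zero>]) simp_all
  next
    case (Suc n)
    then obtain r where r: "r \<in> carrier R" "s (Suc n) = s 1 \<oplus> f \<otimes> r" by blast
    obtain c where c: "c \<in> carrier R" "s (Suc (Suc n)) \<ominus> s (Suc n) = f [^] Suc n \<otimes> c"
      using step[of "Suc n"] by (auto simp: factor_def)
    have "s (Suc (Suc n)) = s (Suc n) \<oplus> (s (Suc (Suc n)) \<ominus> s (Suc n))"
      using s(1)[of "Suc n"] s(1)[of "Suc (Suc n)"] by algebra
    also have "\<dots> = s 1 \<oplus> f \<otimes> (r \<oplus> f [^] n \<otimes> c)"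
      unfolding c(2) unfolding r(2) using r(1) c(1) s(1)[of 1] by (simp add: r_distr a_assoc m_ac)
    finally show ?case by (rule bexI) (use r(1) c(1) in simp)
  qed
  then obtain r where r: "\<And>n. r n \<in> carrier R" "\<And>n. s (Suc n) = s 1 \<oplus> f \<otimes> r n" by metis
  \<comment> \<open>Division by \<open>f\<close> loses one power of \<open>f\<close>: the quotient \<open>r n\<close> of a lift of component \<open>n + 1\<close> is well
    defined modulo \<open>f\<^sup>n\<close>.\<close>
  define y where "y = (\<lambda>n. Cls n (r n))"
  have "f [^] n divides (r (Suc n) \<ominus> r n)" for n
  proof -
    obtain c where c: "c \<in> carrier R" "s (Suc (Suc n)) \<ominus> s (Suc n) = f [^] Suc n \<otimes> c"
      using step[of "Suc n"] by (auto simp: factor_def)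
    have "f \<otimes> (r (Suc n) \<ominus> r n) = f \<otimes> r (Suc n) \<ominus> f \<otimes> r n"
      using r(1) by (simp add: a_minus_def r_distr r_minus)
    also have "\<dots> = (s 1 \<oplus> f \<otimes> r (Suc n)) \<ominus> (s 1 \<oplus> f \<otimes> r n)"
      using r(1)[of n] r(1)[of "Suc n"] s(1)[of 1] f_closed by algebra
    also have "\<dots> = f \<otimes> (f [^] n \<otimes> c)"
      unfolding r(2)[symmetric] c(2) using c(1) by (simp add: m_ac)
    finally have "r (Suc n) \<ominus> r n = f [^] n \<otimes> c"
      by (rule regular_elt_cancel[OF regular, rotated 2]) (use r(1) c(1) in auto)
    then show ?thesis using c(1) by auto
  qed
  then have Cls_r: "Cls n (r (Suc n)) = Cls n (r n)" for n
    using r(1) by (simp only: Cls_eq_iff)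
  have y: "y \<in> carrier Cpl"
    unfolding Cpl_carrier y_def
    by (intro allI conjI) (simp_all only: ring_hom_closed[OF Cls_hom r(1)] Trans_Cls[OF r(1)] Cls_r)
  have "x = to_Cpl (s 1) \<oplus>\<^bsub>Cpl\<^esub> to_Cpl f \<otimes>\<^bsub>Cpl\<^esub> y"
  proof
    fix n
    have fr: "f \<otimes> r n \<in> carrier R" using r(1) by simp
    have "x n = Cls n (s 1 \<oplus> f \<otimes> r n)"
      by (simp only: s(2) Cls_s[symmetric] r(2)[symmetric])
    also have "\<dots> = (to_Cpl (s 1) \<oplus>\<^bsub>Cpl\<^esub> to_Cpl f \<otimes>\<^bsub>Cpl\<^esub> y) n"
      by (simp only: Cpl_simps to_Cpl_apply y_def ring_hom_add[OF Cls_hom s(1) fr]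
          ring_hom_mult[OF Cls_hom f_closed r(1)])
    finally show "x n = (to_Cpl (s 1) \<oplus>\<^bsub>Cpl\<^esub> to_Cpl f \<otimes>\<^bsub>Cpl\<^esub> y) n" .
  qed
  then show ?thesis using s(1) y by blast
qed

lemma power_closed_completion: "power_closed R f \<longleftrightarrow> power_closed Cpl (to_Cpl f)"
proof -
  have "(\<forall>i::unit. power_closed R f) \<longleftrightarrow> power_closed Cpl (to_Cpl f)"
    by (rule power_closed_transfer[of "\<lambda>_::unit. R" Cpl "\<lambda>_. to_Cpl" "\<lambda>_. f"])
      (use is_cring cring_Cpl to_Cpl_hom f_closed to_Cpl_reflects_divides Cpl_approx in blast)+
  then show ?thesis by simp
qed

end

section \<open>Towers with a regular element\<close>

text \<open>The properties of a torsion free perfectoid tower that make the three conditions equivalent.  Its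
  tilt has them as well, with respect to a generator of the kernel.\<close>
locale regular_tower = tower R t for R :: "nat \<Rightarrow> 'a ring" and t +
  fixes f :: 'a
  assumes f_in_base: "f \<in> carrier (R 0)"
    and level_regular: "\<And>i. regular_elt (R i) (tower_map t 0 i f)"
    and level_reflects: "\<And>i x. x \<in> carrier (R i) \<Longrightarrow>
      tower_map t 0 (Suc i) f divides\<^bsub>R (Suc i)\<^esub> t i x \<Longrightarrow> tower_map t 0 i f divides\<^bsub>R i\<^esub> x"
begin

abbreviation fl where "fl i \<equiv> tower_map t 0 i f"
abbreviation Lim where "Lim \<equiv> tower_colim R t"
abbreviation fL where "fL \<equiv> to_colim R t 0 f"

lemma fl_closed: "fl i \<in> carrier (R i)"
  using level_regular by (rule regular_elt_closed)

lemma tower_map_fl: "i \<le> j \<Longrightarrow> tower_map t i j (fl i) = fl j"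
  by (simp add: tower_map_comp)

lemma tower_map_reflects:
  assumes "i \<le> j" "x \<in> carrier (R i)" "fl j divides\<^bsub>R j\<^esub> tower_map t i j x"
  shows "fl i divides\<^bsub>R i\<^esub> x"
  using assms
proof (induction j)
  case (Suc j)
  show ?case
  proof (cases "i = Suc j")
    case True
    then show ?thesis using Suc.prems(3) by simp
  next
    case False
    then have ij: "i \<le> j" using Suc.prems(1) by simp
    have "fl (Suc j) divides\<^bsub>R (Suc j)\<^esub> t j (tower_map t i j x)"
      using Suc.prems(3) ij by (simp add: tower_map_Suc)
    then have "fl j divides\<^bsub>R j\<^esub> tower_map t i j x"
      by (rule level_reflects[OF tower_map_closed[OF ij Suc.prems(2)]])
    then show ?thesis by (rule Suc.IH[OF ij Suc.prems(2)])
  qed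
qed simp

text \<open>Divisibility by one factor \<open>f\<close> is reflected since the transition maps are injective modulo \<open>f\<close>.
  That factor can be cancelled in the target, where \<open>f\<close> is regular, and the next one is treated alike.\<close>
lemma tower_map_reflects_power:
  assumes "i \<le> j" "x \<in> carrier (R i)" "fl j [^]\<^bsub>R j\<^esub> (n::nat) divides\<^bsub>R j\<^esub> tower_map t i j x"
  shows "fl i [^]\<^bsub>R i\<^esub> n divides\<^bsub>R i\<^esub> x"
  using assms(2,3)
proof (induction n arbitrary: x)
  case 0
  then show ?case by (auto simp: factor_def)
next
  case (Suc n)
  interpret h: ring_hom_cring "R i" "R j" "tower_map t i j"
    using assms(1) by (rule tower_map_hom_cring)
  obtain c where c: "c \<in> carrier (R j)" "tower_map t i j x = fl j [^]\<^bsub>R j\<^esub> Suc n \<otimes>\<^bsub>R j\<^esub> c"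
    using Suc.prems(2) unfolding factor_def by blast
  have c': "tower_map t i j x = fl j \<otimes>\<^bsub>R j\<^esub> (fl j [^]\<^bsub>R j\<^esub> n \<otimes>\<^bsub>R j\<^esub> c)"
    unfolding c(2) using c(1) fl_closed by (simp add: Ri.m_ac)
  then have "fl j divides\<^bsub>R j\<^esub> tower_map t i j x"
    using c(1) fl_closed by (auto simp: factor_def)
  then obtain y where y: "y \<in> carrier (R i)" "x = fl i \<otimes>\<^bsub>R i\<^esub> y"
    using tower_map_reflects[OF assms(1) Suc.prems(1)] by (auto simp: factor_def)
  have "fl j \<otimes>\<^bsub>R j\<^esub> tower_map t i j y = fl j \<otimes>\<^bsub>R j\<^esub> (fl j [^]\<^bsub>R j\<^esub> n \<otimes>\<^bsub>R j\<^esub> c)"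
    unfolding c'[symmetric] y(2) using y(1) fl_closed tower_map_fl[OF assms(1)] by simp
  then have "tower_map t i j y = fl j [^]\<^bsub>R j\<^esub> n \<otimes>\<^bsub>R j\<^esub> c"
    by (rule Ri.regular_elt_cancel[OF level_regular, rotated 2]) (use y(1) c(1) fl_closed in auto)
  then have "fl j [^]\<^bsub>R j\<^esub> n divides\<^bsub>R j\<^esub> tower_map t i j y"
    using c(1) by (auto simp: factor_def)
  then obtain d where d: "d \<in> carrier (R i)" "y = fl i [^]\<^bsub>R i\<^esub> n \<otimes>\<^bsub>R i\<^esub> d"
    using Suc.IH[OF y(1)] by (auto simp: factor_def)
  have "x = fl i [^]\<^bsub>R i\<^esub> Suc n \<otimes>\<^bsub>R i\<^esub> d"
    unfolding y(2) d(2) using d(1) fl_closed by (simp add: Ri.m_ac)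
  then show ?case using d(1) unfolding factor_def by blast
qed

lemma to_colim_fl: "to_colim R t i (fl i) = fL"
  using to_colim_tower_map[OF f_in_base, of i] by simp

lemma to_colim_hom_cring: "ring_hom_cring (R i) Lim (to_colim R t i)"
  by (intro ring_hom_cring.intro ring_hom_cring_axioms.intro R_cring cring_colim to_colim_hom)

text \<open>An equation in the direct limit holds already at some level.\<close>
lemma to_colim_reflects_power:
  assumes a: "a \<in> carrier (R i)" and d: "fL [^]\<^bsub>Lim\<^esub> (n::nat) divides\<^bsub>Lim\<^esub> to_colim R t i a"
  shows "fl i [^]\<^bsub>R i\<^esub> n divides\<^bsub>R i\<^esub> a"
proof -
  obtain u where u: "u \<in> carrier Lim" "to_colim R t i a = fL [^]\<^bsub>Lim\<^esub> n \<otimes>\<^bsub>Lim\<^esub> u"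
    using d by (auto simp: factor_def)
  obtain j y where y: "y \<in> carrier (R j)" "u = to_colim R t j y" using u(1) by (rule colim_cases)
  define k where "k = max i j"
  have k: "i \<le> k" "j \<le> k" by (auto simp: k_def)
  define y' where "y' = tower_map t j k y"
  have y': "y' \<in> carrier (R k)" "u = to_colim R t k y'"
    using y k(2) by (simp_all add: y'_def tower_map_closed to_colim_tower_map)
  interpret h: ring_hom_cring "R k" Lim "to_colim R t k" by (rule to_colim_hom_cring)
  have a': "tower_map t i k a \<in> carrier (R k)" using a k by (simp add: tower_map_closed)
  have "to_colim R t k (tower_map t i k a) = fL [^]\<^bsub>Lim\<^esub> n \<otimes>\<^bsub>Lim\<^esub> to_colim R t k y'"
    using u(2) y'(2) to_colim_tower_map[OF a k(1)] by simp
  also have "\<dots> = to_colim R t k (fl k [^]\<^bsub>R k\<^esub> n \<otimes>\<^bsub>R k\<^esub> y')"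
    using y'(1) fl_closed[of k] to_colim_fl[of k] by simp
  finally obtain l where l: "k \<le> l"
    "tower_map t k l (tower_map t i k a) = tower_map t k l (fl k [^]\<^bsub>R k\<^esub> n \<otimes>\<^bsub>R k\<^esub> y')"
    using to_colim_eq_iff[OF a', of "fl k [^]\<^bsub>R k\<^esub> n \<otimes>\<^bsub>R k\<^esub> y'" k] y'(1) fl_closed by auto
  interpret g: ring_hom_cring "R k" "R l" "tower_map t k l"
    using l(1) by (rule tower_map_hom_cring)
  have "tower_map t i l a = fl l [^]\<^bsub>R l\<^esub> n \<otimes>\<^bsub>R l\<^esub> tower_map t k l y'"
    using l(2) tower_map_comp[OF k(1) l(1), of t a] y'(1) fl_closed[of k] tower_map_fl[OF l(1)] by simp
  then have "fl l [^]\<^bsub>R l\<^esub> n divides\<^bsub>R l\<^esub> tower_map t i l a"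
    using y'(1) by (auto simp: factor_def)
  then show ?thesis
    using tower_map_reflects_power[of i l a n] a k(1) l(1) by simp
qed

lemma regular_colim: "regular_elt Lim fL"
  unfolding regular_elt_def
proof (intro conjI ballI impI)
  show "fL \<in> carrier Lim" using f_in_base by (rule to_colim_closed)
  fix u assume u: "u \<in> carrier Lim" and zero: "fL \<otimes>\<^bsub>Lim\<^esub> u = \<zero>\<^bsub>Lim\<^esub>"
  obtain k x where x: "x \<in> carrier (R k)" "u = to_colim R t k x" using u by (rule colim_cases)
  have "to_colim R t k (fl k \<otimes>\<^bsub>R k\<^esub> x) = to_colim R t k \<zero>\<^bsub>R k\<^esub>"
    using zero x to_colim_mult[OF fl_closed x(1)] by (simp add: to_colim_fl colim_zero[of k])
  then obtain l where l: "k \<le> l" "tower_map t k l (fl k \<otimes>\<^bsub>R k\<^esub> x) = tower_map t k l \<zero>\<^bsub>R k\<^esub>"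
    using to_colim_eq_iff[of "fl k \<otimes>\<^bsub>R k\<^esub> x" k "\<zero>\<^bsub>R k\<^esub>" k] x(1) fl_closed by auto
  interpret g: ring_hom_cring "R k" "R l" "tower_map t k l"
    using l(1) by (rule tower_map_hom_cring)
  have "fl l \<otimes>\<^bsub>R l\<^esub> tower_map t k l x = \<zero>\<^bsub>R l\<^esub>"
    using l x(1) fl_closed[of k] tower_map_fl[OF l(1)] by simp
  then have "tower_map t k l x = \<zero>\<^bsub>R l\<^esub>"
    using level_regular[of l] x(1) by (simp add: regular_elt_def)
  then show "u = \<zero>\<^bsub>Lim\<^esub>"
    using x to_colim_tower_map[OF x(1) l(1)] by (simp add: colim_zero[of l])
qed

lemma levels_cic_iff: "levels_cic R t f \<longleftrightarrow> (\<forall>i. power_closed (R i) (fl i))"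
  unfolding levels_cic_def
  using regular_cring.cic_in_localization_iff[OF regular_cring.intro[OF R_cring regular_cring_axioms.intro[OF level_regular]]]
  by simp

sublocale Lim: regular_cring Lim fL
  by (intro regular_cring.intro cring_colim regular_cring_axioms.intro regular_colim)

lemma colim_cic_iff: "colim_cic R t f \<longleftrightarrow> power_closed Lim fL"
  unfolding colim_cic_def by (rule Lim.cic_in_localization_iff)

lemma completed_colim_cic_iff: "completed_colim_cic R t f \<longleftrightarrow> power_closed Lim.Cpl (Lim.to_Cpl fL)"
proof -
  have J: "colim_ideal R t (Idl\<^bsub>R 0\<^esub> {f}) = PIdl\<^bsub>Lim\<^esub> fL"
    unfolding colim_ideal_def using R_cring cring_colim to_colim_hom f_in_base by (rule Idl_image_principal)
  show ?thesis
    unfolding completed_colim_cic_def Let_def J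
    by (rule regular_cring.cic_in_localization_iff)
      (intro regular_cring.intro regular_cring_axioms.intro Lim.cring_Cpl Lim.regular_to_Cpl)
qed

lemma colim_approx:
  assumes "u \<in> carrier Lim"
  shows "\<exists>i. \<exists>a\<in>carrier (R i). \<exists>v\<in>carrier Lim. u = to_colim R t i a \<oplus>\<^bsub>Lim\<^esub> fL \<otimes>\<^bsub>Lim\<^esub> v"
proof -
  obtain i x where x: "x \<in> carrier (R i)" "u = to_colim R t i x" using assms by (rule colim_cases)
  have "u = to_colim R t i x \<oplus>\<^bsub>Lim\<^esub> fL \<otimes>\<^bsub>Lim\<^esub> \<zero>\<^bsub>Lim\<^esub>"
    using x assms by simp
  then show ?thesis using x(1) by blast
qed

theorem levels_cic_iff_colim_cic: "levels_cic R t f \<longleftrightarrow> colim_cic R t f"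
  unfolding levels_cic_iff colim_cic_iff
  by (rule power_closed_transfer[where h = "to_colim R t"])
    (use R_cring cring_colim to_colim_hom fl_closed to_colim_fl to_colim_reflects_power colim_approx in blast)+

theorem colim_cic_iff_completed_colim_cic: "colim_cic R t f \<longleftrightarrow> completed_colim_cic R t f"
  unfolding colim_cic_iff completed_colim_cic_iff by (rule Lim.power_closed_completion)

end

section \<open>Limits along Frobenius projections\<close>

text \<open>The small tilts, for abstract rings \<open>Q i\<close> in place of the quotients \<open>R\<^sub>i/I R\<^sub>i\<close> and maps \<open>F i\<close> in
  place of the Frobenius projections.\<close>
definition frobenius_limit :: "(nat \<Rightarrow> 'b ring) \<Rightarrow> (nat \<Rightarrow> 'b \<Rightarrow> 'b) \<Rightarrow> nat \<Rightarrow> (nat \<Rightarrow> 'b) ring" where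
  "frobenius_limit Q F j = inverse_limit (\<lambda>i. Q (j + i)) (\<lambda>i. F (j + i))"

definition frobenius_limit_map :: "(nat \<Rightarrow> 'b \<Rightarrow> 'b) \<Rightarrow> nat \<Rightarrow> (nat \<Rightarrow> 'b) \<Rightarrow> nat \<Rightarrow> 'b" where
  "frobenius_limit_map u j a = (\<lambda>i. u (j + i) (a i))"

text \<open>Between consecutive limits this is an isomorphism, since the dropped component is the image of the
  next one under \<open>F\<close>.\<close>
definition shift :: "(nat \<Rightarrow> 'b) \<Rightarrow> nat \<Rightarrow> 'b" where
  "shift a = (\<lambda>i. a (Suc i))"

text \<open>The quotients \<open>R\<^sub>i/I R\<^sub>i\<close> of a perfectoid tower: \<open>u\<close> are the transition maps, \<open>F\<close> the Frobenius
  projections, and \<open>e i\<close> is the class of a generator \<open>f\<^sub>1\<close> of \<open>I\<^sub>1\<close>.  The condition on the annihilator of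
  \<open>e i\<close> comes from the fact that \<open>f\<^sub>1\<^sup>p\<close> generates \<open>I R\<^sub>1\<close> and that \<open>f\<^sub>1\<close> is regular at all levels.\<close>
locale frobenius_tower =
  fixes Q :: "nat \<Rightarrow> 'b ring" and u F :: "nat \<Rightarrow> 'b \<Rightarrow> 'b" and e :: "nat \<Rightarrow> 'b" and p :: nat
  assumes Q_cring: "\<And>i. cring (Q i)"
    and u_hom: "\<And>i. u i \<in> ring_hom (Q i) (Q (Suc i))"
    and u_inj: "\<And>i. inj_on (u i) (carrier (Q i))"
    and F_hom: "\<And>i. F i \<in> ring_hom (Q (Suc i)) (Q i)"
    and F_surj: "\<And>i. F i ` carrier (Q (Suc i)) = carrier (Q i)"
    and u_F: "\<And>i x. x \<in> carrier (Q (Suc i)) \<Longrightarrow> u i (F i x) = x [^]\<^bsub>Q (Suc i)\<^esub> p"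
    and p_ge_2: "2 \<le> p"
    and e_closed: "\<And>i. e i \<in> carrier (Q (Suc i))"
    and F_zero_iff: "\<And>i x. x \<in> carrier (Q (Suc i)) \<Longrightarrow>
      F i x = \<zero>\<^bsub>Q i\<^esub> \<longleftrightarrow> e i divides\<^bsub>Q (Suc i)\<^esub> x"
    and e_annihilator: "\<And>i x. x \<in> carrier (Q (Suc i)) \<Longrightarrow> e i \<otimes>\<^bsub>Q (Suc i)\<^esub> x = \<zero>\<^bsub>Q (Suc i)\<^esub> \<Longrightarrow>
      e i [^]\<^bsub>Q (Suc i)\<^esub> (p - 1) divides\<^bsub>Q (Suc i)\<^esub> x"
begin

sublocale Q: cring "Q i" for i by (rule Q_cring)
sublocale u: ring_hom_cring "Q i" "Q (Suc i)" "u i" for i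
  by (intro ring_hom_cring.intro ring_hom_cring_axioms.intro Q_cring u_hom)
sublocale F: ring_hom_cring "Q (Suc i)" "Q i" "F i" for i
  by (intro ring_hom_cring.intro ring_hom_cring_axioms.intro Q_cring F_hom)

abbreviation T where "T \<equiv> frobenius_limit Q F"
abbreviation tm where "tm \<equiv> frobenius_limit_map u"

lemma F_u: "x \<in> carrier (Q i) \<Longrightarrow> F i (u i x) = x [^]\<^bsub>Q i\<^esub> p"
proof -
  assume "x \<in> carrier (Q i)"
  then obtain y where y: "y \<in> carrier (Q (Suc i))" "x = F i y" using F_surj by blast
  then show ?thesis by (simp add: u_F)
qed

lemma T_carrier: "a \<in> carrier (T j) \<longleftrightarrow> (\<forall>i. a i \<in> carrier (Q (j + i)) \<and> F (j + i) (a (Suc i)) = a i)"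
  unfolding frobenius_limit_def by (rule inverse_limit_carrier)

lemma T_closed: "a \<in> carrier (T j) \<Longrightarrow> a i \<in> carrier (Q (j + i))"
  by (simp add: T_carrier)

lemma T_compat: "a \<in> carrier (T j) \<Longrightarrow> F (j + i) (a (Suc i)) = a i"
  by (simp add: T_carrier)

lemma T_simps:
  "(a \<otimes>\<^bsub>T j\<^esub> b) i = a i \<otimes>\<^bsub>Q (j + i)\<^esub> b i"
  "(a \<oplus>\<^bsub>T j\<^esub> b) i = a i \<oplus>\<^bsub>Q (j + i)\<^esub> b i"
  "\<one>\<^bsub>T j\<^esub> i = \<one>\<^bsub>Q (j + i)\<^esub>"
  "\<zero>\<^bsub>T j\<^esub> i = \<zero>\<^bsub>Q (j + i)\<^esub>"
  "(a [^]\<^bsub>T j\<^esub> (k::nat)) i = a i [^]\<^bsub>Q (j + i)\<^esub> k"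
  unfolding frobenius_limit_def by (rule inverse_limit_simps inverse_limit_pow)+

lemma T_cring: "cring (T j)"
  unfolding frobenius_limit_def using F_hom by (intro cring_inverse_limit Q_cring) simp

sublocale T: cring "T j" for j by (rule T_cring)

lemma tm_hom: "tm j \<in> ring_hom (T j) (T (Suc j))"
proof (rule ring_hom_memI)
  fix a assume a: "a \<in> carrier (T j)"
  have "F (Suc (j + i)) (u (Suc (j + i)) (a (Suc i))) = u (j + i) (a i)" for i
    using T_closed[OF a, of "Suc i"] T_compat[OF a, of i, symmetric] by (simp add: F_u u_F)
  then show "tm j a \<in> carrier (T (Suc j))"
    using T_closed[OF a] by (auto simp: T_carrier frobenius_limit_map_def)
next
  fix a b assume ab: "a \<in> carrier (T j)" "b \<in> carrier (T j)"
  show "tm j (a \<otimes>\<^bsub>T j\<^esub> b) = tm j a \<otimes>\<^bsub>T (Suc j)\<^esub> tm j b"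
    using T_closed ab by (intro ext) (simp add: T_simps frobenius_limit_map_def)
  show "tm j (a \<oplus>\<^bsub>T j\<^esub> b) = tm j a \<oplus>\<^bsub>T (Suc j)\<^esub> tm j b"
    using T_closed ab by (intro ext) (simp add: T_simps frobenius_limit_map_def)
next
  show "tm j \<one>\<^bsub>T j\<^esub> = \<one>\<^bsub>T (Suc j)\<^esub>"
    by (intro ext) (simp add: T_simps frobenius_limit_map_def)
qed

lemma T_tower: "tower T tm"
  by (simp add: tower_def ring_tower_def T_cring tm_hom)

lemma shift_hom: "shift \<in> ring_hom (T j) (T (Suc j))"
proof (rule ring_hom_memI)
  fix a assume a: "a \<in> carrier (T j)"
  show "shift a \<in> carrier (T (Suc j))"
    using T_closed[OF a, of "Suc i" for i] T_compat[OF a, of "Suc i" for i]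
    by (simp add: T_carrier shift_def)
qed (auto simp: T_simps shift_def)

sublocale shift: ring_hom_cring "T j" "T (Suc j)" shift for j
  by (intro ring_hom_cring.intro ring_hom_cring_axioms.intro T_cring shift_hom)

lemma tm_eq_shift_pow: "a \<in> carrier (T j) \<Longrightarrow> tm j a = shift a [^]\<^bsub>T (Suc j)\<^esub> p"
proof
  fix i assume a: "a \<in> carrier (T j)"
  show "tm j a i = (shift a [^]\<^bsub>T (Suc j)\<^esub> p) i"
    using T_closed[OF a, of "Suc i"] T_compat[OF a, of i, symmetric]
    by (simp add: frobenius_limit_map_def shift_def T_simps u_F)
qed

lemma shift_surj:
  assumes b: "b \<in> carrier (T (Suc j))"
  obtains a where "a \<in> carrier (T j)" "shift a = b" "a 0 = F j (b 0)"
proof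
  define a where "a = (\<lambda>i. case i of 0 \<Rightarrow> F j (b 0) | Suc i \<Rightarrow> b i)"
  show "a 0 = F j (b 0)" "shift a = b" by (simp_all add: a_def shift_def)
  have "a i \<in> carrier (Q (j + i)) \<and> F (j + i) (a (Suc i)) = a i" for i
    using T_closed[OF b, of 0] T_closed[OF b, of "i - 1"] T_compat[OF b, of "i - 1"]
    by (cases i) (simp_all add: a_def)
  then show "a \<in> carrier (T j)" by (simp add: T_carrier)
qed

text \<open>Since the maps \<open>F\<close> are surjective, components can be chosen one after the other.\<close>
lemma proj_surj:
  assumes x: "x \<in> carrier (Q j)"
  obtains a where "a \<in> carrier (T j)" "a 0 = x"
proof
  define a where "a = rec_nat x (\<lambda>i y. inv_into (carrier (Q (Suc (j + i)))) (F (j + i)) y)"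
  show a0: "a 0 = x" by (simp add: a_def)
  have aS: "a (Suc i) = inv_into (carrier (Q (Suc (j + i)))) (F (j + i)) (a i)" for i
    by (simp add: a_def)
  have ac: "a i \<in> carrier (Q (j + i))" for i
  proof (induction i)
    case 0
    then show ?case using x a0 by simp
  next
    case (Suc i)
    then have "a i \<in> F (j + i) ` carrier (Q (Suc (j + i)))" by (simp add: F_surj)
    then show ?case by (simp add: aS inv_into_into)
  qed
  have "F (j + i) (a (Suc i)) = a i" for i
    unfolding aS by (rule f_inv_into_f) (simp add: F_surj ac)
  then show "a \<in> carrier (T j)" using ac by (simp add: T_carrier)
qed

text \<open>The \<open>p\<close>-th power of the component \<open>i + 1\<close> is the transition image of the component \<open>i\<close>, as
  \<open>u i (F i x)\<close> is the \<open>p\<close>-th power of \<open>x\<close>.\<close>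
lemma component_pow:
  assumes a: "a \<in> carrier (T j)"
  shows "a i [^]\<^bsub>Q (j + i)\<^esub> (p ^ i) = tower_map u j (j + i) (a 0)"
proof (induction i)
  case 0
  then show ?case using T_closed[OF a, of 0] by simp
next
  case (Suc i)
  have c: "a (Suc i) \<in> carrier (Q (Suc (j + i)))" using T_closed[OF a, of "Suc i"] by simp
  have "tower_map u j (j + Suc i) (a 0) = u (j + i) (tower_map u j (j + i) (a 0))"
    by (simp add: tower_map_Suc)
  also have "\<dots> = u (j + i) (F (j + i) (a (Suc i)) [^]\<^bsub>Q (j + i)\<^esub> (p ^ i))"
    using Suc T_compat[OF a, of i] by simp
  also have "\<dots> = (a (Suc i) [^]\<^bsub>Q (Suc (j + i))\<^esub> p) [^]\<^bsub>Q (Suc (j + i))\<^esub> (p ^ i)"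
    using c by (simp add: u_F)
  also have "\<dots> = a (Suc i) [^]\<^bsub>Q (Suc (j + i))\<^esub> (p ^ Suc i)"
    using c by (simp add: Q.nat_pow_pow mult.commute)
  finally show ?case by simp
qed

text \<open>If \<open>g\<close> generates the kernel of \<open>T j \<rightarrow> Q j\<close>, then its image generates the kernel at the next level; this
  is the induction step towards all levels.\<close>

context
  fixes j g
  assumes g: "g \<in> carrier (T j)"
    and ker: "\<And>a. a \<in> carrier (T j) \<Longrightarrow> a 0 = \<zero>\<^bsub>Q j\<^esub> \<longleftrightarrow> g divides\<^bsub>T j\<^esub> a"
begin

lemma shift_g_closed: "shift g \<in> carrier (T (Suc j))"
  using g by simp

text \<open>Under the isomorphism \<open>shift\<close>, the multiples of \<open>shift g\<close> correspond to the kernel of \<open>T j \<rightarrow> Q j\<close>,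
  and the component 0 of the preimage of \<open>b\<close> is \<open>F j (b 0)\<close>.  It follows that \<open>g 1\<close> and \<open>e j\<close> generate the same ideal.\<close>
lemma shift_g_divides_iff:
  assumes b: "b \<in> carrier (T (Suc j))"
  shows "shift g divides\<^bsub>T (Suc j)\<^esub> b \<longleftrightarrow> e j divides\<^bsub>Q (Suc j)\<^esub> b 0"
proof -
  obtain a where a: "a \<in> carrier (T j)" "shift a = b" "a 0 = F j (b 0)"
    using b by (rule shift_surj)
  have "shift g divides\<^bsub>T (Suc j)\<^esub> b \<longleftrightarrow> g divides\<^bsub>T j\<^esub> a"
  proof
    assume "shift g divides\<^bsub>T (Suc j)\<^esub> b"
    then obtain c' where c': "c' \<in> carrier (T (Suc j))" "b = shift g \<otimes>\<^bsub>T (Suc j)\<^esub> c'"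
      by (auto simp: factor_def)
    obtain c where c: "c \<in> carrier (T j)" "shift c = c'" "c 0 = F j (c' 0)"
      using c'(1) by (rule shift_surj)
    have "a 0 = F j (g 1) \<otimes>\<^bsub>Q j\<^esub> c 0"
      using a(3) c'(2) c(3) T_closed[OF c'(1), of 0] T_closed[OF g, of 1]
      by (simp add: T_simps shift_def)
    also have "F j (g 1) = g 0" using T_compat[OF g, of 0] by simp
    also have "g 0 = \<zero>\<^bsub>Q j\<^esub>" using ker[OF g] g by simp
    finally have "a 0 = \<zero>\<^bsub>Q j\<^esub>" using T_closed[OF c(1), of 0] by simp
    then show "g divides\<^bsub>T j\<^esub> a" using ker a(1) by simp
  next
    assume "g divides\<^bsub>T j\<^esub> a"
    then obtain c where "c \<in> carrier (T j)" "a = g \<otimes>\<^bsub>T j\<^esub> c" by (auto simp: factor_def)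
    then have "b = shift g \<otimes>\<^bsub>T (Suc j)\<^esub> shift c" "shift c \<in> carrier (T (Suc j))"
      using a(2) g by auto
    then show "shift g divides\<^bsub>T (Suc j)\<^esub> b" by (auto simp: factor_def)
  qed
  also have "\<dots> \<longleftrightarrow> F j (b 0) = \<zero>\<^bsub>Q j\<^esub>" using ker[OF a(1)] a(3) by simp
  also have "\<dots> \<longleftrightarrow> e j divides\<^bsub>Q (Suc j)\<^esub> b 0" using F_zero_iff T_closed[OF b, of 0] by simp
  finally show ?thesis .
qed

lemma g1_closed: "g 1 \<in> carrier (Q (Suc j))"
  using T_closed[OF g, of 1] by simp

lemma e_divides_g1: "e j divides\<^bsub>Q (Suc j)\<^esub> g 1"
  using shift_g_divides_iff[OF shift_g_closed] shift_g_closed by (simp add: shift_def)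

lemma g1_divides_e: "g 1 divides\<^bsub>Q (Suc j)\<^esub> e j"
proof -
  obtain b where b: "b \<in> carrier (T (Suc j))" "b 0 = e j" using e_closed by (rule proj_surj)
  then have "shift g divides\<^bsub>T (Suc j)\<^esub> b" using e_closed by (simp add: shift_g_divides_iff)
  then obtain c where c: "c \<in> carrier (T (Suc j))" "b = shift g \<otimes>\<^bsub>T (Suc j)\<^esub> c"
    by (auto simp: factor_def)
  have "e j = g 1 \<otimes>\<^bsub>Q (Suc j)\<^esub> c 0"
    using b(2) c(2) by (simp add: T_simps shift_def)
  then show ?thesis using T_closed[OF c(1), of 0] by (auto simp: factor_def)
qed

lemma g1_annihilator:
  assumes x: "x \<in> carrier (Q (Suc j))" and zero: "g 1 \<otimes>\<^bsub>Q (Suc j)\<^esub> x = \<zero>\<^bsub>Q (Suc j)\<^esub>"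
  shows "g 1 [^]\<^bsub>Q (Suc j)\<^esub> (p - 1) divides\<^bsub>Q (Suc j)\<^esub> x"
proof -
  obtain d where d: "d \<in> carrier (Q (Suc j))" "e j = g 1 \<otimes>\<^bsub>Q (Suc j)\<^esub> d"
    using g1_divides_e by (auto simp: factor_def)
  have "e j \<otimes>\<^bsub>Q (Suc j)\<^esub> x = d \<otimes>\<^bsub>Q (Suc j)\<^esub> (g 1 \<otimes>\<^bsub>Q (Suc j)\<^esub> x)"
    using d x g1_closed by (simp add: Q.m_ac)
  then have "e j \<otimes>\<^bsub>Q (Suc j)\<^esub> x = \<zero>\<^bsub>Q (Suc j)\<^esub>" using zero d(1) by simp
  then obtain y where y: "y \<in> carrier (Q (Suc j))" "x = e j [^]\<^bsub>Q (Suc j)\<^esub> (p - 1) \<otimes>\<^bsub>Q (Suc j)\<^esub> y"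
    using e_annihilator[OF x] by (auto simp: factor_def)
  have "x = g 1 [^]\<^bsub>Q (Suc j)\<^esub> (p - 1) \<otimes>\<^bsub>Q (Suc j)\<^esub> (d [^]\<^bsub>Q (Suc j)\<^esub> (p - 1) \<otimes>\<^bsub>Q (Suc j)\<^esub> y)"
    unfolding y(2) d(2) using d(1) y(1) g1_closed by (simp add: Q.nat_pow_distrib Q.m_assoc)
  then show ?thesis using d(1) y(1) by (auto simp: factor_def)
qed

text \<open>Put \<open>h = shift g\<close>, and let \<open>K\<close> be the kernel of the projection.  An element of \<open>K\<close> has the form \<open>h c\<close>,
  where \<open>c 0\<close> is annihilated by \<open>g 1\<close> and hence is a multiple of its power \<open>p - 1\<close>.  So \<open>K\<close> is contained
  in \<open>(h\<^sup>p) + h K\<close>, and \<open>p\<close> iterations give \<open>K \<subseteq> (h\<^sup>p)\<close>.  Finally \<open>h\<^sup>p\<close> is the image of \<open>g\<close>.\<close>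
lemma kernel_next_level:
  assumes b: "b \<in> carrier (T (Suc j))"
  shows "b 0 = \<zero>\<^bsub>Q (Suc j)\<^esub> \<longleftrightarrow> tm j g divides\<^bsub>T (Suc j)\<^esub> b"
proof
  assume "tm j g divides\<^bsub>T (Suc j)\<^esub> b"
  then obtain c where c: "c \<in> carrier (T (Suc j))" "b = tm j g \<otimes>\<^bsub>T (Suc j)\<^esub> c"
    by (auto simp: factor_def)
  have "g 0 = \<zero>\<^bsub>Q j\<^esub>" using ker[OF g] g by simp
  then show "b 0 = \<zero>\<^bsub>Q (Suc j)\<^esub>"
    using c(2) T_closed[OF c(1), of 0] by (simp add: T_simps frobenius_limit_map_def)
next
  have divide: "\<exists>d k. d \<in> carrier (T (Suc j)) \<and> k \<in> carrier (T (Suc j)) \<and> k 0 = \<zero>\<^bsub>Q (Suc j)\<^esub> \<and>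
      b = shift g [^]\<^bsub>T (Suc j)\<^esub> p \<otimes>\<^bsub>T (Suc j)\<^esub> d \<oplus>\<^bsub>T (Suc j)\<^esub> shift g \<otimes>\<^bsub>T (Suc j)\<^esub> k"
    if b: "b \<in> carrier (T (Suc j))" and b0: "b 0 = \<zero>\<^bsub>Q (Suc j)\<^esub>" for b
  proof -
    have "shift g divides\<^bsub>T (Suc j)\<^esub> b"
      unfolding shift_g_divides_iff[OF b] b0 using e_closed
      by (auto simp: factor_def intro!: bexI[of _ "\<zero>\<^bsub>Q (Suc j)\<^esub>"])
    then obtain c where c: "c \<in> carrier (T (Suc j))" "b = shift g \<otimes>\<^bsub>T (Suc j)\<^esub> c"
      by (auto simp: factor_def)
    have c0: "c 0 \<in> carrier (Q (Suc j))" using T_closed[OF c(1), of 0] by simp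
    have "g 1 \<otimes>\<^bsub>Q (Suc j)\<^esub> c 0 = \<zero>\<^bsub>Q (Suc j)\<^esub>"
      using b0 c(2) by (simp add: T_simps shift_def)
    then obtain x where x: "x \<in> carrier (Q (Suc j))" "c 0 = g 1 [^]\<^bsub>Q (Suc j)\<^esub> (p - 1) \<otimes>\<^bsub>Q (Suc j)\<^esub> x"
      using g1_annihilator[OF c0] by (auto simp: factor_def)
    obtain d where d: "d \<in> carrier (T (Suc j))" "d 0 = x" using x(1) by (rule proj_surj)
    define w where "w = shift g [^]\<^bsub>T (Suc j)\<^esub> (p - 1) \<otimes>\<^bsub>T (Suc j)\<^esub> d"
    have w: "w \<in> carrier (T (Suc j))" using d(1) shift_g_closed by (simp add: w_def)
    define k where "k = c \<ominus>\<^bsub>T (Suc j)\<^esub> w"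
    have k: "k \<in> carrier (T (Suc j))" using c(1) w by (simp add: k_def)
    have ck: "c = w \<oplus>\<^bsub>T (Suc j)\<^esub> k"
      using c(1) w unfolding k_def by algebra
    have w0: "w 0 = c 0" using x(2) d(2) by (simp add: w_def T_simps shift_def)
    have "w 0 \<oplus>\<^bsub>Q (Suc j)\<^esub> k 0 = w 0"
      using arg_cong[OF ck, of "\<lambda>a. a 0"] w0 by (simp add: T_simps)
    then have k0: "k 0 = \<zero>\<^bsub>Q (Suc j)\<^esub>"
      using T_closed[OF w, of 0] T_closed[OF k, of 0] by (simp add: Q.add.r_cancel_one)
    have "Suc (p - 1) = p" using p_ge_2 by simp
    then have hp: "shift g [^]\<^bsub>T (Suc j)\<^esub> p = shift g \<otimes>\<^bsub>T (Suc j)\<^esub> shift g [^]\<^bsub>T (Suc j)\<^esub> (p - 1)"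
      using T.nat_pow_Suc2[OF shift_g_closed, of "p - 1"] by simp
    have "b = shift g [^]\<^bsub>T (Suc j)\<^esub> p \<otimes>\<^bsub>T (Suc j)\<^esub> d \<oplus>\<^bsub>T (Suc j)\<^esub> shift g \<otimes>\<^bsub>T (Suc j)\<^esub> k"
      unfolding c(2) ck hp using w d(1) k shift_g_closed
      by (simp add: w_def T.r_distr T.m_assoc)
    with d(1) k k0 show ?thesis by (intro exI[of _ d] exI[of _ k] conjI)
  qed
  assume b0: "b 0 = \<zero>\<^bsub>Q (Suc j)\<^esub>"
  have "\<exists>d k. d \<in> carrier (T (Suc j)) \<and> k \<in> carrier (T (Suc j)) \<and> k 0 = \<zero>\<^bsub>Q (Suc j)\<^esub> \<and>
      b = shift g [^]\<^bsub>T (Suc j)\<^esub> p \<otimes>\<^bsub>T (Suc j)\<^esub> d \<oplus>\<^bsub>T (Suc j)\<^esub> shift g [^]\<^bsub>T (Suc j)\<^esub> n \<otimes>\<^bsub>T (Suc j)\<^esub> k"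
    for n :: nat
  proof (induction n)
    case 0
    show ?case
      using b b0 shift_g_closed by (intro exI[of _ "\<zero>\<^bsub>T (Suc j)\<^esub>"] exI[of _ b]) simp
  next
    case (Suc n)
    then obtain d k where dk: "d \<in> carrier (T (Suc j))" "k \<in> carrier (T (Suc j))" "k 0 = \<zero>\<^bsub>Q (Suc j)\<^esub>"
      "b = shift g [^]\<^bsub>T (Suc j)\<^esub> p \<otimes>\<^bsub>T (Suc j)\<^esub> d \<oplus>\<^bsub>T (Suc j)\<^esub> shift g [^]\<^bsub>T (Suc j)\<^esub> n \<otimes>\<^bsub>T (Suc j)\<^esub> k"
      by blast
    obtain d' k' where dk': "d' \<in> carrier (T (Suc j))" "k' \<in> carrier (T (Suc j))" "k' 0 = \<zero>\<^bsub>Q (Suc j)\<^esub>"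
      "k = shift g [^]\<^bsub>T (Suc j)\<^esub> p \<otimes>\<^bsub>T (Suc j)\<^esub> d' \<oplus>\<^bsub>T (Suc j)\<^esub> shift g \<otimes>\<^bsub>T (Suc j)\<^esub> k'"
      using divide[OF dk(2,3)] by blast
    have "b = shift g [^]\<^bsub>T (Suc j)\<^esub> p \<otimes>\<^bsub>T (Suc j)\<^esub> (d \<oplus>\<^bsub>T (Suc j)\<^esub> shift g [^]\<^bsub>T (Suc j)\<^esub> n \<otimes>\<^bsub>T (Suc j)\<^esub> d')
        \<oplus>\<^bsub>T (Suc j)\<^esub> shift g [^]\<^bsub>T (Suc j)\<^esub> Suc n \<otimes>\<^bsub>T (Suc j)\<^esub> k'"
      unfolding dk(4) dk'(4) using dk(1) dk'(1,2) shift_g_closed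
      by (simp add: T.r_distr T.m_ac T.a_ac)
    then show ?case using dk(1) dk'(1,2,3) shift_g_closed
      by (intro exI[of _ "d \<oplus>\<^bsub>T (Suc j)\<^esub> shift g [^]\<^bsub>T (Suc j)\<^esub> n \<otimes>\<^bsub>T (Suc j)\<^esub> d'"] exI[of _ k']) simp
  qed
  from this[of p] obtain d k where dk: "d \<in> carrier (T (Suc j))" "k \<in> carrier (T (Suc j))"
    "b = shift g [^]\<^bsub>T (Suc j)\<^esub> p \<otimes>\<^bsub>T (Suc j)\<^esub> d \<oplus>\<^bsub>T (Suc j)\<^esub> shift g [^]\<^bsub>T (Suc j)\<^esub> p \<otimes>\<^bsub>T (Suc j)\<^esub> k"
    by blast
  have "b = tm j g \<otimes>\<^bsub>T (Suc j)\<^esub> (d \<oplus>\<^bsub>T (Suc j)\<^esub> k)"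
    unfolding dk(3) tm_eq_shift_pow[OF g] using dk(1,2) shift_g_closed by (simp add: T.r_distr)
  then show "tm j g divides\<^bsub>T (Suc j)\<^esub> b"
    by (rule dividesI') (use dk(1,2) in simp)
qed

text \<open>The component 1 is annihilated by \<open>g 1\<close>, hence it is a multiple of \<open>g 1\<close>, which \<open>F j\<close> kills.\<close>
lemma annihilated_component:
  assumes c: "c \<in> carrier (T j)" and zero: "g \<otimes>\<^bsub>T j\<^esub> c = \<zero>\<^bsub>T j\<^esub>"
  shows "c 0 = \<zero>\<^bsub>Q j\<^esub>"
proof -
  have c1: "c 1 \<in> carrier (Q (Suc j))" using T_closed[OF c, of 1] by simp
  have "g 1 \<otimes>\<^bsub>Q (Suc j)\<^esub> c 1 = \<zero>\<^bsub>Q (Suc j)\<^esub>"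
    using arg_cong[OF zero, of "\<lambda>a. a 1"] by (simp add: T_simps)
  then have "g 1 [^]\<^bsub>Q (Suc j)\<^esub> (p - 1) divides\<^bsub>Q (Suc j)\<^esub> c 1" by (rule g1_annihilator[OF c1])
  moreover have "g 1 divides\<^bsub>Q (Suc j)\<^esub> g 1 [^]\<^bsub>Q (Suc j)\<^esub> (p - 1)"
  proof -
    have "Suc (p - 2) = p - 1" using p_ge_2 by simp
    then have "g 1 [^]\<^bsub>Q (Suc j)\<^esub> (p - 1) = g 1 \<otimes>\<^bsub>Q (Suc j)\<^esub> g 1 [^]\<^bsub>Q (Suc j)\<^esub> (p - 2)"
      using Q.nat_pow_Suc2[OF g1_closed, of "p - 2"] by simp
    then show ?thesis using g1_closed by (auto simp: factor_def)
  qed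
  ultimately have "e j divides\<^bsub>Q (Suc j)\<^esub> c 1"
    by (meson e_divides_g1 g1_closed e_closed Q.divides_trans)
  then have "F j (c 1) = \<zero>\<^bsub>Q j\<^esub>" using F_zero_iff[OF c1] by simp
  then show ?thesis using T_compat[OF c, of 0] by simp
qed

end

end

section \<open>Divisibility and the Jacobson radical\<close>

text \<open>By Zorn's lemma, applied to the ideals that contain \<open>I\<close> but not \<open>1\<close>.\<close>
lemma (in cring) exists_maximal_ideal:
  assumes I: "ideal I R" and one: "\<one> \<notin> I"
  obtains M where "maximalideal M R" "I \<subseteq> M"
proof -
  define A where "A = {J. ideal J R \<and> I \<subseteq> J \<and> \<one> \<notin> J}"
  have "\<exists>M\<in>A. \<forall>J\<in>A. M \<subseteq> J \<longrightarrow> J = M"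
  proof (rule subset_Zorn_nonempty)
    show "A \<noteq> {}" using I one by (auto simp: A_def)
    fix C assume C: "C \<noteq> {}" "subset.chain A C"
    have "subset.chain {I. ideal I R} C"
      using C(2) by (auto simp: A_def pred_on.chain_def)
    then have "ideal (\<Union>C) R" using chain_Union_is_ideal[of C] C(1) by simp
    then show "\<Union>C \<in> A" using C by (auto simp: A_def pred_on.chain_def)
  qed
  then obtain M where M: "M \<in> A" "\<And>J. J \<in> A \<Longrightarrow> M \<subseteq> J \<Longrightarrow> J = M" by blast
  have "maximalideal M R"
  proof (rule maximalidealI)
    show "ideal M R" using M(1) by (simp add: A_def)
    show "carrier R \<noteq> M" using M(1) by (auto simp: A_def)
    fix J assume J: "ideal J R" "M \<subseteq> J" "J \<subseteq> carrier R"
    show "J = M \<or> J = carrier R"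
    proof (cases "\<one> \<in> J")
      case True
      then show ?thesis using ideal.one_imp_carrier[OF J(1)] by simp
    next
      case False
      then have "J \<in> A" using J M(1) by (auto simp: A_def)
      then show ?thesis using M(2) J(2) by blast
    qed
  qed
  then show ?thesis using that M(1) by (auto simp: A_def)
qed

text \<open>A maximal ideal contains \<open>f\<close>, hence \<open>x\<^sup>N\<close> and \<open>x\<close>, and therefore it does not contain \<open>1 - x y\<close>.\<close>
lemma one_minus_unit_of_power_in_jacobson:
  fixes R :: "'a ring" (structure)
  assumes R: "cring R" and f: "f \<in> jacobson_radical R" and x: "x \<in> carrier R" and y: "y \<in> carrier R"
    and d: "f divides x [^] (N::nat)"
  shows "\<one> \<ominus> x \<otimes> y \<in> Units R"
proof (rule ccontr)
  interpret cring R by (rule R)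
  define v where "v = \<one> \<ominus> x \<otimes> y"
  have v: "v \<in> carrier R" using x y by (simp add: v_def)
  assume "\<one> \<ominus> x \<otimes> y \<notin> Units R"
  then have "\<not> v divides \<one>" using v Unit_eq_dividesone by (simp add: v_def)
  then have "\<one> \<notin> PIdl v" using v by (simp add: mem_cgenideal_iff)
  then obtain M where M: "maximalideal M R" "PIdl v \<subseteq> M"
    by (rule exists_maximal_ideal[OF cgenideal_ideal[OF v]])
  interpret M: primeideal M R using maximalideal_prime[OF M(1)] .
  have one: "\<one> \<notin> M" using M.I_notcarr M.one_imp_carrier by blast
  have fM: "f \<in> M" using f M(1) by (simp add: jacobson_radical_def)
  obtain c where "c \<in> carrier R" "x [^] N = f \<otimes> c" using d by (auto simp: factor_def)
  then have "x [^] N \<in> M" using fM M.I_r_closed by simp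
  then have "x \<in> M"
  proof (induction N)
    case 0
    then show ?case using one by simp
  next
    case (Suc N)
    then show ?case using M.I_prime[of "x [^] N" x] x by auto
  qed
  then have "x \<otimes> y \<in> M" using y by (rule M.I_r_closed)
  moreover have "v \<in> M" using cgenideal_self[OF v] M(2) by blast
  ultimately have "v \<oplus> x \<otimes> y \<in> M" by (rule M.a_closed[rotated])
  moreover have "v \<oplus> x \<otimes> y = \<one>"
    using x y unfolding v_def by algebra
  ultimately show False using one by simp
qed

text \<open>With \<open>x - y = f d\<close> and \<open>f = x\<^sup>2 c\<close> one gets \<open>y = x (1 - x c d)\<close>, where the second factor is a unit.\<close>
lemma divides_of_congruent:
  fixes R :: "'a ring" (structure)
  assumes R: "cring R" and f: "f \<in> jacobson_radical R" and x: "x \<in> carrier R" and y: "y \<in> carrier R"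
    and fx: "f divides x [^] (N::nat)" and xf: "x [^] (2::nat) divides f" and xy: "f divides (x \<ominus> y)"
  shows "y divides x"
proof -
  interpret cring R by (rule R)
  have fc: "f \<in> carrier R" using f by (simp add: jacobson_radical_def)
  obtain d where d: "d \<in> carrier R" "x \<ominus> y = f \<otimes> d" using xy by (auto simp: factor_def)
  obtain c where c: "c \<in> carrier R" "f = x [^] (2::nat) \<otimes> c" using xf by (auto simp: factor_def)
  define v where "v = \<one> \<ominus> x \<otimes> (c \<otimes> d)"
  have v: "v \<in> Units R"
    unfolding v_def
    by (rule one_minus_unit_of_power_in_jacobson[OF R f x _ fx]) (use c(1) d(1) in simp)
  have "y = x \<ominus> (x \<ominus> y)" using x y by algebra
  also have "\<dots> = x \<otimes> v"
    unfolding d(2) c(2) v_def numeral_2_eq_2 using x c(1) d(1)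
    by (simp add: a_minus_def r_distr r_minus m_assoc)
  finally have yv: "y = x \<otimes> v" .
  have "x = y \<otimes> inv v"
    unfolding yv using x v Units_closed[OF v] by (simp add: m_assoc)
  then show ?thesis by (rule dividesI') (use v in simp)
qed

lemma (in cring) divides_pow:
  assumes "a divides b" "a \<in> carrier R" "b \<in> carrier R"
  shows "a [^] (n::nat) divides b [^] n"
proof -
  obtain c where c: "c \<in> carrier R" "b = a \<otimes> c" using assms(1) by (auto simp: factor_def)
  then have "b [^] n = a [^] n \<otimes> c [^] n" using assms(2) by (simp add: nat_pow_distrib)
  then show ?thesis by (rule dividesI') (use c in simp)
qed

lemma (in cring) pow_divides_pow:
  assumes "a \<in> carrier R" "m \<le> (n::nat)"
  shows "a [^] m divides a [^] n"
proof -
  have "a [^] n = a [^] m \<otimes> a [^] (n - m)" using assms by (simp add: nat_pow_mult)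
  then show ?thesis by (rule dividesI') (use assms in simp)
qed

lemma (in ring_hom_cring) hom_divides:
  assumes "a \<in> carrier R" "a divides b"
  shows "h a divides\<^bsub>S\<^esub> h b"
proof -
  obtain c where c: "c \<in> carrier R" "b = a \<otimes> c" using assms(2) by (auto simp: factor_def)
  then have "h b = h a \<otimes>\<^bsub>S\<^esub> h c" using assms(1) by simp
  then show ?thesis by (rule dividesI') (use c in simp)
qed

section \<open>The generator of the kernel at all levels\<close>

locale frobenius_tower_generator = frobenius_tower Q u F e p
  for Q :: "nat \<Rightarrow> 'b ring" and u F e p +
  fixes g :: "nat \<Rightarrow> 'b"
  assumes g_closed: "g \<in> carrier (T 0)"
    and g_kernel: "\<And>a. a \<in> carrier (T 0) \<Longrightarrow> a 0 = \<zero>\<^bsub>Q 0\<^esub> \<longleftrightarrow> g divides\<^bsub>T 0\<^esub> a"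
begin

interpretation Tt: tower T tm by (rule T_tower)

abbreviation G where "G j \<equiv> tower_map tm 0 j g"

lemma G_closed: "G j \<in> carrier (T j)"
  using g_closed by (rule Tt.tower_map_closed[rotated]) simp

lemma G_Suc: "G (Suc j) = tm j (G j)"
  by (simp add: tower_map_Suc)

lemma G_kernel: "a \<in> carrier (T j) \<Longrightarrow> a 0 = \<zero>\<^bsub>Q j\<^esub> \<longleftrightarrow> G j divides\<^bsub>T j\<^esub> a"
proof (induction j arbitrary: a)
  case 0
  then show ?case using g_kernel by simp
next
  case (Suc j)
  show ?case
    unfolding G_Suc by (rule kernel_next_level[OF G_closed Suc.IH Suc.prems])
qed

lemma G_0: "G j 0 = \<zero>\<^bsub>Q j\<^esub>"
  using G_kernel[OF G_closed] G_closed by simp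

text \<open>Since \<open>G (Suc j)\<close> is a power of \<open>shift (G j)\<close> with positive exponent, it annihilates \<open>shift c\<close>; this
  reduces the component \<open>i + 1\<close> of \<open>c\<close> to the component \<open>i\<close> of \<open>shift c\<close>.\<close>
lemma G_annihilates_component:
  assumes "c \<in> carrier (T j)" "G j \<otimes>\<^bsub>T j\<^esub> c = \<zero>\<^bsub>T j\<^esub>"
  shows "c i = \<zero>\<^bsub>Q (j + i)\<^esub>"
  using assms
proof (induction i arbitrary: j c)
  case 0
  then show ?case using annihilated_component[OF G_closed G_kernel] by simp
next
  case (Suc i)
  have c: "shift c \<in> carrier (T (Suc j))" using Suc.prems(1) by simp
  have G: "shift (G j) \<in> carrier (T (Suc j))" using G_closed by simp
  have zero: "shift (G j) \<otimes>\<^bsub>T (Suc j)\<^esub> shift c = \<zero>\<^bsub>T (Suc j)\<^esub>"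
    using arg_cong[OF Suc.prems(2), of shift] Suc.prems(1) G_closed[of j] by simp
  have "Suc (p - 1) = p" using p_ge_2 by simp
  then have "G (Suc j) = shift (G j) [^]\<^bsub>T (Suc j)\<^esub> (p - 1) \<otimes>\<^bsub>T (Suc j)\<^esub> shift (G j)"
    unfolding G_Suc tm_eq_shift_pow[OF G_closed] by (metis T.nat_pow_Suc)
  then have "G (Suc j) \<otimes>\<^bsub>T (Suc j)\<^esub> shift c =
      shift (G j) [^]\<^bsub>T (Suc j)\<^esub> (p - 1) \<otimes>\<^bsub>T (Suc j)\<^esub> (shift (G j) \<otimes>\<^bsub>T (Suc j)\<^esub> shift c)"
    using c G by (simp add: T.m_assoc)
  also have "\<dots> = \<zero>\<^bsub>T (Suc j)\<^esub>" unfolding zero using G by simp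
  finally have "shift c i = \<zero>\<^bsub>Q (Suc j + i)\<^esub>" by (rule Suc.IH[OF c])
  then show ?case by (simp add: shift_def)
qed

lemma G_regular: "regular_elt (T j) (G j)"
  unfolding regular_elt_def
proof (intro conjI ballI impI)
  show "G j \<in> carrier (T j)" by (rule G_closed)
  fix c assume "c \<in> carrier (T j)" "G j \<otimes>\<^bsub>T j\<^esub> c = \<zero>\<^bsub>T j\<^esub>"
  then show "c = \<zero>\<^bsub>T j\<^esub>"
    using G_annihilates_component by (intro ext) (simp add: T_simps)
qed

lemma G_reflects:
  assumes x: "x \<in> carrier (T j)" and d: "G (Suc j) divides\<^bsub>T (Suc j)\<^esub> tm j x"
  shows "G j divides\<^bsub>T j\<^esub> x"
proof -
  have "tm j x \<in> carrier (T (Suc j))" using tm_hom x by (rule ring_hom_closed)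
  then have "tm j x 0 = \<zero>\<^bsub>Q (Suc j)\<^esub>" using d G_kernel[of "tm j x" "Suc j"] by simp
  then have "u j (x 0) = u j \<zero>\<^bsub>Q j\<^esub>" by (simp add: frobenius_limit_map_def)
  then have "x 0 = \<zero>\<^bsub>Q j\<^esub>"
    using inj_onD[OF u_inj, of j "x 0" "\<zero>\<^bsub>Q j\<^esub>"] T_closed[OF x, of 0] by simp
  then show ?thesis using G_kernel[OF x] by simp
qed

lemma T_regular_tower: "regular_tower T tm g"
proof (rule regular_tower.intro[OF T_tower regular_tower_axioms.intro])
  show "g \<in> carrier (T 0)" by (rule g_closed)
  show "regular_elt (T i) (G i)" for i by (rule G_regular)
  show "G i divides\<^bsub>T i\<^esub> x"
    if "x \<in> carrier (T i)" "G (Suc i) divides\<^bsub>T (Suc i)\<^esub> tm i x" for i x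
    using that by (rule G_reflects)
qed

end

section \<open>Descending almost integrality from the tilt\<close>

text \<open>A tower of rings together with its quotients modulo \<open>f\<close>, where \<open>f\<^sub>1\<^sup>p\<close> and \<open>f\<close> generate the same ideal
  of \<open>R\<^sub>1\<close>.\<close>
locale lifted_frobenius_tower =
  regular_tower R t f + frobenius_tower_generator Q u F e p g
  for R :: "nat \<Rightarrow> 'a ring" and t f and Q :: "nat \<Rightarrow> 'b ring" and u F e p g +
  fixes q :: "nat \<Rightarrow> 'a \<Rightarrow> 'b" and f1 :: 'a
  assumes q_hom: "\<And>i. q i \<in> ring_hom (R i) (Q i)"
    and q_surj: "\<And>i. q i ` carrier (R i) = carrier (Q i)"
    and q_zero_iff: "\<And>i x. x \<in> carrier (R i) \<Longrightarrow> q i x = \<zero>\<^bsub>Q i\<^esub> \<longleftrightarrow> fl i divides\<^bsub>R i\<^esub> x"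
    and q_t: "\<And>i x. x \<in> carrier (R i) \<Longrightarrow> q (Suc i) (t i x) = u i (q i x)"
    and f1_closed: "f1 \<in> carrier (R 1)"
    and e_eq: "\<And>i. e i = q (Suc i) (tower_map t 1 (Suc i) f1)"
    and fl1_divides: "fl 1 divides\<^bsub>R 1\<^esub> f1 [^]\<^bsub>R 1\<^esub> p"
    and divides_fl1: "f1 [^]\<^bsub>R 1\<^esub> p divides\<^bsub>R 1\<^esub> fl 1"
    and fl_jacobson: "\<And>i. fl i \<in> jacobson_radical (R i)"
begin

sublocale q: ring_hom_cring "R i" "Q i" "q i" for i
  by (intro ring_hom_cring.intro ring_hom_cring_axioms.intro R_cring Q_cring q_hom)

sublocale t: ring_hom_cring "R i" "R (Suc i)" "t i" for i
  by (intro ring_hom_cring.intro ring_hom_cring_axioms.intro R_cring t_hom)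

lemma q_lift:
  assumes "x \<in> carrier (Q i)"
  obtains y where "y \<in> carrier (R i)" "q i y = x"
  using assms that unfolding q_surj[symmetric] by blast

lemma q_eq_iff:
  assumes "x \<in> carrier (R i)" "y \<in> carrier (R i)"
  shows "q i x = q i y \<longleftrightarrow> fl i divides\<^bsub>R i\<^esub> (x \<ominus>\<^bsub>R i\<^esub> y)"
proof -
  have "q i (x \<ominus>\<^bsub>R i\<^esub> y) = q i x \<ominus>\<^bsub>Q i\<^esub> q i y"
    using assms by (simp add: a_minus_def)
  then show ?thesis
    using q_zero_iff[of "x \<ominus>\<^bsub>R i\<^esub> y" i] assms by simp
qed

lemma q_tower_map:
  "x \<in> carrier (R j) \<Longrightarrow> q (j + i) (tower_map t j (j + i) x) = tower_map u j (j + i) (q j x)"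
proof (induction i)
  case (Suc i)
  then show ?case
    using q_t[of "tower_map t j (j + i) x" "j + i"] tower_map_closed[of j "j + i" x]
    by (simp add: tower_map_Suc)
qed simp

text \<open>The components of \<open>G j\<close> are compatible \<open>p\<close>-power roots of zero modulo \<open>f\<close>; lifted to the tower they
  are no more divisible than the corresponding roots of \<open>f\<close> would be.  A congruence modulo \<open>f\<close> becomes a
  divisibility by \<open>divides_of_congruent\<close>: at the first step between \<open>f\<^sub>1\<close> and a multiple of the lift, at
  the later steps between a lift at one level and the \<open>p\<close>-th power of a lift at the next level.  The
  first component, where the exponent is \<open>1\<close>, has to be left out: there \<open>0\<close> may be replaced by any
  multiple of \<open>f\<close>.\<close>
lemma lift_power_divides:
  assumes \<Gamma>: "\<Gamma> \<in> carrier (R (j + Suc i))" "q (j + Suc i) \<Gamma> = G j (Suc i)"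
  shows "\<Gamma> [^]\<^bsub>R (j + Suc i)\<^esub> (p ^ Suc i) divides\<^bsub>R (j + Suc i)\<^esub> fl (j + Suc i)"
  using \<Gamma>
proof (induction i arbitrary: \<Gamma>)
  case 0
  let ?R = "R (Suc j)"
  have \<Gamma>: "\<Gamma> \<in> carrier ?R" "q (Suc j) \<Gamma> = G j 1" using 0 by simp_all
  define \<phi> where "\<phi> = tower_map t 1 (Suc j) f1"
  interpret h: ring_hom_cring "R 1" ?R "tower_map t 1 (Suc j)" by (rule tower_map_hom_cring) simp
  have \<phi>: "\<phi> \<in> carrier ?R" "q (Suc j) \<phi> = e j"
    using h.hom_closed[OF f1_closed] by (simp_all add: \<phi>_def e_eq)
  have fl_h: "tower_map t 1 (Suc j) (fl 1) = fl (Suc j)" by (rule tower_map_fl) simp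
  have \<phi>p: "fl (Suc j) divides\<^bsub>?R\<^esub> \<phi> [^]\<^bsub>?R\<^esub> p" "\<phi> [^]\<^bsub>?R\<^esub> p divides\<^bsub>?R\<^esub> fl (Suc j)"
    using h.hom_divides[OF fl_closed fl1_divides] h.hom_divides[OF Ri.nat_pow_closed[OF f1_closed] divides_fl1]
    by (simp_all only: \<phi>_def fl_h h.hom_pow[OF f1_closed])
  obtain d where d: "d \<in> carrier (Q (Suc j))" "e j = G j 1 \<otimes>\<^bsub>Q (Suc j)\<^esub> d"
    using g1_divides_e[OF G_closed G_kernel] by (auto simp: factor_def)
  obtain s where s: "s \<in> carrier ?R" "q (Suc j) s = d" using d(1) by (rule q_lift)
  have "q (Suc j) \<phi> = q (Suc j) (\<Gamma> \<otimes>\<^bsub>?R\<^esub> s)"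
    using \<phi>(2) d(2) s \<Gamma> by simp
  then have cong: "fl (Suc j) divides\<^bsub>?R\<^esub> (\<phi> \<ominus>\<^bsub>?R\<^esub> \<Gamma> \<otimes>\<^bsub>?R\<^esub> s)"
    using q_eq_iff[OF \<phi>(1), of "\<Gamma> \<otimes>\<^bsub>?R\<^esub> s"] \<Gamma>(1) s(1) by simp
  have \<phi>2: "\<phi> [^]\<^bsub>?R\<^esub> (2::nat) divides\<^bsub>?R\<^esub> fl (Suc j)"
    by (rule Ri.divides_trans[OF Ri.pow_divides_pow[OF \<phi>(1) p_ge_2] \<phi>p(2)]) (use \<phi>(1) in simp)
  have "\<Gamma> \<otimes>\<^bsub>?R\<^esub> s divides\<^bsub>?R\<^esub> \<phi>"
    by (rule divides_of_congruent[OF R_cring fl_jacobson \<phi>(1) _ \<phi>p(1) \<phi>2 cong]) (use \<Gamma>(1) s(1) in simp)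
  then have "\<Gamma> divides\<^bsub>?R\<^esub> \<phi>"
    by (rule Ri.divides_trans[rotated]) (use \<Gamma>(1) s(1) in auto)
  then have "\<Gamma> [^]\<^bsub>?R\<^esub> p divides\<^bsub>?R\<^esub> \<phi> [^]\<^bsub>?R\<^esub> p"
    by (rule Ri.divides_pow) (use \<Gamma>(1) \<phi>(1) in auto)
  then have "\<Gamma> [^]\<^bsub>?R\<^esub> p divides\<^bsub>?R\<^esub> fl (Suc j)"
    by (rule Ri.divides_trans[OF _ \<phi>p(2)]) (use \<Gamma>(1) in simp)
  then show ?case by simp
next
  case (Suc i)
  define k where "k = j + Suc i"
  let ?R = "R (Suc k)" and ?N = "p ^ Suc i"
  have ek: "j + Suc (Suc i) = Suc k" by (simp add: k_def)
  have \<Gamma>: "\<Gamma> \<in> carrier ?R" "q (Suc k) \<Gamma> = G j (Suc (Suc i))" using Suc.prems by (simp_all only: ek)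
  have Gi: "G j (Suc i) \<in> carrier (Q k)" using T_closed[OF G_closed, of j "Suc i"] by (simp add: k_def)
  obtain \<Delta> where \<Delta>: "\<Delta> \<in> carrier (R k)" "q k \<Delta> = G j (Suc i)" using Gi by (rule q_lift)
  have IH: "\<Delta> [^]\<^bsub>R k\<^esub> ?N divides\<^bsub>R k\<^esub> fl k"
    using Suc.IH[of \<Delta>] \<Delta> by (simp add: k_def)
  define x where "x = t k \<Delta>"
  have x: "x \<in> carrier ?R" using \<Delta>(1) by (simp add: x_def)
  have t_fl: "t k (fl k) = fl (Suc k)" by (simp add: tower_map_Suc)
  have xf: "x [^]\<^bsub>?R\<^esub> ?N divides\<^bsub>?R\<^esub> fl (Suc k)"
    using t.hom_divides[OF _ IH] \<Delta>(1) t_fl by (simp add: x_def)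
  have "G j (Suc i) [^]\<^bsub>Q (j + Suc i)\<^esub> ?N = tower_map u j (j + Suc i) \<zero>\<^bsub>Q j\<^esub>"
    using component_pow[OF G_closed, of j "Suc i"] G_0[of j] by simp
  also have "\<dots> = tower_map u j (j + Suc i) (q j \<zero>\<^bsub>R j\<^esub>)" by simp
  also have "\<dots> = q (j + Suc i) (tower_map t j (j + Suc i) \<zero>\<^bsub>R j\<^esub>)" by (rule q_tower_map[symmetric]) simp
  also have "\<dots> = \<zero>\<^bsub>Q (j + Suc i)\<^esub>"
    using ring_hom_cring.hom_zero[OF tower_map_hom_cring[of j "j + Suc i"]] q.hom_zero[of "j + Suc i"] by simp
  finally have "q k (\<Delta> [^]\<^bsub>R k\<^esub> ?N) = \<zero>\<^bsub>Q k\<^esub>"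
    using \<Delta> by (simp add: k_def)
  then have "fl k divides\<^bsub>R k\<^esub> \<Delta> [^]\<^bsub>R k\<^esub> ?N" using q_zero_iff[of "\<Delta> [^]\<^bsub>R k\<^esub> ?N" k] \<Delta>(1) by simp
  then have fx: "fl (Suc k) divides\<^bsub>?R\<^esub> x [^]\<^bsub>?R\<^esub> ?N"
    using t.hom_divides[OF fl_closed, of k "\<Delta> [^]\<^bsub>R k\<^esub> ?N"] \<Delta>(1) t_fl by (simp add: x_def)
  have "p \<le> ?N" using p_ge_2 by simp
  then have "2 \<le> ?N" using p_ge_2 by (rule order.trans[rotated])
  then have x2: "x [^]\<^bsub>?R\<^esub> (2::nat) divides\<^bsub>?R\<^esub> fl (Suc k)"
    by (intro Ri.divides_trans[OF Ri.pow_divides_pow[OF x] xf]) (use x in simp_all)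
  have "q (Suc k) (\<Gamma> [^]\<^bsub>?R\<^esub> p) = u k (F k (G j (Suc (Suc i))))"
    using \<Gamma> T_closed[OF G_closed, of j "Suc (Suc i)"] unfolding ek by (simp add: u_F)
  also have "F k (G j (Suc (Suc i))) = G j (Suc i)"
    using T_compat[OF G_closed, of j "Suc i"] by (simp add: k_def)
  also have "u k (G j (Suc i)) = q (Suc k) x" using q_t[OF \<Delta>(1)] \<Delta>(2) by (simp add: x_def)
  finally have cong: "fl (Suc k) divides\<^bsub>?R\<^esub> (x \<ominus>\<^bsub>?R\<^esub> \<Gamma> [^]\<^bsub>?R\<^esub> p)"
    using q_eq_iff[of x "Suc k" "\<Gamma> [^]\<^bsub>?R\<^esub> p"] x \<Gamma>(1) by simp
  have "\<Gamma> [^]\<^bsub>?R\<^esub> p divides\<^bsub>?R\<^esub> x"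
    by (rule divides_of_congruent[OF R_cring fl_jacobson x _ fx x2 cong]) (use \<Gamma>(1) in simp)
  then have "(\<Gamma> [^]\<^bsub>?R\<^esub> p) [^]\<^bsub>?R\<^esub> ?N divides\<^bsub>?R\<^esub> x [^]\<^bsub>?R\<^esub> ?N"
    by (rule Ri.divides_pow) (use \<Gamma>(1) x in auto)
  then have "\<Gamma> [^]\<^bsub>?R\<^esub> (p ^ Suc (Suc i)) divides\<^bsub>?R\<^esub> x [^]\<^bsub>?R\<^esub> ?N"
    using \<Gamma>(1) by (simp add: Ri.nat_pow_pow)
  then have "\<Gamma> [^]\<^bsub>?R\<^esub> (p ^ Suc (Suc i)) divides\<^bsub>?R\<^esub> fl (Suc k)"
    by (rule Ri.divides_trans[OF _ xf]) (use \<Gamma>(1) in simp)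
  then show ?case by (simp only: ek)
qed

text \<open>Let \<open>\<Gamma>\<close> lift the component \<open>i\<close> of \<open>G j\<close> and let \<open>C\<close> lift \<open>c 0\<close>.  In component \<open>i\<close>, the \<open>p\<^sup>i\<close>-th power of
  \<open>G j\<close> vanishes while that of \<open>c\<close> is the image of \<open>c 0\<close>.  Hence the assumption on \<open>c\<close>, for the exponent
  \<open>p\<^sup>i\<close>, says that \<open>f\<close> divides \<open>\<Gamma>\<^sup>m C\<close>.  For given \<open>n\<close> and large \<open>i\<close>, the \<open>n\<close>-th power of \<open>\<Gamma>\<^sup>m\<close> divides
  \<open>f\<close>.  So \<open>f (C/f)\<^sup>n\<close> belongs to \<open>R j\<close> for all \<open>n\<close>.\<close>
theorem power_closed_tilt:
  assumes pc: "power_closed (R j) (fl j)"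
  shows "power_closed (T j) (G j)"
  unfolding power_closed_def
proof (intro ballI impI)
  fix c assume c: "c \<in> carrier (T j)"
    and "\<exists>m::nat. \<forall>n::nat. G j [^]\<^bsub>T j\<^esub> n divides\<^bsub>T j\<^esub> G j [^]\<^bsub>T j\<^esub> m \<otimes>\<^bsub>T j\<^esub> c [^]\<^bsub>T j\<^esub> n"
  then obtain m :: nat where
    m: "\<And>n::nat. G j [^]\<^bsub>T j\<^esub> n divides\<^bsub>T j\<^esub> G j [^]\<^bsub>T j\<^esub> m \<otimes>\<^bsub>T j\<^esub> c [^]\<^bsub>T j\<^esub> n" by blast
  have "c 0 \<in> carrier (Q j)" using T_closed[OF c, of 0] by simp
  then obtain C where C: "C \<in> carrier (R j)" "q j C = c 0" by (rule q_lift)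
  have "fl j [^]\<^bsub>R j\<^esub> n divides\<^bsub>R j\<^esub> fl j [^]\<^bsub>R j\<^esub> (1::nat) \<otimes>\<^bsub>R j\<^esub> C [^]\<^bsub>R j\<^esub> n" for n :: nat
  proof -
    \<comment> \<open>Any positive \<open>i\<close> with \<open>m * n \<le> p ^ i\<close> will do.\<close>
    define i where "i = Suc (m * n)"
    define k where "k = j + i"
    have jk: "j \<le> k" by (simp add: k_def)
    interpret h: ring_hom_cring "R j" "R k" "tower_map t j k" using jk by (rule tower_map_hom_cring)
    define D where "D = tower_map t j k C"
    have D: "D \<in> carrier (R k)" using C(1) by (simp add: D_def)
    have Gi: "G j i \<in> carrier (Q k)" using T_closed[OF G_closed, of j i] by (simp add: k_def)
    obtain \<Gamma> where \<Gamma>: "\<Gamma> \<in> carrier (R k)" "q k \<Gamma> = G j i" using Gi by (rule q_lift)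
    have \<Gamma>_div: "\<Gamma> [^]\<^bsub>R k\<^esub> (p ^ i) divides\<^bsub>R k\<^esub> fl k"
      using lift_power_divides[of \<Gamma> j "m * n"] \<Gamma> by (simp add: k_def i_def del: power_Suc)
    have "m * n \<le> p ^ i"
    proof -
      have "m * n < 2 ^ (m * n)" by (rule less_exp)
      also have "\<dots> \<le> 2 ^ i" by (rule power_increasing) (simp_all add: i_def)
      also have "\<dots> \<le> p ^ i" using p_ge_2 by (rule power_mono) simp
      finally show ?thesis by simp
    qed
    then have "\<Gamma> [^]\<^bsub>R k\<^esub> (m * n) divides\<^bsub>R k\<^esub> fl k"
      by (intro Ri.divides_trans[OF Ri.pow_divides_pow[OF \<Gamma>(1)] \<Gamma>_div]) (use \<Gamma>(1) in simp_all)
    then obtain s where s: "s \<in> carrier (R k)" "fl k = \<Gamma> [^]\<^bsub>R k\<^esub> (m * n) \<otimes>\<^bsub>R k\<^esub> s"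
      by (auto simp: factor_def)
    obtain d where d: "d \<in> carrier (T j)"
      "G j [^]\<^bsub>T j\<^esub> m \<otimes>\<^bsub>T j\<^esub> c [^]\<^bsub>T j\<^esub> (p ^ i) = G j [^]\<^bsub>T j\<^esub> (p ^ i) \<otimes>\<^bsub>T j\<^esub> d"
      using m[of "p ^ i"] by (auto simp: factor_def)
    have di: "d i \<in> carrier (Q k)" using T_closed[OF d(1)] by (simp add: k_def)
    have "tower_map u j k \<zero>\<^bsub>Q j\<^esub> = q k (tower_map t j k \<zero>\<^bsub>R j\<^esub>)"
      unfolding k_def by (subst q_tower_map) simp_all
    then have G_pow: "G j i [^]\<^bsub>Q k\<^esub> (p ^ i) = \<zero>\<^bsub>Q k\<^esub>"
      using component_pow[OF G_closed, of j i] G_0[of j] by (simp add: k_def[symmetric])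
    have c_pow: "c i [^]\<^bsub>Q k\<^esub> (p ^ i) = q k D"
      using component_pow[OF c, of i] q_tower_map[OF C(1), of i] C(2)
      by (simp add: k_def[symmetric] D_def)
    have "G j i [^]\<^bsub>Q k\<^esub> m \<otimes>\<^bsub>Q k\<^esub> c i [^]\<^bsub>Q k\<^esub> (p ^ i) = G j i [^]\<^bsub>Q k\<^esub> (p ^ i) \<otimes>\<^bsub>Q k\<^esub> d i"
      using arg_cong[OF d(2), of "\<lambda>a. a i"] by (simp add: T_simps k_def)
    then have "q k (\<Gamma> [^]\<^bsub>R k\<^esub> m \<otimes>\<^bsub>R k\<^esub> D) = \<zero>\<^bsub>Q k\<^esub>"
      using G_pow c_pow \<Gamma> D di by simp
    then have "fl k divides\<^bsub>R k\<^esub> \<Gamma> [^]\<^bsub>R k\<^esub> m \<otimes>\<^bsub>R k\<^esub> D"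
      using q_zero_iff[of "\<Gamma> [^]\<^bsub>R k\<^esub> m \<otimes>\<^bsub>R k\<^esub> D" k] \<Gamma>(1) D by simp
    then have "fl k [^]\<^bsub>R k\<^esub> n divides\<^bsub>R k\<^esub> (\<Gamma> [^]\<^bsub>R k\<^esub> m \<otimes>\<^bsub>R k\<^esub> D) [^]\<^bsub>R k\<^esub> n"
      by (rule Ri.divides_pow) (use fl_closed \<Gamma>(1) D in auto)
    then have "fl k [^]\<^bsub>R k\<^esub> n divides\<^bsub>R k\<^esub> (\<Gamma> [^]\<^bsub>R k\<^esub> m \<otimes>\<^bsub>R k\<^esub> D) [^]\<^bsub>R k\<^esub> n \<otimes>\<^bsub>R k\<^esub> s"
      by (rule Ri.divides_prod_r) (use fl_closed s(1) in auto)
    also have "(\<Gamma> [^]\<^bsub>R k\<^esub> m \<otimes>\<^bsub>R k\<^esub> D) [^]\<^bsub>R k\<^esub> n \<otimes>\<^bsub>R k\<^esub> s = fl k \<otimes>\<^bsub>R k\<^esub> D [^]\<^bsub>R k\<^esub> n"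
      unfolding s(2) using \<Gamma>(1) D s(1)
      by (simp add: Ri.nat_pow_distrib Ri.nat_pow_pow Ri.m_ac)
    also have "\<dots> = tower_map t j k (fl j [^]\<^bsub>R j\<^esub> (1::nat) \<otimes>\<^bsub>R j\<^esub> C [^]\<^bsub>R j\<^esub> n)"
      using C(1) fl_closed[of j] tower_map_fl[OF jk] by (simp add: D_def)
    finally show ?thesis
      by (rule tower_map_reflects_power[OF jk, rotated]) (use C(1) fl_closed in simp)
  qed
  then have "fl j divides\<^bsub>R j\<^esub> C" using pc C(1) unfolding power_closed_def by blast
  then have "c 0 = \<zero>\<^bsub>Q j\<^esub>" using q_zero_iff[OF C(1)] C(2) by simp
  then show "G j divides\<^bsub>T j\<^esub> c" using G_kernel[OF c] by simp
qed

end

section \<open>Perfectoid towers\<close>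

locale principal_perfectoid_tower =
  fixes p :: nat and A :: "'a ring" and f :: 'a and R :: "nat \<Rightarrow> 'a ring" and t :: "nat \<Rightarrow> 'a \<Rightarrow> 'a"
  assumes prime_p: "Factorial_Ring.prime p"
    and A_cring: "cring A"
    and f_closed: "f \<in> carrier A"
    and perfectoid: "perfectoid_tower p A (Idl\<^bsub>A\<^esub> {f}) R t"
    and torsion_free: "torsion_free_elt A f"
begin

abbreviation I where "I \<equiv> Idl\<^bsub>A\<^esub> {f}"

abbreviation Q where "Q \<equiv> level_quot R t I"
abbreviation q where "q i \<equiv> (+>\<^bsub>R i\<^esub>) (level_ideal R t I i)"
abbreviation u where "u \<equiv> level_map R t I"
abbreviation F where "F \<equiv> frob_proj p R t I"

lemma tower_R: "ring_tower R t"
  using perfectoid unfolding perfectoid_tower_def by (elim conjE) assumption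

lemma R_0: "R 0 = A"
  using perfectoid unfolding perfectoid_tower_def by (elim conjE) assumption

lemma u_inj: "inj_on (u i) (carrier (Q i))"
  using perfectoid unfolding perfectoid_tower_def by (elim conjE) (erule spec)

lemma frob_factor_exists: "\<exists>F. frob_factor p R t I i F"
  using perfectoid unfolding perfectoid_tower_def by (elim conjE) (erule spec)

lemma F_surj: "F i ` carrier (Q (Suc i)) = carrier (Q i)"
  using perfectoid unfolding perfectoid_tower_def by (elim conjE) (erule spec)

lemma level_ideal_jacobson: "level_ideal R t I i \<subseteq> jacobson_radical (R i)"
  using perfectoid unfolding perfectoid_tower_def by (elim conjE) (erule spec)

lemma root_ideal: "\<exists>I\<^sub>1. principalideal I\<^sub>1 (R 1) \<and>
    I\<^sub>1 [^]\<^bsub>ideals_set (R 1)\<^esub> p = level_ideal R t I 1 \<and>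
    (\<forall>i. a_kernel (Q (Suc i)) (Q i) (F i)
      = Idl\<^bsub>Q (Suc i)\<^esub> ((\<lambda>x. q (Suc i) (tower_map t 1 (Suc i) x)) ` I\<^sub>1))"
  using perfectoid unfolding perfectoid_tower_def by (elim conjE) assumption

lemma torsion_bij: "\<exists>G. bij_betw G (level_torsion R t I (Suc i)) (level_torsion R t I i)"
proof -
  have "\<exists>G. bij_betw G (level_torsion R t I (Suc i)) (level_torsion R t I i) \<and>
      (\<forall>x\<in>level_torsion R t I (Suc i). F i (q (Suc i) x) = q i (G x))"
    using perfectoid unfolding perfectoid_tower_def
    by (elim conjE allE[of _ i]) assumption
  then show ?thesis by (elim exE conjE) (rule exI)
qed

sublocale tower R t
  by (rule tower.intro[OF tower_R])

lemma f_closed': "f \<in> carrier (R 0)"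
  using f_closed by (simp add: R_0)

lemma gen_closed: "tower_map t 0 i f \<in> carrier (R i)"
  by (rule tower_map_closed) (simp_all add: f_closed')

lemma level_ideal_eq: "level_ideal R t I i = PIdl\<^bsub>R i\<^esub> (tower_map t 0 i f)"
  unfolding level_ideal_def R_0[symmetric]
  by (rule Idl_image_principal[OF R_cring R_cring tower_map_hom f_closed']) simp

lemma Q_cring: "cring (Q i)"
  unfolding level_quot_def level_ideal_eq by (rule Ri.cring_quot_principal[OF gen_closed])

lemma q_hom: "q i \<in> ring_hom (R i) (Q i)"
  unfolding level_quot_def level_ideal_eq by (rule Ri.hom_quot_principal[OF gen_closed])

lemma q_surj: "q i ` carrier (R i) = carrier (Q i)"
proof
  show "q i ` carrier (R i) \<subseteq> carrier (Q i)" using ring_hom_closed[OF q_hom] by blast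
  show "carrier (Q i) \<subseteq> q i ` carrier (R i)"
    unfolding level_quot_def by (auto elim: Ri.quot_cases)
qed

lemma q_zero_iff: "x \<in> carrier (R i) \<Longrightarrow> q i x = \<zero>\<^bsub>Q i\<^esub> \<longleftrightarrow> tower_map t 0 i f divides\<^bsub>R i\<^esub> x"
  unfolding level_quot_def level_ideal_eq by (rule Ri.coset_principal_zero_iff[OF gen_closed])

lemma t_image: "t i ` level_ideal R t I i \<subseteq> level_ideal R t I (Suc i)"
proof
  fix y assume "y \<in> t i ` level_ideal R t I i"
  then obtain r where r: "r \<in> carrier (R i)" "y = t i (r \<otimes>\<^bsub>R i\<^esub> tower_map t 0 i f)"
    by (auto simp: level_ideal_eq cgenideal_def)
  then have "y = t i r \<otimes>\<^bsub>R (Suc i)\<^esub> tower_map t 0 (Suc i) f"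
    using ring_hom_mult[OF t_hom r(1) gen_closed] by (simp add: tower_map_Suc)
  then show "y \<in> level_ideal R t I (Suc i)"
    using ring_hom_closed[OF t_hom r(1)] by (auto simp: level_ideal_eq cgenideal_def)
qed

lemma level_ideal_ideal: "ideal (level_ideal R t I i) (R i)"
  unfolding level_ideal_eq by (rule Ri.cgenideal_ideal[OF gen_closed])

lemma u_hom: "u i \<in> ring_hom (Q i) (Q (Suc i))"
  unfolding level_map_def level_quot_def
  by (rule quot_map_hom[OF R_cring R_cring t_hom level_ideal_ideal level_ideal_ideal t_image])

lemma u_q: "x \<in> carrier (R i) \<Longrightarrow> u i (q i x) = q (Suc i) (t i x)"
  unfolding level_map_def
  by (rule quot_map_coset[OF R_cring R_cring t_hom level_ideal_ideal level_ideal_ideal t_image])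

text \<open>A factor as in \<open>frob_factor\<close> is unique on the carrier because \<open>u i\<close> is injective, so that the definite
  description in \<open>frob_proj\<close> denotes it.\<close>
lemma frob_factor_F: "frob_factor p R t I i (F i)"
proof -
  interpret Q: cring "Q j" for j by (rule Q_cring)
  obtain F0 where F0: "frob_factor p R t I i F0"
    using frob_factor_exists[of i] by auto
  have "\<exists>!F. F \<in> extensional (carrier (Q (Suc i))) \<and> frob_factor p R t I i F"
  proof (rule ex1I)
    let ?F = "restrict F0 (carrier (Q (Suc i)))"
    have "?F \<in> ring_hom (Q (Suc i)) (Q i)"
      by (rule Q.ring_hom_restrict[of F0]) (use F0 in \<open>simp_all add: frob_factor_def\<close>)
    then show "?F \<in> extensional (carrier (Q (Suc i))) \<and> frob_factor p R t I i ?F"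
      using F0 by (simp add: frob_factor_def)
    fix G assume G: "G \<in> extensional (carrier (Q (Suc i))) \<and> frob_factor p R t I i G"
    show "G = ?F"
    proof (rule extensionalityI)
      show "G \<in> extensional (carrier (Q (Suc i)))" using G by simp
      fix x assume x: "x \<in> carrier (Q (Suc i))"
      have GF: "frob_factor p R t I i G" using G by simp
      have eq: "u i (G x) = u i (F0 x)" using GF F0 x by (simp add: frob_factor_def)
      have "G x \<in> carrier (Q i)" "F0 x \<in> carrier (Q i)"
        using GF F0 unfolding frob_factor_def by (auto intro: ring_hom_closed[OF _ x])
      then have "G x = F0 x" by (rule inj_onD[OF u_inj eq])
      then show "G x = ?F x" using x by simp
    qed simp
  qed
  from theI'[OF this] show ?thesis
    unfolding frob_proj_def by (elim conjE)
qed

lemma F_hom: "F i \<in> ring_hom (Q (Suc i)) (Q i)"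
  using frob_factor_F by (simp add: frob_factor_def)

lemma u_F: "x \<in> carrier (Q (Suc i)) \<Longrightarrow> u i (F i x) = x [^]\<^bsub>Q (Suc i)\<^esub> p"
  using frob_factor_F[of i] by (simp add: frob_factor_def)

lemma gen_jacobson: "tower_map t 0 i f \<in> jacobson_radical (R i)"
proof -
  show ?thesis using level_ideal_jacobson[of i] Ri.cgenideal_self[OF gen_closed] by (auto simp: level_ideal_eq)
qed

lemma I_eq: "I = PIdl\<^bsub>R 0\<^esub> f"
  using Ri.cgenideal_eq_genideal[OF f_closed'] by (simp add: R_0)

lemma annihilated_in_level_torsion:
  assumes x: "x \<in> carrier (R i)" and zero: "tower_map t 0 i f \<otimes>\<^bsub>R i\<^esub> x = \<zero>\<^bsub>R i\<^esub>"
  shows "x \<in> level_torsion R t I i"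
proof -
  interpret h: ring_hom_cring "R 0" "R i" "tower_map t 0 i" by (rule tower_map_hom_cring) simp
  have "tower_map t 0 i (a [^]\<^bsub>R 0\<^esub> (1::nat)) \<otimes>\<^bsub>R i\<^esub> x = \<zero>\<^bsub>R i\<^esub>" if "a \<in> I" for a
  proof -
    obtain r where r: "r \<in> carrier (R 0)" "a = r \<otimes>\<^bsub>R 0\<^esub> f"
      using \<open>a \<in> I\<close> by (auto simp: I_eq cgenideal_def)
    have "tower_map t 0 i (a [^]\<^bsub>R 0\<^esub> (1::nat)) \<otimes>\<^bsub>R i\<^esub> x =
        tower_map t 0 i r \<otimes>\<^bsub>R i\<^esub> (tower_map t 0 i f \<otimes>\<^bsub>R i\<^esub> x)"
      unfolding r(2) using r(1) f_closed' x by (simp add: Ri.m_assoc)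
    then show ?thesis using zero r(1) by simp
  qed
  then show ?thesis
    using x unfolding level_torsion_def torsion_def module_via_def
    by (auto intro!: exI[of _ 1])
qed

text \<open>The bijections between the torsion parts transport the vanishing from level \<open>0\<close> to all levels.\<close>
lemma level_torsion_zero: "level_torsion R t I i = {\<zero>\<^bsub>R i\<^esub>}"
proof (induction i)
  case 0
  have "tower_map t 0 0 = (\<lambda>a. a)" by (rule ext) simp
  then show ?case
    using torsion_free by (simp add: torsion_free_elt_def level_torsion_def R_0)
next
  case (Suc i)
  obtain G where "bij_betw G (level_torsion R t I (Suc i)) (level_torsion R t I i)"
    using torsion_bij[of i] by auto
  then have "card (level_torsion R t I (Suc i)) = 1"
    using bij_betw_same_card Suc by fastforce
  then obtain z where z: "level_torsion R t I (Suc i) = {z}" by (auto simp: card_1_singleton_iff)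
  have "\<zero>\<^bsub>R (Suc i)\<^esub> \<in> level_torsion R t I (Suc i)"
    using gen_closed by (intro annihilated_in_level_torsion) simp_all
  then show ?case using z by simp
qed

lemma gen_regular: "regular_elt (R i) (tower_map t 0 i f)"
  unfolding regular_elt_def using gen_closed annihilated_in_level_torsion level_torsion_zero by blast

sublocale regular_tower R t f
proof
  show "f \<in> carrier (R 0)" by (rule f_closed')
  show "regular_elt (R i) (tower_map t 0 i f)" for i by (rule gen_regular)
  fix i x assume x: "x \<in> carrier (R i)" and d: "tower_map t 0 (Suc i) f divides\<^bsub>R (Suc i)\<^esub> t i x"
  interpret q: ring_hom_cring "R j" "Q j" "q j" for j
    by (intro ring_hom_cring.intro ring_hom_cring_axioms.intro R_cring Q_cring q_hom)
  interpret u: ring_hom_cring "Q j" "Q (Suc j)" "u j" for j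
    by (intro ring_hom_cring.intro ring_hom_cring_axioms.intro Q_cring u_hom)
  have "u i (q i x) = u i \<zero>\<^bsub>Q i\<^esub>"
    using d x q_zero_iff[of "t i x" "Suc i"] ring_hom_closed[OF t_hom x] by (simp add: u_q)
  then have "q i x = \<zero>\<^bsub>Q i\<^esub>"
    using inj_onD[OF u_inj, of i "q i x" "\<zero>\<^bsub>Q i\<^esub>"] x by simp
  then show "tower_map t 0 i f divides\<^bsub>R i\<^esub> x" using q_zero_iff x by simp
qed

lemma small_tilt_eq: "small_tilt p R t I = frobenius_limit Q F"
  by (rule ext) (simp add: small_tilt_def frobenius_limit_def)

lemma small_tilt_map_eq: "small_tilt_map R t I = frobenius_limit_map u"
  by (intro ext) (simp add: small_tilt_map_def frobenius_limit_map_def)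

lemma root_generator:
  obtains f1 where "f1 \<in> carrier (R 1)"
    "fl 1 divides\<^bsub>R 1\<^esub> f1 [^]\<^bsub>R 1\<^esub> p" "f1 [^]\<^bsub>R 1\<^esub> p divides\<^bsub>R 1\<^esub> fl 1"
    "\<And>i. a_kernel (Q (Suc i)) (Q i) (F i) = PIdl\<^bsub>Q (Suc i)\<^esub> (q (Suc i) (tower_map t 1 (Suc i) f1))"
proof -
  obtain I1 where I1: "principalideal I1 (R 1)" "I1 [^]\<^bsub>ideals_set (R 1)\<^esub> p = level_ideal R t I 1"
    and ker: "\<And>i. a_kernel (Q (Suc i)) (Q i) (F i)
          = Idl\<^bsub>Q (Suc i)\<^esub> ((\<lambda>x. q (Suc i) (tower_map t 1 (Suc i) x)) ` I1)"
    using root_ideal by (elim exE conjE) (rule that, assumption+, erule spec)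
  obtain f1 where f1: "f1 \<in> carrier (R 1)" "I1 = Idl\<^bsub>R 1\<^esub> {f1}"
    using principalideal.generate[OF I1(1)] by blast
  have f1p: "f1 [^]\<^bsub>R 1\<^esub> p \<in> carrier (R 1)" using f1(1) by (rule Ri.nat_pow_closed)
  have "PIdl\<^bsub>R 1\<^esub> (f1 [^]\<^bsub>R 1\<^esub> p) = PIdl\<^bsub>R 1\<^esub> (fl 1)"
    using I1(2) Ri.principal_ideal_power[OF f1(1), of p] Ri.cgenideal_eq_genideal[OF f1(1)]
    by (simp only: f1(2) level_ideal_eq)
  then have "fl 1 divides\<^bsub>R 1\<^esub> f1 [^]\<^bsub>R 1\<^esub> p" "f1 [^]\<^bsub>R 1\<^esub> p divides\<^bsub>R 1\<^esub> fl 1"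
    using Ri.cgenideal_self[OF f1p] Ri.cgenideal_self[OF fl_closed[of 1]]
      Ri.mem_cgenideal_iff[OF f1p fl_closed[of 1]] Ri.mem_cgenideal_iff[OF fl_closed[of 1] f1p]
    by simp_all
  moreover have "a_kernel (Q (Suc i)) (Q i) (F i) = PIdl\<^bsub>Q (Suc i)\<^esub> (q (Suc i) (tower_map t 1 (Suc i) f1))"
    for i
  proof -
    have "q (Suc i) \<circ> tower_map t 1 (Suc i) \<in> ring_hom (R 1) (Q (Suc i))"
      by (rule ring_hom_trans[OF tower_map_hom q_hom]) simp
    from Idl_image_principal[OF R_cring Q_cring this f1(1)]
    show ?thesis unfolding ker f1(2) by (simp only: comp_def)
  qed
  ultimately show ?thesis using that f1(1) by blast
qed

text \<open>The only condition that is not read off from the definition of a perfectoid tower concerns the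
  annihilator of the class of \<open>f\<^sub>1\<close>.  Writing \<open>f = \<phi>\<^sup>p w\<close> for the image \<open>\<phi>\<close> of \<open>f\<^sub>1\<close>, if \<open>f\<close> divides \<open>\<phi> y\<close>, then
  cancelling \<open>\<phi>\<close> shows that \<open>\<phi>\<^sup>p\<^sup>-\<^sup>1\<close> divides \<open>y\<close>.\<close>
lemma tilt_lifted_frobenius_tower:
  assumes g: "g \<in> carrier (small_tilt p R t I 0)"
    and gen: "small_tilt_ideal p R t I = Idl\<^bsub>small_tilt p R t I 0\<^esub> {g}"
  obtains f1 where
    "lifted_frobenius_tower R t f Q u F (\<lambda>i. q (Suc i) (tower_map t 1 (Suc i) f1)) p g q f1"
proof -
  obtain f1 where f1: "f1 \<in> carrier (R 1)"
    and d: "fl 1 divides\<^bsub>R 1\<^esub> f1 [^]\<^bsub>R 1\<^esub> p" "f1 [^]\<^bsub>R 1\<^esub> p divides\<^bsub>R 1\<^esub> fl 1"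
    and ker: "\<And>i. a_kernel (Q (Suc i)) (Q i) (F i) = PIdl\<^bsub>Q (Suc i)\<^esub> (q (Suc i) (tower_map t 1 (Suc i) f1))"
    using root_generator by metis
  define e where "e = (\<lambda>i. q (Suc i) (tower_map t 1 (Suc i) f1))"
  interpret Qc: cring "Q i" for i by (rule Q_cring)
  have p2: "2 \<le> p" using prime_p by (rule prime_ge_2_nat)
  have \<phi>: "tower_map t 1 (Suc i) f1 \<in> carrier (R (Suc i))" for i
    by (rule tower_map_closed[OF _ f1]) simp
  have e_closed: "e i \<in> carrier (Q (Suc i))" for i
    unfolding e_def using q_hom \<phi> by (rule ring_hom_closed)
  have "frobenius_tower Q u F e p"
  proof
    fix i x assume x: "x \<in> carrier (Q (Suc i))"
    have "F i x = \<zero>\<^bsub>Q i\<^esub> \<longleftrightarrow> x \<in> a_kernel (Q (Suc i)) (Q i) (F i)"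
      using x by (simp add: a_kernel_def')
    also have "\<dots> \<longleftrightarrow> e i divides\<^bsub>Q (Suc i)\<^esub> x"
      unfolding ker using Qc.mem_cgenideal_iff[OF e_closed x] by (simp only: e_def)
    finally show "F i x = \<zero>\<^bsub>Q i\<^esub> \<longleftrightarrow> e i divides\<^bsub>Q (Suc i)\<^esub> x" .
    assume zero: "e i \<otimes>\<^bsub>Q (Suc i)\<^esub> x = \<zero>\<^bsub>Q (Suc i)\<^esub>"
    let ?R = "R (Suc i)" and ?\<phi> = "tower_map t 1 (Suc i) f1"
    interpret h: ring_hom_cring "R 1" ?R "tower_map t 1 (Suc i)" by (rule tower_map_hom_cring) simp
    interpret qi: ring_hom_cring ?R "Q (Suc i)" "q (Suc i)"
      by (intro ring_hom_cring.intro ring_hom_cring_axioms.intro R_cring Q_cring q_hom)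
    have "x \<in> q (Suc i) ` carrier ?R" using x by (simp add: q_surj)
    then obtain y where y: "y \<in> carrier ?R" "x = q (Suc i) y" by blast
    obtain v where v: "v \<in> carrier (R 1)" "fl 1 = f1 [^]\<^bsub>R 1\<^esub> p \<otimes>\<^bsub>R 1\<^esub> v"
      using d(2) by (rule dividesE)
    define w where "w = tower_map t 1 (Suc i) v"
    have w: "w \<in> carrier ?R" unfolding w_def using v(1) by (rule h.hom_closed)
    have fl_h: "tower_map t 1 (Suc i) (fl 1) = fl (Suc i)" by (rule tower_map_fl) simp
    have "fl (Suc i) = ?\<phi> [^]\<^bsub>?R\<^esub> p \<otimes>\<^bsub>?R\<^esub> w"
      unfolding fl_h[symmetric] v(2) w_def
      by (simp only: h.hom_mult[OF Ri.nat_pow_closed[OF f1] v(1)] h.hom_pow[OF f1])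
    moreover have "?\<phi> [^]\<^bsub>?R\<^esub> p = ?\<phi> \<otimes>\<^bsub>?R\<^esub> ?\<phi> [^]\<^bsub>?R\<^esub> (p - 1)"
    proof -
      have "Suc (p - 1) = p" using p2 by simp
      then show ?thesis using Ri.nat_pow_Suc2[OF \<phi>, of i "p - 1"] by (simp only:)
    qed
    ultimately have fl_eq: "fl (Suc i) = ?\<phi> \<otimes>\<^bsub>?R\<^esub> (?\<phi> [^]\<^bsub>?R\<^esub> (p - 1) \<otimes>\<^bsub>?R\<^esub> w)"
      using \<phi> w by (simp only: Ri.m_assoc Ri.nat_pow_closed)
    have \<phi>_regular: "regular_elt ?R ?\<phi>"
      unfolding regular_elt_def
    proof (intro conjI ballI impI)
      show "?\<phi> \<in> carrier ?R" by (rule \<phi>)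
      fix z assume z: "z \<in> carrier ?R" and \<phi>z: "?\<phi> \<otimes>\<^bsub>?R\<^esub> z = \<zero>\<^bsub>?R\<^esub>"
      have "fl (Suc i) \<otimes>\<^bsub>?R\<^esub> z = (?\<phi> [^]\<^bsub>?R\<^esub> (p - 1) \<otimes>\<^bsub>?R\<^esub> w) \<otimes>\<^bsub>?R\<^esub> (?\<phi> \<otimes>\<^bsub>?R\<^esub> z)"
        unfolding fl_eq using \<phi>[of i] w z by (simp add: Ri.m_ac del: One_nat_def)
      then have "fl (Suc i) \<otimes>\<^bsub>?R\<^esub> z = \<zero>\<^bsub>?R\<^esub>"
        unfolding \<phi>z using \<phi>[of i] w by (simp del: One_nat_def)
      then show "z = \<zero>\<^bsub>?R\<^esub>" using level_regular[of "Suc i"] z by (simp add: regular_elt_def)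
    qed
    have "q (Suc i) (?\<phi> \<otimes>\<^bsub>?R\<^esub> y) = \<zero>\<^bsub>Q (Suc i)\<^esub>"
      using zero unfolding y(2) e_def ring_hom_mult[OF q_hom \<phi> y(1)] .
    then have "fl (Suc i) divides\<^bsub>?R\<^esub> ?\<phi> \<otimes>\<^bsub>?R\<^esub> y"
      using q_zero_iff[OF Ri.m_closed[OF \<phi> y(1)]] by simp
    then obtain b where b: "b \<in> carrier ?R" "?\<phi> \<otimes>\<^bsub>?R\<^esub> y = fl (Suc i) \<otimes>\<^bsub>?R\<^esub> b"
      by (rule dividesE)
    have "?\<phi> \<otimes>\<^bsub>?R\<^esub> y = ?\<phi> \<otimes>\<^bsub>?R\<^esub> (?\<phi> [^]\<^bsub>?R\<^esub> (p - 1) \<otimes>\<^bsub>?R\<^esub> (w \<otimes>\<^bsub>?R\<^esub> b))"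
      unfolding b(2) fl_eq using \<phi>[of i] w b(1) by (simp add: Ri.m_assoc del: One_nat_def)
    then have "y = ?\<phi> [^]\<^bsub>?R\<^esub> (p - 1) \<otimes>\<^bsub>?R\<^esub> (w \<otimes>\<^bsub>?R\<^esub> b)"
      by (rule Ri.regular_elt_cancel[OF \<phi>_regular y(1), rotated])
        (use \<phi>[of i] w b(1) in \<open>simp del: One_nat_def\<close>)
    then have "?\<phi> [^]\<^bsub>?R\<^esub> (p - 1) divides\<^bsub>?R\<^esub> y"
      by (rule dividesI') (use w b(1) in simp)
    then have "q (Suc i) (?\<phi> [^]\<^bsub>?R\<^esub> (p - 1)) divides\<^bsub>Q (Suc i)\<^esub> x"
      unfolding y(2) by (rule qi.hom_divides[OF Ri.nat_pow_closed[OF \<phi>]])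
    then show "e i [^]\<^bsub>Q (Suc i)\<^esub> (p - 1) divides\<^bsub>Q (Suc i)\<^esub> x"
      by (simp only: e_def qi.hom_pow[OF \<phi>])
  qed (use Q_cring u_hom u_inj F_hom F_surj u_F p2 e_closed in simp_all)
  then interpret frobenius_tower Q u F e p .
  have gT: "g \<in> carrier (T 0)" using g by (simp only: small_tilt_eq)
  have "frobenius_tower_generator Q u F e p g"
  proof
    show "g \<in> carrier (T 0)" by (rule gT)
    fix a assume a: "a \<in> carrier (T 0)"
    have "a 0 = \<zero>\<^bsub>Q 0\<^esub> \<longleftrightarrow> a \<in> small_tilt_ideal p R t I"
      using a by (simp add: small_tilt_ideal_def a_kernel_def' small_tilt_eq)
    also have "small_tilt_ideal p R t I = PIdl\<^bsub>T 0\<^esub> g"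
      unfolding gen small_tilt_eq by (rule T.cgenideal_eq_genideal[OF gT, symmetric])
    also have "a \<in> \<dots> \<longleftrightarrow> g divides\<^bsub>T 0\<^esub> a" by (rule T.mem_cgenideal_iff[OF gT a])
    finally show "a 0 = \<zero>\<^bsub>Q 0\<^esub> \<longleftrightarrow> g divides\<^bsub>T 0\<^esub> a" .
  qed
  then interpret frobenius_tower_generator Q u F e p g .
  have "lifted_frobenius_tower R t f Q u F e p g q f1"
    by unfold_locales (use q_hom q_surj q_zero_iff u_q f1 d gen_jacobson in \<open>simp_all add: e_def\<close>)
  then show ?thesis unfolding e_def by (rule that)
qed

theorem tilt_cic:
  assumes levels: "levels_cic R t f"
    and g: "g \<in> carrier (small_tilt p R t I 0)"
    and gen: "small_tilt_ideal p R t I = Idl\<^bsub>small_tilt p R t I 0\<^esub> {g}"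
  shows "levels_cic (small_tilt p R t I) (small_tilt_map R t I) g
    \<and> colim_cic (small_tilt p R t I) (small_tilt_map R t I) g
    \<and> completed_colim_cic (small_tilt p R t I) (small_tilt_map R t I) g"
proof -
  obtain f1 where
    "lifted_frobenius_tower R t f Q u F (\<lambda>i. q (Suc i) (tower_map t 1 (Suc i) f1)) p g q f1"
    using g gen by (rule tilt_lifted_frobenius_tower)
  then interpret L: lifted_frobenius_tower R t f Q u F "\<lambda>i. q (Suc i) (tower_map t 1 (Suc i) f1)" p g q f1 .
  interpret tilt: regular_tower L.T L.tm g by (rule L.T_regular_tower)
  have "levels_cic L.T L.tm g"
    unfolding tilt.levels_cic_iff using levels L.power_closed_tilt by (simp add: levels_cic_iff)
  then show ?thesis
    unfolding small_tilt_eq small_tilt_map_eq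
    using tilt.levels_cic_iff_colim_cic tilt.colim_cic_iff_completed_colim_cic by blast
qed

end

theorem theorem1p1:
  fixes p :: nat and A :: "'a ring" and f\<^sub>0 :: 'a
    and R :: "nat \<Rightarrow> 'a ring" and t :: "nat \<Rightarrow> 'a \<Rightarrow> 'a"
  assumes "Factorial_Ring.prime p"
    and "cring A"
    and "f\<^sub>0 \<in> carrier A"
    and "perfectoid_tower p A (Idl\<^bsub>A\<^esub> {f\<^sub>0}) R t"
    and "torsion_free_elt A f\<^sub>0"
  shows "(levels_cic R t f\<^sub>0 \<longleftrightarrow> colim_cic R t f\<^sub>0)
    \<and> (colim_cic R t f\<^sub>0 \<longleftrightarrow> completed_colim_cic R t f\<^sub>0)
    \<and> (levels_cic R t f\<^sub>0 \<longrightarrow>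
        (\<forall>g \<in> carrier (small_tilt p R t (Idl\<^bsub>A\<^esub> {f\<^sub>0}) 0).
          small_tilt_ideal p R t (Idl\<^bsub>A\<^esub> {f\<^sub>0})
              = Idl\<^bsub>small_tilt p R t (Idl\<^bsub>A\<^esub> {f\<^sub>0}) 0\<^esub> {g} \<longrightarrow>
            levels_cic (small_tilt p R t (Idl\<^bsub>A\<^esub> {f\<^sub>0})) (small_tilt_map R t (Idl\<^bsub>A\<^esub> {f\<^sub>0})) g
          \<and> colim_cic (small_tilt p R t (Idl\<^bsub>A\<^esub> {f\<^sub>0})) (small_tilt_map R t (Idl\<^bsub>A\<^esub> {f\<^sub>0})) g
          \<and> completed_colim_cic (small_tilt p R t (Idl\<^bsub>A\<^esub> {f\<^sub>0})) (small_tilt_map R t (Idl\<^bsub>A\<^esub> {f\<^sub>0})) g))"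
proof -
  interpret principal_perfectoid_tower p A f\<^sub>0 R t
    using assms by (rule principal_perfectoid_tower.intro)
  show ?thesis
    using levels_cic_iff_colim_cic colim_cic_iff_completed_colim_cic tilt_cic by blast
qed

end
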